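(* Let $M$ be an $n$-dimensional compact smooth manifold with boundary, and let $\sigma\in\mathbb R$ be a constant. Then the following hold. (i) For $n\geq 4$ and $1\le k\leq n-3$: if $\gamma$ is a smooth Riemannian metric on $\partial M$ with $\operatorname{Ric}_k^\gamma\leq \sigma$ at some point of $\partial M$, then there is no smooth Riemannian metric $g$ on any collar neighborhood of $\partial M$ such that $\operatorname{Ric}_k^g>\sigma$ and $g|_{\partial M}=\gamma$. (ii) For $n\geq 3$: if $\gamma$ is a smooth Riemannian metric on $\partial M$ with $\operatorname{Ric}^\gamma\leq \sigma$, and there exists a smooth Riemannian metric $g$ on a collar neighborhood of $\partial M$ such that $\operatorname{Ric}_{n-2}^g>\sigma$ and $g|_{\partial M}=\gamma$, then the tangent bundle $T(\partial M)$ splits as a direct sum of two nontrivial subbundles.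
   Context: For a Riemannian manifold $(N,h)$, a point $p\in N$ and an orthonormal set $\{v_0;v_1,\ldots,v_k\}\subset T_pN$, the $k^{\rm th}$-intermediate Ricci curvature is $\operatorname{Ric}^h_k(v_0;v_1,\ldots,v_k)=\sum_{i=1}^k\sec^h(v_0\wedge v_i)$, where $\sec^h$ is the sectional curvature. $\operatorname{Ric}^h_k>\sigma$ means $\operatorname{Ric}^h_k(v_0;v_1,\ldots,v_k)>\sigma$ for all $p\in N$ and all orthonormal sets $\{v_0;v_1,\ldots,v_k\}\subset T_pN$; $\operatorname{Ric}^h_k\le\sigma$ at a point $p$ means $\operatorname{Ric}^h_k(v_0;v_1,\ldots,v_k)\le\sigma$ for all orthonormal sets in $T_pN$. $\operatorname{Ric}^\gamma\le\sigma$ means $\operatorname{Ric}^\gamma(v,v)\le\sigma$ for all $\gamma$-unit tangent vectors $v$ at every point of $\partial M$. $g|_{\partial M}$ is the metric induced by $g$ on $\partial M$. "Nontrivial subbundle" means a subbundle that is neither zero nor all of $T(\partial M)$ (i.e. both summands have positive rank). *)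

theory Defs
  imports "HOL-Analysis.Analysis" "HOL-Library.Function_Algebras"
begin

text \<open>Functions into a real vector space form a real vector space, pointwise. Tangent vectors are
  represented below by such functions, so that \<open>span\<close>, \<open>independent\<close> etc. apply to them.\<close>

instantiation "fun" :: (type, real_vector) real_vector
begin

definition scaleR_fun :: "real \<Rightarrow> ('a \<Rightarrow> 'b) \<Rightarrow> 'a \<Rightarrow> 'b"
  where "scaleR_fun a f = (\<lambda>x. a *\<^sub>R f x)"

instance
  by standard (simp_all add: scaleR_fun_def plus_fun_def fun_eq_iff scaleR_add_right scaleR_add_left)

end


section \<open>Smooth maps between subsets of Euclidean spaces\<close>

text \<open>\<open>Ck_on k U f\<close> is meant for open \<open>U\<close> only: all iterated directional derivatives up to order \<open>k\<close>
  exist (as Frechet derivatives) and are continuous.\<close>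

primrec Ck_on :: "nat \<Rightarrow> 'a::euclidean_space set \<Rightarrow> ('a \<Rightarrow> 'b::euclidean_space) \<Rightarrow> bool" where
  "Ck_on 0 U f \<longleftrightarrow> continuous_on U f"
| "Ck_on (Suc k) U f \<longleftrightarrow>
     (\<forall>x\<in>U. f differentiable (at x)) \<and> (\<forall>v. Ck_on k U (\<lambda>x. frechet_derivative f (at x) v))"

text \<open>On an arbitrary set (in practice a relatively open subset of a closed half-space), smoothness
  means having smooth extensions to open neighbourhoods of all points.\<close>

definition smooth_on :: "'a::euclidean_space set \<Rightarrow> ('a \<Rightarrow> 'b::euclidean_space) \<Rightarrow> bool" where
  "smooth_on S f \<longleftrightarrow>
     (\<forall>x\<in>S. \<exists>U F. open U \<and> x \<in> U \<and> (\<forall>k. Ck_on k U F) \<and> (\<forall>y\<in>S \<inter> U. F y = f y))"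


section \<open>Manifolds with boundary\<close>

text \<open>A chart is a domain together with its coordinate map; only the values on the domain matter.\<close>

type_synonym ('p, 'e) chart = "'p set \<times> ('p \<Rightarrow> 'e)"

definition chart_image :: "('p, 'e) chart \<Rightarrow> 'e set" where
  "chart_image c = snd c ` fst c"

definition chart_inv :: "('p, 'e) chart \<Rightarrow> 'e \<Rightarrow> 'p" where
  "chart_inv c = inv_into (fst c) (snd c)"

definition transition :: "('p, 'e) chart \<Rightarrow> ('p, 'e) chart \<Rightarrow> 'e \<Rightarrow> 'e" where
  "transition c d = snd d \<circ> chart_inv c"

definition transition_deriv ::
    "('p, 'e::euclidean_space) chart \<Rightarrow> ('p, 'e) chart \<Rightarrow> 'p \<Rightarrow> 'e \<Rightarrow> 'e" where
  "transition_deriv c d p =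
     frechet_derivative (transition c d) (at (snd c p) within snd c ` (fst c \<inter> fst d))"

definition smooth_atlas ::
    "'e::euclidean_space set \<Rightarrow> 'p topology \<Rightarrow> ('p, 'e) chart set \<Rightarrow> bool" where
  "smooth_atlas H X A \<longleftrightarrow>
     (\<forall>c\<in>A. openin X (fst c) \<and> openin (top_of_set H) (chart_image c) \<and>
        homeomorphic_map (subtopology X (fst c)) (top_of_set (chart_image c)) (snd c)) \<and>
     \<Union> (fst ` A) = topspace X \<and>
     (\<forall>c\<in>A. \<forall>d\<in>A. smooth_on (snd c ` (fst c \<inter> fst d)) (transition c d))"

text \<open>The half-space \<open>[0,\<infinity>) \<times> 'e\<close>, of dimension \<open>DIM('e) + 1\<close>; its boundary is modelled on \<open>'e\<close>.\<close>

definition half_space :: "(real \<times> 'e::euclidean_space) set" where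
  "half_space = {0..} \<times> UNIV"

definition smooth_manifold_with_boundary ::
    "'p topology \<Rightarrow> ('p, real \<times> 'e::euclidean_space) chart set \<Rightarrow> bool" where
  "smooth_manifold_with_boundary X A \<longleftrightarrow>
     Hausdorff_space X \<and> second_countable X \<and> smooth_atlas half_space X A"

definition manifold_boundary :: "('p, real \<times> 'e::euclidean_space) chart set \<Rightarrow> 'p set" where
  "manifold_boundary A = {p. \<exists>c\<in>A. p \<in> fst c \<and> fst (snd c p) = 0}"

definition boundary_atlas ::
    "('p, real \<times> 'e::euclidean_space) chart set \<Rightarrow> ('p, 'e) chart set" where
  "boundary_atlas A = (\<lambda>c. (fst c \<inter> manifold_boundary A, snd \<circ> snd c)) ` A"

definition restrict_atlas :: "'p set \<Rightarrow> ('p, 'e) chart set \<Rightarrow> ('p, 'e) chart set" where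
  "restrict_atlas N A = (\<lambda>c. (fst c \<inter> N, snd c)) ` A"

definition smooth_map ::
    "('p, 'e::euclidean_space) chart set \<Rightarrow> ('q, 'f::euclidean_space) chart set \<Rightarrow> ('p \<Rightarrow> 'q) \<Rightarrow> bool"
  where
  "smooth_map A B f \<longleftrightarrow>
     (\<forall>c\<in>A. \<forall>d\<in>B. smooth_on (snd c ` {p \<in> fst c. f p \<in> fst d}) (snd d \<circ> f \<circ> chart_inv c))"

definition diffeomorphism ::
    "'p topology \<Rightarrow> ('p, 'e::euclidean_space) chart set \<Rightarrow>
     'q topology \<Rightarrow> ('q, 'f::euclidean_space) chart set \<Rightarrow> ('p \<Rightarrow> 'q) \<Rightarrow> bool" where
  "diffeomorphism X A Y B f \<longleftrightarrow>
     (\<exists>f'. homeomorphic_maps X Y f f' \<and> smooth_map A B f \<and> smooth_map B A f')"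

text \<open>Charts of \<open>\<partial>M \<times> [0,1)\<close>; the collar parameter becomes the half-line coordinate.\<close>

definition cylinder_atlas ::
    "('p, real \<times> 'e::euclidean_space) chart set \<Rightarrow> ('p \<times> real, real \<times> 'e) chart set" where
  "cylinder_atlas A = (\<lambda>b. (fst b \<times> {0..<1}, \<lambda>(p, t). (t, snd b p))) ` boundary_atlas A"

text \<open>A collar neighbourhood is an open set \<open>N\<close> for which there is a diffeomorphism
  \<open>\<partial>M \<times> [0,1) \<rightarrow> N\<close> restricting to the identity \<open>\<partial>M \<times> {0} = \<partial>M\<close>.\<close>

definition collar_neighborhood ::
    "'p topology \<Rightarrow> ('p, real \<times> 'e::euclidean_space) chart set \<Rightarrow> 'p set \<Rightarrow> bool" where
  "collar_neighborhood X A N \<longleftrightarrow> openin X N \<and>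
     (\<exists>\<Phi>. (\<forall>p\<in>manifold_boundary A. \<Phi> (p, 0) = p) \<and>
        diffeomorphism
          (prod_topology (subtopology X (manifold_boundary A)) (top_of_set {0..<1})) (cylinder_atlas A)
          (subtopology X N) (restrict_atlas N A) \<Phi>)"


section \<open>Tangent vectors\<close>

text \<open>A tangent vector at \<open>p\<close> is the family of its coordinate vectors in all charts around \<open>p\<close>,
  related by the derivatives of the transition maps (and zero at all other indices).\<close>

type_synonym ('p, 'e) tvec = "('p, 'e) chart \<Rightarrow> 'e"

definition tangent_space ::
    "('p, 'e::euclidean_space) chart set \<Rightarrow> 'p \<Rightarrow> ('p, 'e) tvec set" where
  "tangent_space A p = {v.
     (\<forall>c\<in>A. \<forall>d\<in>A. p \<in> fst c \<longrightarrow> p \<in> fst d \<longrightarrow> v d = transition_deriv c d p (v c)) \<and>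
     (\<forall>c. \<not> (c \<in> A \<and> p \<in> fst c) \<longrightarrow> v c = 0)}"

text \<open>The tangent vector at \<open>p\<close> with coordinates \<open>u\<close> in the chart \<open>c\<close>.\<close>

definition tvec_of ::
    "('p, 'e::euclidean_space) chart set \<Rightarrow> ('p, 'e) chart \<Rightarrow> 'p \<Rightarrow> 'e \<Rightarrow> ('p, 'e) tvec" where
  "tvec_of A c p u = (\<lambda>d. if d \<in> A \<and> p \<in> fst d then transition_deriv c d p u else 0)"

definition some_chart :: "('p, 'e) chart set \<Rightarrow> 'p \<Rightarrow> ('p, 'e) chart" where
  "some_chart A p = (SOME c. c \<in> A \<and> p \<in> fst c)"

definition differential ::
    "('p, 'e::euclidean_space) chart set \<Rightarrow> ('q, 'f::euclidean_space) chart set \<Rightarrow> ('p \<Rightarrow> 'q) \<Rightarrow>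
     'p \<Rightarrow> ('p, 'e) tvec \<Rightarrow> ('q, 'f) tvec" where
  "differential A B f p v = (\<lambda>d. if d \<in> B \<and> f p \<in> fst d then
     (let c = some_chart A p
      in frechet_derivative (snd d \<circ> f \<circ> chart_inv c)
           (at (snd c p) within snd c ` {q \<in> fst c. f q \<in> fst d}) (v c))
     else 0)"


section \<open>Riemannian metrics and curvature\<close>

type_synonym ('p, 'e) metric = "'p \<Rightarrow> ('p, 'e) tvec \<Rightarrow> ('p, 'e) tvec \<Rightarrow> real"

definition metric_coord ::
    "('p, 'e::euclidean_space) chart set \<Rightarrow> ('p, 'e) metric \<Rightarrow> ('p, 'e) chart \<Rightarrow> 'e \<Rightarrow> 'e \<Rightarrow> 'e \<Rightarrow> real"
  where
  "metric_coord A g c x u v =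
     (let p = chart_inv c x in g p (tvec_of A c p u) (tvec_of A c p v))"

definition riemannian_metric ::
    "('p, 'e::euclidean_space) chart set \<Rightarrow> ('p, 'e) metric \<Rightarrow> bool" where
  "riemannian_metric A g \<longleftrightarrow>
     (\<forall>p\<in>\<Union> (fst ` A).
        (\<forall>u\<in>tangent_space A p. \<forall>v\<in>tangent_space A p. g p u v = g p v u) \<and>
        (\<forall>u\<in>tangent_space A p. \<forall>v\<in>tangent_space A p. \<forall>w\<in>tangent_space A p.
           g p (u + v) w = g p u w + g p v w) \<and>
        (\<forall>a. \<forall>u\<in>tangent_space A p. \<forall>v\<in>tangent_space A p. g p (a *\<^sub>R u) v = a * g p u v) \<and>
        (\<forall>u\<in>tangent_space A p. u \<noteq> 0 \<longrightarrow> g p u u > 0)) \<and>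
     (\<forall>c\<in>A. \<forall>u v. smooth_on (chart_image c) (\<lambda>x. metric_coord A g c x u v))"

definition pullback_metric ::
    "('p, 'e::euclidean_space) chart set \<Rightarrow> ('q, 'f::euclidean_space) chart set \<Rightarrow> ('p \<Rightarrow> 'q) \<Rightarrow>
     ('q, 'f) metric \<Rightarrow> ('p, 'e) metric" where
  "pullback_metric A B f g p u v = g (f p) (differential A B f p u) (differential A B f p v)"

text \<open>\<open>g|\<^bsub>\<partial>M\<^esub> = \<gamma>\<close>, where \<open>g\<close> is a metric on the open set \<open>N\<close> containing \<open>\<partial>M\<close>.\<close>

definition induces_on_boundary ::
    "('p, real \<times> 'e::euclidean_space) chart set \<Rightarrow> 'p set \<Rightarrow> ('p, real \<times> 'e) metric \<Rightarrow>
     ('p, 'e) metric \<Rightarrow> bool" where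
  "induces_on_boundary A N g \<gamma> \<longleftrightarrow>
     (\<forall>p\<in>manifold_boundary A.
        \<forall>u\<in>tangent_space (boundary_atlas A) p. \<forall>v\<in>tangent_space (boundary_atlas A) p.
          pullback_metric (boundary_atlas A) (restrict_atlas N A) (\<lambda>q. q) g p u v = \<gamma> p u v)"

text \<open>For a field \<open>h\<close> of inner products on \<open>S\<close>, \<open>christoffel S h x u v\<close> is the value at \<open>x\<close> of the
  Levi-Civita derivative of the constant field \<open>v\<close> in direction \<open>u\<close>, given by the Koszul formula.\<close>

definition christoffel ::
    "'e::euclidean_space set \<Rightarrow> ('e \<Rightarrow> 'e \<Rightarrow> 'e \<Rightarrow> real) \<Rightarrow> 'e \<Rightarrow> 'e \<Rightarrow> 'e \<Rightarrow> 'e" where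
  "christoffel S h x u v = (THE z. \<forall>w. h x z w =
     (frechet_derivative (\<lambda>y. h y v w) (at x within S) u
    + frechet_derivative (\<lambda>y. h y u w) (at x within S) v
    - frechet_derivative (\<lambda>y. h y u v) (at x within S) w) / 2)"

text \<open>Sign convention: \<open>R(u,v)w = \<nabla>\<^sub>u\<nabla>\<^sub>v w - \<nabla>\<^sub>v\<nabla>\<^sub>u w - \<nabla>\<^bsub>[u,v]\<^esub> w\<close>, evaluated on constant (hence
  commuting) fields.\<close>

definition curvature_coord ::
    "'e::euclidean_space set \<Rightarrow> ('e \<Rightarrow> 'e \<Rightarrow> 'e \<Rightarrow> real) \<Rightarrow> 'e \<Rightarrow> 'e \<Rightarrow> 'e \<Rightarrow> 'e \<Rightarrow> 'e" where
  "curvature_coord S h x u v w =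
     frechet_derivative (\<lambda>y. christoffel S h y v w) (at x within S) u
   - frechet_derivative (\<lambda>y. christoffel S h y u w) (at x within S) v
   + christoffel S h x u (christoffel S h x v w)
   - christoffel S h x v (christoffel S h x u w)"

definition riemann ::
    "('p, 'e::euclidean_space) chart set \<Rightarrow> ('p, 'e) metric \<Rightarrow> 'p \<Rightarrow>
     ('p, 'e) tvec \<Rightarrow> ('p, 'e) tvec \<Rightarrow> ('p, 'e) tvec \<Rightarrow> ('p, 'e) tvec" where
  "riemann A g p u v w = (\<lambda>c. if c \<in> A \<and> p \<in> fst c then
     curvature_coord (chart_image c) (metric_coord A g c) (snd c p) (u c) (v c) (w c) else 0)"

definition sectional_curvature ::
    "('p, 'e::euclidean_space) chart set \<Rightarrow> ('p, 'e) metric \<Rightarrow> 'p \<Rightarrow>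
     ('p, 'e) tvec \<Rightarrow> ('p, 'e) tvec \<Rightarrow> real" where
  "sectional_curvature A g p u v =
     g p (riemann A g p u v v) u / (g p u u * g p v v - (g p u v)\<^sup>2)"

text \<open>The trace of \<open>w \<mapsto> R(w,u)v\<close>, computed in coordinates.\<close>

definition ricci ::
    "('p, 'e::euclidean_space) chart set \<Rightarrow> ('p, 'e) metric \<Rightarrow> 'p \<Rightarrow>
     ('p, 'e) tvec \<Rightarrow> ('p, 'e) tvec \<Rightarrow> real" where
  "ricci A g p u v = (let c = some_chart A p
     in \<Sum>b\<in>Basis. riemann A g p (tvec_of A c p b) u v c \<bullet> b)"

text \<open>Orthonormal sets \<open>{v 0; v 1, \<dots>, v k}\<close> in the tangent space at \<open>p\<close>.\<close>

definition orthonormal_at ::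
    "('p, 'e::euclidean_space) chart set \<Rightarrow> ('p, 'e) metric \<Rightarrow> 'p \<Rightarrow> nat \<Rightarrow>
     (nat \<Rightarrow> ('p, 'e) tvec) \<Rightarrow> bool" where
  "orthonormal_at A g p k v \<longleftrightarrow>
     (\<forall>i\<le>k. v i \<in> tangent_space A p) \<and>
     (\<forall>i\<le>k. \<forall>j\<le>k. g p (v i) (v j) = (if i = j then 1 else 0))"

definition intermediate_ricci ::
    "('p, 'e::euclidean_space) chart set \<Rightarrow> ('p, 'e) metric \<Rightarrow> nat \<Rightarrow> 'p \<Rightarrow>
     (nat \<Rightarrow> ('p, 'e) tvec) \<Rightarrow> real" where
  "intermediate_ricci A g k p v = (\<Sum>i=1..k. sectional_curvature A g p (v 0) (v i))"

definition intermediate_ricci_gt ::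
    "('p, 'e::euclidean_space) chart set \<Rightarrow> ('p, 'e) metric \<Rightarrow> nat \<Rightarrow> real \<Rightarrow> bool" where
  "intermediate_ricci_gt A g k \<sigma> \<longleftrightarrow>
     (\<forall>p\<in>\<Union> (fst ` A). \<forall>v. orthonormal_at A g p k v \<longrightarrow> intermediate_ricci A g k p v > \<sigma>)"

definition intermediate_ricci_le_at ::
    "('p, 'e::euclidean_space) chart set \<Rightarrow> ('p, 'e) metric \<Rightarrow> nat \<Rightarrow> 'p \<Rightarrow> real \<Rightarrow> bool" where
  "intermediate_ricci_le_at A g k p \<sigma> \<longleftrightarrow>
     (\<forall>v. orthonormal_at A g p k v \<longrightarrow> intermediate_ricci A g k p v \<le> \<sigma>)"

definition ricci_le ::
    "('p, 'e::euclidean_space) chart set \<Rightarrow> ('p, 'e) metric \<Rightarrow> real \<Rightarrow> bool" where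
  "ricci_le A g \<sigma> \<longleftrightarrow>
     (\<forall>p\<in>\<Union> (fst ` A). \<forall>v\<in>tangent_space A p. g p v v = 1 \<longrightarrow> ricci A g p v v \<le> \<sigma>)"


section \<open>Subbundles of the tangent bundle\<close>

definition smooth_vector_field_on ::
    "('p, 'e::euclidean_space) chart set \<Rightarrow> 'p set \<Rightarrow> ('p \<Rightarrow> ('p, 'e) tvec) \<Rightarrow> bool" where
  "smooth_vector_field_on A U Y \<longleftrightarrow>
     (\<forall>q\<in>U. Y q \<in> tangent_space A q) \<and>
     (\<forall>c\<in>A. smooth_on (snd c ` (fst c \<inter> U)) (\<lambda>x. Y (chart_inv c x) c))"

text \<open>A family of subspaces spanned near every point by a smooth local frame.  The rank is locally
  constant, and may differ between components of the base.\<close>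

definition smooth_subbundle ::
    "'p topology \<Rightarrow> ('p, 'e::euclidean_space) chart set \<Rightarrow> ('p \<Rightarrow> ('p, 'e) tvec set) \<Rightarrow> bool" where
  "smooth_subbundle X A D \<longleftrightarrow>
     (\<forall>p\<in>topspace X. \<exists>U (r::nat) Y. openin X U \<and> p \<in> U \<and>
        (\<forall>i<r. smooth_vector_field_on A U (Y i)) \<and>
        (\<forall>q\<in>U. inj_on (\<lambda>i. Y i q) {..<r} \<and> independent ((\<lambda>i. Y i q) ` {..<r}) \<and>
           D q = span ((\<lambda>i. Y i q) ` {..<r})))"

text \<open>The tangent bundle is an internal direct sum of two subbundles, both of positive rank
  at every point.\<close>

definition tangent_bundle_splits ::
    "'p topology \<Rightarrow> ('p, 'e::euclidean_space) chart set \<Rightarrow> bool" where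
  "tangent_bundle_splits X A \<longleftrightarrow>
     (\<exists>D E. smooth_subbundle X A D \<and> smooth_subbundle X A E \<and>
        (\<forall>p\<in>topspace X. D p \<inter> E p = {0} \<and>
           tangent_space A p = {u + v |u v. u \<in> D p \<and> v \<in> E p} \<and>
           D p \<noteq> {0} \<and> E p \<noteq> {0}))"

end

theory Submission
  imports Defs
begin

text \<open>
  Write \<open>B\<close> for the second fundamental form of \<open>\<partial>M\<close> in the collar and \<open>\<lambda>\<^sub>1, \<dots>, \<lambda>\<^sub>m\<close> (\<open>m = n - 1\<close>) for its
  eigenvalues with respect to \<open>\<gamma>\<close>, with orthonormal eigenvectors \<open>e\<^sub>i\<close>.  By the Gauss equation
  \<open>sec\<^sup>g(e\<^sub>a, e\<^sub>i) = sec\<^sup>\<gamma>(e\<^sub>a, e\<^sub>i) - \<lambda>\<^sub>a \<lambda>\<^sub>i\<close> for \<open>i \<noteq> a\<close>.  Summing over a set \<open>K\<close> of \<open>k\<close> indices with \<open>a \<notin> K\<close>,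
  the left-hand side exceeds \<open>\<sigma>\<close> while the curvatures of \<open>\<gamma>\<close> contribute at most \<open>\<sigma>\<close>; hence
  \<open>\<lambda>\<^sub>a \<cdot> (\<Sum>i\<in>K. \<lambda>\<^sub>i) < 0\<close> (\<open>eigenvalue_products_negative\<close>).  The rest is about signs.

  In part (i) this holds at the given point for all such \<open>a\<close> and \<open>K\<close>.  Since \<open>k + 2 \<le> m\<close>, for any \<open>a \<noteq> b\<close>
  there is a \<open>K\<close> that avoids both; the same sum over \<open>K\<close> has the sign opposite to \<open>\<lambda>\<^sub>a\<close> and to \<open>\<lambda>\<^sub>b\<close>,
  hence all eigenvalues have one common sign, and then the products cannot be negative
  (\<open>no_eigenvalues_with_negative_partial_sums\<close>).

  In part (ii) it holds everywhere: here \<open>k = m - 1\<close>, and the sum of \<open>sec\<^sup>\<gamma>(e\<^sub>a, e\<^sub>i)\<close> over all \<open>i \<noteq> a\<close> is the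
  Ricci curvature of \<open>e\<^sub>a\<close>.  Now \<open>\<lambda>\<^sub>a \<cdot> (\<Sum>i\<noteq>a. \<lambda>\<^sub>i) < 0\<close> for all \<open>a\<close> forces \<open>B\<close> to be nondegenerate and
  indefinite (\<open>eigenvalues_of_both_signs\<close>).  The sums of the eigenspaces for the positive and for the negative
  eigenvalues are then two complementary nonzero subbundles.  They are smooth because they are the
  ranges of \<open>\<bar>L\<bar> \<plusminus> L\<close>, where \<open>L\<close> is the shape operator and \<open>\<bar>L\<bar>\<close> the positive square root of \<open>L\<^sup>2\<close>,
  and this root is smooth (\<open>square_root_Ck\<close>, \<open>smooth_absolute_value\<close>, \<open>eigen_span_frame\<close>).

  The geometry is done in coordinates.  Two devices keep it short.  First, in a boundary chart \<open>B\<close> is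
  represented by the transversal component of the Christoffel symbols, that is, up to a positive
  factor, which leaves the signs of eigenvalues unchanged.  Second, the Gauss
  equation is read off from the curvature tensor with all indices lowered (\<open>curvature_lowered\<close>), where
  second derivatives of the metric occur in tangential directions only.  All derivatives are taken
  within sets that determine them uniquely (\<open>thick\<close>), so that interior, boundary and half-space charts are
  treated alike; the tensor transformation law of the curvature (\<open>curvature_change\<close>) makes the
  coordinate expressions independent of the chart.
\<close>

section \<open>Calculus of continuously differentiable maps\<close>

lemma Ck_on_cong:
  assumes "open U" "\<And>x. x \<in> U \<Longrightarrow> f x = g x"
  shows "Ck_on k U f \<longleftrightarrow> Ck_on k U g"
  using assms(2)
proof (induction k arbitrary: f g)
  case 0
  then show ?case by (auto cong: continuous_on_cong)
next
  case (Suc k)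
  have D: "(f has_derivative f') (at x) \<longleftrightarrow> (g has_derivative f') (at x)" if "x \<in> U" for x f'
    using has_derivative_transform_within_open[OF _ \<open>open U\<close> that] Suc.prems by metis
  have diff: "f differentiable (at x) \<longleftrightarrow> g differentiable (at x)" if "x \<in> U" for x
    using D[OF that] by (simp add: differentiable_def)
  have fd: "frechet_derivative f (at x) = frechet_derivative g (at x)" if "x \<in> U" for x
    using D[OF that] by (simp add: frechet_derivative_def)
  show ?case
    using diff Suc.IH[of "\<lambda>x. frechet_derivative f (at x) _" "\<lambda>x. frechet_derivative g (at x) _"] fd
    by (auto simp del: Ck_on.simps(1))
qed

lemma Ck_on_subset:
  assumes "Ck_on k U f" "V \<subseteq> U"
  shows "Ck_on k V f"
  using assms by (induction k arbitrary: f) (auto intro: continuous_on_subset)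

text \<open>Any formula for the derivative serves to climb one order; this is how all closure properties below are proved.\<close>

lemma Ck_on_SucI:
  assumes U: "open U" and D: "\<And>x. x \<in> U \<Longrightarrow> (f has_derivative f' x) (at x)"
    and C: "\<And>v. Ck_on k U (\<lambda>x. f' x v)"
  shows "Ck_on (Suc k) U f"
proof -
  have "Ck_on k U (\<lambda>x. frechet_derivative f (at x) v)" for v
    using C[of v] frechet_derivative_at[OF D]
    by (subst Ck_on_cong[OF U, where g = "\<lambda>x. f' x v"]) auto
  then show ?thesis
    using D by (auto simp: differentiable_def)
qed

lemma Ck_on_SucD:
  assumes "Ck_on (Suc k) U f" "x \<in> U"
  shows "(f has_derivative frechet_derivative f (at x)) (at x)"
  using assms by (auto simp: frechet_derivative_works[symmetric])

lemma Ck_on_lower: "Ck_on (Suc k) U f \<Longrightarrow> Ck_on k U f"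
proof (induction k arbitrary: f)
  case 0
  then show ?case
    by (simp add: continuous_at_imp_continuous_on differentiable_imp_continuous_within)
next
  case (Suc k)
  then show ?case by auto
qed

lemma Ck_on_imp_continuous_on: "Ck_on k U f \<Longrightarrow> continuous_on U f"
  by (induction k) (auto dest: Ck_on_lower simp del: Ck_on.simps(2))

lemma Ck_on_const: "Ck_on k U (\<lambda>x. c)"
  by (induction k arbitrary: c) (auto simp: frechet_derivative_const)

lemma Ck_on_bounded_linear:
  assumes U: "open U" and L: "bounded_linear L" and f: "Ck_on k U f"
  shows "Ck_on k U (\<lambda>x. L (f x))"
  using f
proof (induction k arbitrary: f)
  case 0
  then show ?case
    using bounded_linear.continuous_on[OF L] by auto
next
  case (Suc k)
  show ?case
  proof (rule Ck_on_SucI[OF U])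
    show "((\<lambda>x. L (f x)) has_derivative (\<lambda>v. L (frechet_derivative f (at x) v))) (at x)" if "x \<in> U" for x
      using bounded_linear.has_derivative[OF L Ck_on_SucD[OF Suc.prems that]] .
  qed (use Suc in auto)
qed

lemma Ck_on_id: "Ck_on k U (\<lambda>x. x)"
  by (cases k) (auto simp: frechet_derivative_ident Ck_on_const)

lemma Ck_on_linear: "open U \<Longrightarrow> bounded_linear L \<Longrightarrow> Ck_on k U L"
  using Ck_on_bounded_linear[OF _ _ Ck_on_id] .

lemma Ck_on_add:
  assumes U: "open U" and "Ck_on k U f" "Ck_on k U g"
  shows "Ck_on k U (\<lambda>x. f x + g x)"
  using assms(2,3)
proof (induction k arbitrary: f g)
  case 0
  then show ?case by (auto intro: continuous_intros)
next
  case (Suc k)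
  show ?case
  proof (rule Ck_on_SucI[OF U])
    show "((\<lambda>x. f x + g x) has_derivative
        (\<lambda>v. frechet_derivative f (at x) v + frechet_derivative g (at x) v)) (at x)" if "x \<in> U" for x
      using Ck_on_SucD[OF Suc.prems(1) that] Ck_on_SucD[OF Suc.prems(2) that]
      by (rule has_derivative_add)
  qed (use Suc in auto)
qed

lemma Ck_on_sum:
  assumes U: "open U" and "\<And>i. i \<in> I \<Longrightarrow> Ck_on k U (f i)"
  shows "Ck_on k U (\<lambda>x. \<Sum>i\<in>I. f i x)"
  using assms(2) by (induction I rule: infinite_finite_induct) (auto simp: Ck_on_const Ck_on_add[OF U])

lemma Ck_on_bilinear:
  assumes U: "open U" and P: "bounded_bilinear P" and "Ck_on k U f" "Ck_on k U g"
  shows "Ck_on k U (\<lambda>x. P (f x) (g x))"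
  using assms(3,4)
proof (induction k arbitrary: f g)
  case 0
  then show ?case using bounded_bilinear.continuous_on[OF P] by auto
next
  case (Suc k)
  show ?case
  proof (rule Ck_on_SucI[OF U])
    show "((\<lambda>x. P (f x) (g x)) has_derivative
        (\<lambda>v. P (f x) (frechet_derivative g (at x) v) + P (frechet_derivative f (at x) v) (g x))) (at x)"
      if "x \<in> U" for x
      using bounded_bilinear.FDERIV[OF P Ck_on_SucD[OF Suc.prems(1) that] Ck_on_SucD[OF Suc.prems(2) that]] .
    show "Ck_on k U (\<lambda>x. P (f x) (frechet_derivative g (at x) v) + P (frechet_derivative f (at x) v) (g x))" for v
      using Suc.prems Ck_on_lower[OF Suc.prems(1)] Ck_on_lower[OF Suc.prems(2)]
      by (intro Ck_on_add[OF U] Suc.IH) auto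
  qed
qed

lemma linear_basis_expansion:
  fixes T :: "'a::euclidean_space \<Rightarrow> 'b::real_vector"
  assumes "linear T"
  shows "T v = (\<Sum>b\<in>Basis. (v \<bullet> b) *\<^sub>R T b)"
proof -
  have "T v = T (\<Sum>b\<in>Basis. (v \<bullet> b) *\<^sub>R b)" by (simp only: euclidean_representation)
  also have "\<dots> = (\<Sum>b\<in>Basis. (v \<bullet> b) *\<^sub>R T b)"
    by (simp only: linear_sum[OF assms] linear_scale[OF assms])
  finally show ?thesis .
qed

text \<open>The chain rule evaluates the derivative of the outer map on a moving vector.  Since the order of
  differentiability is defined through derivatives in fixed directions, that vector is expanded in the basis.\<close>

lemma Ck_on_compose:
  fixes f :: "'b::euclidean_space \<Rightarrow> 'c::euclidean_space" and g :: "'a::euclidean_space \<Rightarrow> 'b"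
  assumes U: "open U" and V: "open V" and "Ck_on k V f" "Ck_on k U g" "g ` U \<subseteq> V"
  shows "Ck_on k U (\<lambda>x. f (g x))"
  using assms(3,4)
proof (induction k arbitrary: f)
  case 0
  then show ?case using assms(5) by (auto intro: continuous_on_compose2)
next
  case (Suc k)
  let ?f' = "\<lambda>x. frechet_derivative f (at x)" and ?g' = "\<lambda>x. frechet_derivative g (at x)"
  have g: "Ck_on k U g" "\<And>v. Ck_on k U (\<lambda>x. ?g' x v)"
    using Suc.prems Ck_on_lower[of k U g] by auto
  show ?case
  proof (rule Ck_on_SucI[OF U])
    fix x assume x: "x \<in> U"
    then have gx: "g x \<in> V" using assms(5) by auto
    have "((\<lambda>x. f (g x)) has_derivative (\<lambda>v. ?f' (g x) (?g' x v))) (at x)"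
      using has_derivative_compose[OF Ck_on_SucD[OF Suc.prems(2) x] Ck_on_SucD[OF Suc.prems(1) gx]] .
    moreover have "linear (?f' (g x))"
      using Ck_on_SucD[OF Suc.prems(1) gx] has_derivative_linear by blast
    ultimately show "((\<lambda>x. f (g x)) has_derivative
        (\<lambda>v. \<Sum>b\<in>Basis. (?g' x v \<bullet> b) *\<^sub>R ?f' (g x) b)) (at x)"
      by (simp add: linear_basis_expansion[of "?f' (g x)", symmetric])
  next
    fix v
    show "Ck_on k U (\<lambda>x. \<Sum>b\<in>Basis. (?g' x v \<bullet> b) *\<^sub>R ?f' (g x) b)"
      using g Suc.prems
      by (intro Ck_on_sum[OF U] Ck_on_bilinear[OF U bounded_bilinear_scaleR] Ck_on_bilinear[OF U bounded_bilinear_inner]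
          Ck_on_const Suc.IH) auto
  qed
qed

lemma Ck_on_Pair:
  assumes U: "open U" and "Ck_on k U f" "Ck_on k U g"
  shows "Ck_on k U (\<lambda>x. (f x, g x))"
proof -
  have "Ck_on k U (\<lambda>x. (f x, 0) + (0, g x))"
    using assms by (intro Ck_on_add[OF U] Ck_on_bounded_linear[OF U _ assms(2)] Ck_on_bounded_linear[OF U _ assms(3)])
      (auto intro!: bounded_linear_intros bounded_linear_Pair)
  then show ?thesis by simp
qed

subsection \<open>Symmetry of second derivatives\<close>

text \<open>The mean value theorem in direction \<open>v\<close>, applied to the increment of \<open>f\<close> in direction \<open>u\<close>.  The second
  difference quotient on the left is symmetric in \<open>u\<close> and \<open>v\<close>, which gives the symmetry of second derivatives.\<close>

lemma second_difference_approximation: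
  fixes f :: "'a::euclidean_space \<Rightarrow> real"
  assumes U: "open U" "x \<in> U" and f': "\<And>y. y \<in> U \<Longrightarrow> (f has_derivative f' y) (at y)"
    and L: "((\<lambda>y. f' y v) has_derivative L) (at x)" and e: "e > 0"
  shows "\<exists>d>0. \<forall>s. 0 < s \<and> s < d \<longrightarrow>
    \<bar>f (x + s *\<^sub>R u + s *\<^sub>R v) - f (x + s *\<^sub>R u) - f (x + s *\<^sub>R v) + f x - s\<^sup>2 * L u\<bar> \<le> e * s\<^sup>2"
proof -
  define \<eta> where "\<eta> = e / (norm u + 2 * norm v + 1)"
  have pos: "norm u + 2 * norm v + 1 > 0" using norm_ge_zero[of u] norm_ge_zero[of v] by linarith
  have \<eta>: "\<eta> > 0" using e pos by (simp add: \<eta>_def)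
  obtain r where r: "r > 0" "ball x r \<subseteq> U" using U open_contains_ball by blast
  have "bounded_linear L" using L has_derivative_bounded_linear by blast
  then have linL: "linear L" by (simp add: linear_conv_bounded_linear)
  obtain d0 where d0: "d0 > 0" "\<And>y. norm (y - x) < d0 \<Longrightarrow> norm (f' y v - f' x v - L (y - x)) \<le> \<eta> * norm (y - x)"
    using L \<eta> unfolding has_derivative_at_alt by blast
  define d where "d = min r d0 / (norm u + 2 * norm v + 1)"
  have d: "d > 0" using r(1) d0(1) pos by (simp add: d_def)
  show ?thesis
  proof (intro exI[of _ d] conjI allI impI d)
    fix s assume s: "0 < s \<and> s < d"
    have small: "s * (norm u + 2 * norm v + 1) < min r d0"
      using s pos by (simp add: d_def pos_less_divide_eq)
    have near: "norm (a *\<^sub>R u + t *\<^sub>R v) \<le> s * norm u + s * norm v"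
      if "0 \<le> t" "t \<le> s" "0 \<le> a" "a \<le> s" for t a
    proof -
      have "norm (a *\<^sub>R u + t *\<^sub>R v) \<le> a * norm u + t * norm v"
        using that by (metis abs_of_nonneg norm_scaleR norm_triangle_ineq)
      also have "\<dots> \<le> s * norm u + s * norm v"
        using that by (intro add_mono mult_right_mono) auto
      finally show ?thesis .
    qed
    have sum_small: "s * norm u + s * norm v < min r d0"
    proof -
      have "s * norm u + s * norm v \<le> s * (norm u + 2 * norm v + 1)"
        using s by (simp add: algebra_simps)
      then show ?thesis using small by linarith
    qed
    have inU: "x + (a *\<^sub>R u + t *\<^sub>R v) \<in> U" if "0 \<le> t" "t \<le> s" "0 \<le> a" "a \<le> s" for t a
    proof -
      have "dist x (x + (a *\<^sub>R u + t *\<^sub>R v)) < r"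
        using near[OF that] sum_small by (metis add_diff_cancel_left' dist_commute dist_norm min_less_iff_conj order_le_less_trans)
      then show ?thesis using r(2) by auto
    qed
    define \<phi> where "\<phi> = (\<lambda>t. f (x + (s *\<^sub>R u + t *\<^sub>R v)) - f (x + (0 *\<^sub>R u + t *\<^sub>R v)))"
    define \<phi>' where "\<phi>' = (\<lambda>t. f' (x + (s *\<^sub>R u + t *\<^sub>R v)) v - f' (x + (0 *\<^sub>R u + t *\<^sub>R v)) v)"
    have D: "(\<phi> has_real_derivative \<phi>' t) (at t)" if t: "0 \<le> t" "t \<le> s" for t
    proof -
      have lin: "linear (f' (x + (a *\<^sub>R u + t *\<^sub>R v)))" if "0 \<le> a" "a \<le> s" for a
        using f'[OF inU[OF t that]] has_derivative_linear by blast
      have DD: "((\<lambda>t. f (x + (a *\<^sub>R u + t *\<^sub>R v))) has_derivative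
          (\<lambda>h. f' (x + (a *\<^sub>R u + t *\<^sub>R v)) (h *\<^sub>R v))) (at t)" if "0 \<le> a" "a \<le> s" for a
      proof (rule has_derivative_compose[where g = f])
        show "(f has_derivative f' (x + (a *\<^sub>R u + t *\<^sub>R v))) (at (x + (a *\<^sub>R u + t *\<^sub>R v)))"
          using f'[OF inU[OF t that]] .
      qed (auto intro!: derivative_eq_intros)
      have "(\<phi> has_derivative (\<lambda>h. f' (x + (s *\<^sub>R u + t *\<^sub>R v)) (h *\<^sub>R v) - f' (x + (0 *\<^sub>R u + t *\<^sub>R v)) (h *\<^sub>R v))) (at t)"
        unfolding \<phi>_def using s by (intro has_derivative_diff DD) auto
      moreover have "f' (x + (a *\<^sub>R u + t *\<^sub>R v)) (h *\<^sub>R v) = h * f' (x + (a *\<^sub>R u + t *\<^sub>R v)) v"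
        if "0 \<le> a" "a \<le> s" for a h
        using linear_scale[OF lin[OF that]] by simp
      note this[of s] this[of 0]
      moreover have "(*) (p - q) = (\<lambda>h. h * p - h * q)" for p q :: real
        by (auto simp: fun_eq_iff algebra_simps)
      ultimately show ?thesis
        using s by (simp add: has_field_derivative_def \<phi>'_def)
    qed
    have "\<exists>z>0. z < s \<and> \<phi> s - \<phi> 0 = (s - 0) * \<phi>' z"
      using s by (intro MVT2 D) auto
    then obtain \<xi> where \<xi>: "0 < \<xi>" "\<xi> < s" "\<phi> s - \<phi> 0 = s * \<phi>' \<xi>" by auto
    have est: "\<bar>f' (x + (a *\<^sub>R u + \<xi> *\<^sub>R v)) v - f' x v - L (a *\<^sub>R u + \<xi> *\<^sub>R v)\<bar> \<le> \<eta> * norm (a *\<^sub>R u + \<xi> *\<^sub>R v)"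
      if "0 \<le> a" "a \<le> s" for a
      using d0(2)[of "x + (a *\<^sub>R u + \<xi> *\<^sub>R v)"] near[of \<xi> a] \<xi> that sum_small by auto
    have n1: "norm (s *\<^sub>R u + \<xi> *\<^sub>R v) \<le> s * norm u + s * norm v"
      using near[of \<xi> s] \<xi> s by auto
    have n0: "norm (0 *\<^sub>R u + \<xi> *\<^sub>R v) \<le> s * norm v"
      using \<xi> by (simp add: mult_right_mono)
    have "\<bar>\<phi>' \<xi> - s * L u\<bar> \<le> \<eta> * norm (s *\<^sub>R u + \<xi> *\<^sub>R v) + \<eta> * norm (0 *\<^sub>R u + \<xi> *\<^sub>R v)"
      using est[of s] est[of 0] s \<xi> unfolding \<phi>'_def
      by (simp add: linear_add[OF linL] linear_scale[OF linL] linear_0[OF linL])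
    also have "\<dots> \<le> \<eta> * (s * norm u + s * norm v) + \<eta> * (s * norm v)"
      using n1 n0 \<eta> by (intro add_mono mult_left_mono) auto
    also have "\<dots> \<le> \<eta> * (s * (norm u + 2 * norm v + 1))"
      using \<eta> s by (simp add: algebra_simps)
    also have "\<dots> = e * s" using pos by (simp add: \<eta>_def)
    finally have "s * \<bar>\<phi>' \<xi> - s * L u\<bar> \<le> s * (e * s)" using s by (intro mult_left_mono) auto
    moreover have "f (x + s *\<^sub>R u + s *\<^sub>R v) - f (x + s *\<^sub>R u) - f (x + s *\<^sub>R v) + f x = \<phi> s - \<phi> 0"
      by (simp add: \<phi>_def add.assoc)
    moreover have "s * \<bar>\<phi>' \<xi> - s * L u\<bar> = \<bar>s * \<phi>' \<xi> - s\<^sup>2 * L u\<bar>"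
    proof -
      have "s * \<phi>' \<xi> - s\<^sup>2 * L u = s * (\<phi>' \<xi> - s * L u)" by (simp add: power2_eq_square algebra_simps)
      then show ?thesis using s by (simp only: abs_mult) simp
    qed
    ultimately show "\<bar>f (x + s *\<^sub>R u + s *\<^sub>R v) - f (x + s *\<^sub>R u) - f (x + s *\<^sub>R v) + f x - s\<^sup>2 * L u\<bar> \<le> e * s\<^sup>2"
      using \<xi>(3) by (simp add: power2_eq_square mult.left_commute mult.commute)
  qed
qed

lemma second_derivative_symmetric_real:
  fixes f :: "'a::euclidean_space \<Rightarrow> real"
  assumes U: "open U" "x \<in> U" and f': "\<And>y. y \<in> U \<Longrightarrow> (f has_derivative f' y) (at y)"
    and L: "\<And>v. ((\<lambda>y. f' y v) has_derivative L v) (at x)"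
  shows "L v u = L u v"
proof -
  have "\<bar>L v u - L u v\<bar> \<le> e" if e: "e > 0" for e
  proof -
    obtain d1 where d1: "d1 > 0" "\<And>s. 0 < s \<Longrightarrow> s < d1 \<Longrightarrow>
      \<bar>f (x + s *\<^sub>R u + s *\<^sub>R v) - f (x + s *\<^sub>R u) - f (x + s *\<^sub>R v) + f x - s\<^sup>2 * L v u\<bar> \<le> e / 2 * s\<^sup>2"
      using second_difference_approximation[OF U f' L, where v = v and u = u and e = "e / 2"] e by auto
    obtain d2 where d2: "d2 > 0" "\<And>s. 0 < s \<Longrightarrow> s < d2 \<Longrightarrow>
      \<bar>f (x + s *\<^sub>R v + s *\<^sub>R u) - f (x + s *\<^sub>R v) - f (x + s *\<^sub>R u) + f x - s\<^sup>2 * L u v\<bar> \<le> e / 2 * s\<^sup>2"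
      using second_difference_approximation[OF U f' L, where v = u and u = v and e = "e / 2"] e by auto
    define s where "s = min d1 d2 / 2"
    have s: "0 < s" "s < d1" "s < d2" using d1(1) d2(1) by (auto simp: s_def)
    have eq: "x + s *\<^sub>R v + s *\<^sub>R u = x + s *\<^sub>R u + s *\<^sub>R v" by simp
    have "\<bar>s\<^sup>2 * L v u - s\<^sup>2 * L u v\<bar> \<le> e / 2 * s\<^sup>2 + e / 2 * s\<^sup>2"
      using d1(2)[OF s(1,2)] d2(2)[OF s(1,3)] unfolding eq by linarith
    also have "\<bar>s\<^sup>2 * L v u - s\<^sup>2 * L u v\<bar> = s\<^sup>2 * \<bar>L v u - L u v\<bar>"
      by (simp add: abs_mult flip: right_diff_distrib)
    finally have "s\<^sup>2 * \<bar>L v u - L u v\<bar> \<le> s\<^sup>2 * e" by (simp add: mult.commute)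
    then show ?thesis using s(1) by simp
  qed
  then have "\<bar>L v u - L u v\<bar> \<le> 0" by (rule field_le_epsilon[where y = 0, simplified])
  then show ?thesis by simp
qed

lemma second_derivative_symmetric:
  fixes f :: "'a::euclidean_space \<Rightarrow> 'b::euclidean_space"
  assumes U: "open U" "x \<in> U" and f: "Ck_on (Suc (Suc k)) U f"
  shows "frechet_derivative (\<lambda>y. frechet_derivative f (at y) v) (at x) u =
    frechet_derivative (\<lambda>y. frechet_derivative f (at y) u) (at x) v"
proof (rule euclidean_eqI)
  fix b :: 'b assume "b \<in> Basis"
  let ?L = "\<lambda>v. frechet_derivative (\<lambda>y. frechet_derivative f (at y) v) (at x)"
  have "((\<lambda>y. f y \<bullet> b) has_derivative (\<lambda>v. frechet_derivative f (at y) v \<bullet> b)) (at y)" if "y \<in> U" for y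
    by (intro has_derivative_inner_left Ck_on_SucD[OF f that])
  moreover have "((\<lambda>y. frechet_derivative f (at y) v \<bullet> b) has_derivative (\<lambda>u. ?L v u \<bullet> b)) (at x)" for v
    using f by (intro has_derivative_inner_left Ck_on_SucD[OF _ U(2)]) auto
  ultimately show "?L v u \<bullet> b = ?L u v \<bullet> b"
    by (rule second_derivative_symmetric_real[OF U])
qed

subsection \<open>Linear equations with varying coefficients\<close>

lemma linear_family_difference_bound:
  fixes T T' :: "'b::euclidean_space \<Rightarrow> 'c::real_normed_vector"
  assumes "linear T" "linear T'"
  shows "norm (T z - T' z) \<le> (\<Sum>b\<in>Basis. norm (T b - T' b)) * norm z"
proof -
  have "T z - T' z = (\<Sum>b\<in>Basis. (z \<bullet> b) *\<^sub>R (T b - T' b))"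
    by (simp add: linear_basis_expansion[OF assms(1), of z] linear_basis_expansion[OF assms(2), of z]
        scaleR_diff_right sum_subtractf)
  also have "norm \<dots> \<le> (\<Sum>b\<in>Basis. norm ((z \<bullet> b) *\<^sub>R (T b - T' b)))" by (rule norm_sum)
  also have "\<dots> \<le> (\<Sum>b\<in>Basis. norm z * norm (T b - T' b))"
    by (intro sum_mono) (auto intro!: mult_right_mono Basis_le_norm)
  finally show ?thesis by (simp add: sum_distrib_left mult.commute)
qed

text \<open>Injectivity of a linear map on a Euclidean space is a quantitative and therefore open condition.\<close>

lemma linear_family_bounded_below_nearby:
  fixes T :: "'a::metric_space \<Rightarrow> 'b::euclidean_space \<Rightarrow> 'c::euclidean_space"
  assumes lin: "\<forall>\<^sub>F y in at x. linear (T y)" "linear (T x)" and inj: "inj (T x)"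
    and cont: "\<And>b. b \<in> Basis \<Longrightarrow> isCont (\<lambda>y. T y b) x"
  obtains c where "c > 0" "\<forall>\<^sub>F y in nhds x. \<forall>z. c * norm z \<le> norm (T y z)"
proof -
  obtain B where B: "B > 0" "\<And>z. B * norm z \<le> norm (T x z)"
    using linear_inj_bounded_below_pos[OF lin(2) inj] by metis
  let ?E = "\<lambda>y. \<Sum>b\<in>Basis. norm (T y b - T x b)"
  have "(?E \<longlongrightarrow> (\<Sum>b\<in>(Basis::'b set). 0)) (at x)"
    by (intro tendsto_sum tendsto_norm_zero LIM_zero isContD cont)
  then have "(?E \<longlongrightarrow> 0) (at x)" by simp
  then have "\<forall>\<^sub>F y in at x. ?E y < B / 2"
    using B(1) order_tendstoD(2)[of ?E 0 "at x" "B / 2"] by simp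
  then have "\<forall>\<^sub>F y in at x. \<forall>z. B / 2 * norm z \<le> norm (T y z)"
    using lin(1)
  proof eventually_elim
    case (elim y)
    show ?case
    proof
      fix z
      have "norm (T y z - T x z) \<le> B / 2 * norm z"
        using linear_family_difference_bound[OF elim(2) lin(2), of z] elim(1)
        by (meson less_imp_le mult_right_mono norm_ge_zero order_trans)
      moreover have "norm (T x z) \<le> norm (T y z) + norm (T y z - T x z)"
        by (metis norm_minus_commute norm_triangle_sub)
      ultimately show "B / 2 * norm z \<le> norm (T y z)"
        using B(2)[of z] by simp
    qed
  qed
  moreover have "\<forall>z. B / 2 * norm z \<le> norm (T x z)"
  proof
    fix z :: 'b
    have "B / 2 * norm z \<le> B * norm z" using B(1) by (intro mult_right_mono) auto
    then show "B / 2 * norm z \<le> norm (T x z)" using B(2)[of z] by linarith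
  qed
  ultimately have "\<forall>\<^sub>F y in nhds x. \<forall>z. B / 2 * norm z \<le> norm (T y z)"
    by (auto simp: eventually_at_filter elim: eventually_mono)
  then show thesis using that[of "B/2"] B(1) by auto
qed

text \<open>Because \<open>w\<close> vanishes at \<open>x\<close>, the product rule contains no derivative of the coefficients \<open>T\<close>: their
  continuity at \<open>x\<close> is enough.  This matters for square roots below, where \<open>T\<close> depends on the unknown
  function itself.\<close>

lemma linear_equation_solution_has_derivative:
  fixes T :: "'a::euclidean_space \<Rightarrow> 'b::euclidean_space \<Rightarrow> 'c::euclidean_space"
  assumes U: "open U" "x \<in> U" and lin: "\<And>y. y \<in> U \<Longrightarrow> linear (T y)" and inj: "inj (T x)"
    and cont: "\<And>b. b \<in> Basis \<Longrightarrow> isCont (\<lambda>y. T y b) x"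
    and eq: "\<And>y. y \<in> U \<Longrightarrow> T y (w y) = f y" and fx: "f x = 0"
    and f': "(f has_derivative f') (at x)"
    and w': "linear w'" "\<And>u. T x (w' u) = f' u"
  shows "(w has_derivative w') (at x)"
proof -
  have ev: "\<forall>\<^sub>F y in nhds x. y \<in> U" using U by (simp add: eventually_nhds_in_open)
  then have "\<forall>\<^sub>F y in at x. linear (T y)"
    using lin by (auto simp: eventually_at_filter elim: eventually_mono)
  then obtain c where c: "c > 0" "\<forall>\<^sub>F y in nhds x. \<forall>z. c * norm z \<le> norm (T y z)"
    using linear_family_bounded_below_nearby[OF _ lin[OF U(2)] inj cont] by blast
  have wx: "w x = 0"
    using eq[OF U(2)] fx inj linear_0[OF lin[OF U(2)]] by (metis injD)
  let ?E = "\<lambda>y. \<Sum>b\<in>Basis. norm (T y b - T x b)"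
  have "(?E \<longlongrightarrow> (\<Sum>b\<in>(Basis::'b set). 0)) (at x)"
    by (intro tendsto_sum tendsto_norm_zero LIM_zero isContD cont)
  then have E: "(?E \<longlongrightarrow> 0) (at x)" by simp
  have blw: "bounded_linear w'" using w'(1) by (simp add: linear_conv_bounded_linear)
  then obtain K where K: "K > 0" "\<And>u. norm (w' u) \<le> norm u * K"
    using bounded_linear.pos_bounded by blast
  let ?Q = "\<lambda>y. norm (f y - f x - f' (y - x)) / norm (y - x) + ?E y * K"
  have Q: "(?Q \<longlongrightarrow> 0 + 0 * K) (at x)"
    using f' by (intro tendsto_intros E) (simp add: has_derivative_iff_norm)
  have bound: "\<forall>\<^sub>F y in at x. norm (w y - w x - w' (y - x)) / norm (y - x) \<le> ?Q y / c"
    using c(2) ev unfolding eventually_at_filter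
  proof eventually_elim
    case (elim y)
    show ?case
    proof (intro impI)
      assume ne: "y \<noteq> x"
      let ?d = "w y - w x - w' (y - x)"
      have "T y ?d = (f y - f x - f' (y - x)) - (T y (w' (y - x)) - T x (w' (y - x)))"
        using elim(2) by (simp add: linear_diff[OF lin] eq fx wx w'(2))
      then have A: "c * norm ?d \<le> norm (f y - f x - f' (y - x)) + norm (T y (w' (y - x)) - T x (w' (y - x)))"
        using elim(1) norm_triangle_ineq4 by (metis order_trans)
      have "norm (T y (w' (y - x)) - T x (w' (y - x))) \<le> ?E y * norm (w' (y - x))"
        by (rule linear_family_difference_bound) (use lin elim U in auto)
      also have "\<dots> \<le> ?E y * (norm (y - x) * K)"
        by (intro mult_left_mono K sum_nonneg) auto
      finally have "c * norm ?d \<le> norm (f y - f x - f' (y - x)) + ?E y * (norm (y - x) * K)"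
        using A by linarith
      also have "\<dots> = ?Q y * norm (y - x)"
        using ne by (simp add: distrib_right)
      finally have "norm ?d \<le> ?Q y / c * norm (y - x)"
        using c(1) by (simp add: pos_le_divide_eq mult.commute)
      then show "norm ?d / norm (y - x) \<le> ?Q y / c"
        using ne by (simp add: pos_divide_le_eq)
    qed
  qed
  have "((\<lambda>y. norm (w y - w x - w' (y - x)) / norm (y - x)) \<longlongrightarrow> 0) (at x)"
  proof (rule tendsto_sandwich[OF _ bound tendsto_const])
    show "((\<lambda>y. ?Q y / c) \<longlongrightarrow> 0) (at x)"
      using tendsto_divide[OF Q tendsto_const, of c] c(1) by simp
  qed auto
  then show ?thesis
    using blw by (simp add: has_derivative_iff_norm)
qed

text \<open>The derivative of a solution solves an equation with the same coefficients and a right-hand side of one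
  order less, so the order of differentiability can be raised step by step, without Cramer's rule.\<close>

lemma Ck_on_linear_solution:
  fixes T :: "'a::euclidean_space \<Rightarrow> 'b::euclidean_space \<Rightarrow> 'b"
  assumes U: "open U" and lin: "\<And>y. y \<in> U \<Longrightarrow> linear (T y)" and inj: "\<And>y. y \<in> U \<Longrightarrow> inj (T y)"
    and T: "\<And>b. Ck_on k U (\<lambda>y. T y b)" and f: "Ck_on k U f"
    and eq: "\<And>y. y \<in> U \<Longrightarrow> T y (z y) = f y"
  shows "Ck_on k U z"
  using T f eq
proof (induction k arbitrary: f z)
  case 0
  have "isCont z x" if x: "x \<in> U" for x
  proof -
    have ev: "\<forall>\<^sub>F y in nhds x. y \<in> U" using U x by (simp add: eventually_nhds_in_open)
    then have evlin: "\<forall>\<^sub>F y in at x. linear (T y)"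
      using lin by (auto simp: eventually_at_filter elim: eventually_mono)
    have cT: "isCont (\<lambda>y. T y b) x" for b
      using 0 U x by (simp add: continuous_on_eq_continuous_at)
    obtain c where c: "c > 0" "\<forall>\<^sub>F y in nhds x. \<forall>z. c * norm z \<le> norm (T y z)"
      using linear_family_bounded_below_nearby[OF evlin lin[OF x] inj[OF x] cT] by blast
    have "((\<lambda>y. norm (f y - T y (z x)) / c) \<longlongrightarrow> norm (f x - T x (z x)) / c) (at x)"
      using 0 U x c(1) cT[of "z x"]
      by (intro tendsto_intros) (auto simp: continuous_on_eq_continuous_at isCont_def)
    then have lim: "((\<lambda>y. norm (f y - T y (z x)) / c) \<longlongrightarrow> 0) (at x)"
      using 0 x by simp
    have "\<forall>\<^sub>F y in at x. norm (z y - z x) \<le> norm (f y - T y (z x)) / c"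
      using eventually_conj[OF c(2) ev] unfolding eventually_at_filter
    proof eventually_elim
      case (elim y)
      then have "T y (z y - z x) = f y - T y (z x)"
        using 0 by (simp add: linear_diff[OF lin])
      then show ?case using elim c(1) by (metis mult.commute pos_le_divide_eq)
    qed
    then have "((\<lambda>y. norm (z y - z x)) \<longlongrightarrow> 0) (at x)"
      by (intro tendsto_sandwich[OF _ _ tendsto_const lim]) auto
    then show ?thesis
      by (simp add: isCont_def LIM_zero_iff tendsto_norm_zero_iff)
  qed
  then show ?case by (simp add: continuous_at_imp_continuous_on)
next
  case (Suc k)
  let ?f' = "\<lambda>x. frechet_derivative f (at x)" and ?T' = "\<lambda>x u b. frechet_derivative (\<lambda>y. T y b) (at x) u"
  have z: "Ck_on k U z"
    using Suc.IH[of f z] Ck_on_lower[OF Suc.prems(1)] Ck_on_lower[OF Suc.prems(2)] Suc.prems(3) by blast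
  \<comment> \<open>differentiating \<open>T y (z y) = f y\<close> gives the linear equation for the derivative of \<open>z\<close>\<close>
  define r where "r = (\<lambda>x u. ?f' x u - (\<Sum>b\<in>Basis. (z x \<bullet> b) *\<^sub>R ?T' x u b))"
  define z' where "z' = (\<lambda>x u. inv (T x) (r x u))"
  have bij: "bij (T y)" if "y \<in> U" for y
    using lin inj that by (simp add: bij_def linear_injective_imp_surjective)
  have z'eq: "T y (z' y u) = r y u" if "y \<in> U" for y u
    unfolding z'_def using bij[OF that] by (simp add: bij_is_surj surj_f_inv_f)
  have D: "(z has_derivative z' x) (at x)" if x: "x \<in> U" for x
  proof -
    have Df: "(f has_derivative ?f' x) (at x)" and DT: "((\<lambda>y. T y b) has_derivative (\<lambda>u. ?T' x u b)) (at x)" for b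
      using Ck_on_SucD[OF Suc.prems(2) x] Ck_on_SucD[OF Suc.prems(1) x] by auto
    have DTz: "((\<lambda>y. T y (z x)) has_derivative (\<lambda>u. \<Sum>b\<in>Basis. (z x \<bullet> b) *\<^sub>R ?T' x u b)) (at x)"
    proof (rule has_derivative_transform_within_open[OF _ U x])
      show "((\<lambda>y. \<Sum>b\<in>Basis. (z x \<bullet> b) *\<^sub>R T y b) has_derivative
          (\<lambda>u. \<Sum>b\<in>Basis. (z x \<bullet> b) *\<^sub>R ?T' x u b)) (at x)"
        by (intro has_derivative_sum has_derivative_scaleR_right DT)
    qed (rule linear_basis_expansion[OF lin, symmetric])
    have Dr: "((\<lambda>y. f y - T y (z x)) has_derivative r x) (at x)"
      unfolding r_def by (rule has_derivative_diff[OF Df DTz])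
    have "linear (z' x)"
    proof -
      have "linear (r x)" using Dr has_derivative_linear by blast
      then have "T x (z' x (u + v)) = T x (z' x u + z' x v)" "T x (z' x (a *\<^sub>R u)) = T x (a *\<^sub>R z' x u)" for u v a
        using z'eq[OF x] lin[OF x] by (simp_all add: linear_add linear_scale)
      then show ?thesis
        using injD[OF inj[OF x]] by (intro linearI) blast+
    qed
    then have "((\<lambda>y. z y - z x) has_derivative z' x) (at x)"
      using Suc.prems(3) x
      by (intro linear_equation_solution_has_derivative[where f = "\<lambda>y. f y - T y (z x)" and T = T, OF U x lin inj[OF x] _ _ _ Dr])
        (auto simp: linear_diff[OF lin] z'eq intro: has_derivative_continuous[OF DT])
    then have "((\<lambda>y. (z y - z x) + z x) has_derivative (\<lambda>u. z' x u + 0)) (at x)"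
      by (intro has_derivative_add has_derivative_const)
    then show ?thesis by simp
  qed
  show ?case
  proof (rule Ck_on_SucI[OF U D])
    fix u
    show "Ck_on k U (\<lambda>x. z' x u)"
    proof (rule Suc.IH)
      have "Ck_on k U (\<lambda>x. ?f' x u + (- 1) *\<^sub>R (\<Sum>b\<in>Basis. (z x \<bullet> b) *\<^sub>R ?T' x u b))"
        using Suc.prems z
        by (intro Ck_on_add[OF U] Ck_on_sum[OF U] Ck_on_bilinear[OF U bounded_bilinear_scaleR]
             Ck_on_bilinear[OF U bounded_bilinear_inner] Ck_on_const) auto
      then show "Ck_on k U (\<lambda>x. r x u)" by (simp add: r_def)
    qed (use Ck_on_lower[OF Suc.prems(1)] z'eq in auto)
  qed
qed

section \<open>Smooth maps on sets with unique derivatives\<close>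

text \<open>Every point of \<open>S\<close> can be approached within \<open>S\<close> along each coordinate axis.  Open sets and relatively open subsets
  of a half-space have this property, and it makes derivatives within \<open>S\<close> unique.\<close>

definition thick :: "'a::euclidean_space set \<Rightarrow> bool" where
  "thick S \<longleftrightarrow> (\<forall>x\<in>S. \<forall>i\<in>Basis. \<forall>e>0. \<exists>d. 0 < \<bar>d\<bar> \<and> \<bar>d\<bar> < e \<and> x + d *\<^sub>R i \<in> S)"

abbreviation fderiv :: "'a::real_normed_vector set \<Rightarrow> ('a \<Rightarrow> 'b::real_normed_vector) \<Rightarrow> 'a \<Rightarrow> 'a \<Rightarrow> 'b" where
  "fderiv S f x \<equiv> frechet_derivative f (at x within S)"

lemma thick_fderiv_eq:
  assumes "thick S" "x \<in> S" "(f has_derivative f') (at x within S)"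
  shows "fderiv S f x = f'"
proof -
  have "(f has_derivative fderiv S f x) (at x within S)"
    using assms(3) frechet_derivative_works differentiable_def by blast
  then show ?thesis
    using assms by (intro frechet_derivative_unique_within) (auto simp: thick_def)
qed

lemma thick_Int_open:
  assumes "thick S" "open W"
  shows "thick (S \<inter> W)"
  unfolding thick_def
proof (intro ballI allI impI)
  fix x i :: 'a and e :: real assume x: "x \<in> S \<inter> W" and i: "i \<in> Basis" and e: "e > 0"
  obtain r where r: "r > 0" "ball x r \<subseteq> W" using assms(2) x open_contains_ball by blast
  obtain d where d: "0 < \<bar>d\<bar>" "\<bar>d\<bar> < min e r" "x + d *\<^sub>R i \<in> S"
    using assms(1) x i e r(1) unfolding thick_def by (metis IntD1 min_less_iff_conj)
  have "dist x (x + d *\<^sub>R i) < r" using d(2) i by (simp add: dist_norm)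
  then show "\<exists>d. 0 < \<bar>d\<bar> \<and> \<bar>d\<bar> < e \<and> x + d *\<^sub>R i \<in> S \<inter> W"
    using d r(2) by auto
qed

lemma thick_UNIV: "thick UNIV"
proof -
  have "\<exists>d. 0 < \<bar>d\<bar> \<and> \<bar>d\<bar> < e" if "e > 0" for e :: real
    using that by (intro exI[of _ "e / 2"]) auto
  then show ?thesis by (auto simp: thick_def)
qed

lemma thick_open: "open S \<Longrightarrow> thick S"
  using thick_Int_open[OF thick_UNIV, of S] by simp

lemma at_within_Int_open:
  assumes "open W" "x \<in> W"
  shows "at x within (S \<inter> W) = at x within S"
  by (rule at_within_nhd[OF assms(2,1)]) auto

lemma fderiv_cong:
  assumes "x \<in> S" "\<And>y. y \<in> S \<Longrightarrow> f y = g y"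
  shows "fderiv S f x = fderiv S g x"
proof -
  have "(f has_derivative f') (at x within S) \<longleftrightarrow> (g has_derivative f') (at x within S)" for f'
  proof
    show "(g has_derivative f') (at x within S)" if "(f has_derivative f') (at x within S)"
      by (rule has_derivative_transform[OF assms(1) _ that]) (simp add: assms(2))
    show "(f has_derivative f') (at x within S)" if "(g has_derivative f') (at x within S)"
      by (rule has_derivative_transform[OF assms(1) _ that]) (simp add: assms(2))
  qed
  then show ?thesis by (simp add: frechet_derivative_def)
qed

lemma smooth_onE:
  assumes "smooth_on S f" "x \<in> S"
  obtains U F where "open U" "x \<in> U" "\<And>k. Ck_on k U F" "\<And>y. y \<in> S \<Longrightarrow> y \<in> U \<Longrightarrow> F y = f y"
proof -
  have "\<exists>U F. open U \<and> x \<in> U \<and> (\<forall>k. Ck_on k U F) \<and> (\<forall>y\<in>S \<inter> U. F y = f y)"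
    using assms by (simp add: smooth_on_def)
  then obtain U F where "open U \<and> x \<in> U \<and> (\<forall>k. Ck_on k U F) \<and> (\<forall>y\<in>S \<inter> U. F y = f y)"
    by (elim exE)
  then show thesis using that[of U F] by simp
qed

lemma smooth_on_subset: "smooth_on S f \<Longrightarrow> T \<subseteq> S \<Longrightarrow> smooth_on T f"
  unfolding smooth_on_def
proof
  fix x assume f: "\<forall>x\<in>S. \<exists>U F. open U \<and> x \<in> U \<and> (\<forall>k. Ck_on k U F) \<and> (\<forall>y\<in>S \<inter> U. F y = f y)"
    and TS: "T \<subseteq> S" and x: "x \<in> T"
  have "x \<in> S" using TS x by (rule subsetD)
  from bspec[OF f this] obtain U F where "open U \<and> x \<in> U \<and> (\<forall>k. Ck_on k U F) \<and> (\<forall>y\<in>S \<inter> U. F y = f y)"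
    by (elim exE)
  then show "\<exists>U F. open U \<and> x \<in> U \<and> (\<forall>k. Ck_on k U F) \<and> (\<forall>y\<in>T \<inter> U. F y = f y)"
    using TS by (intro exI[of _ U] exI[of _ F]) auto
qed

lemma smooth_on_cong: "smooth_on S f \<Longrightarrow> (\<And>x. x \<in> S \<Longrightarrow> f x = g x) \<Longrightarrow> smooth_on S g"
  unfolding smooth_on_def by simp

lemma smooth_on_const: "smooth_on S (\<lambda>x. c)"
  unfolding smooth_on_def by (intro ballI exI[of _ UNIV] exI[of _ "\<lambda>x. c"]) (auto simp: Ck_on_const)

lemma smooth_on_linear: "bounded_linear L \<Longrightarrow> smooth_on S L"
  unfolding smooth_on_def by (intro ballI exI[of _ UNIV] exI[of _ L]) (auto simp: Ck_on_linear)

lemma smooth_on_compose: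
  fixes f :: "'b::euclidean_space \<Rightarrow> 'c::euclidean_space" and g :: "'a::euclidean_space \<Rightarrow> 'b"
  assumes f: "smooth_on T f" and g: "smooth_on S g" and "g ` S \<subseteq> T"
  shows "smooth_on S (\<lambda>x. f (g x))"
  unfolding smooth_on_def
proof
  fix x assume x: "x \<in> S"
  obtain U G where U: "open U" "x \<in> U" "\<And>k. Ck_on k U G" "\<And>y. y \<in> S \<Longrightarrow> y \<in> U \<Longrightarrow> G y = g y"
    using smooth_onE[OF g x] by metis
  have "g x \<in> T" using x assms(3) by auto
  then obtain V F where V: "open V" "g x \<in> V" "\<And>k. Ck_on k V F" "\<And>y. y \<in> T \<Longrightarrow> y \<in> V \<Longrightarrow> F y = f y"
    using smooth_onE[OF f] by metis
  let ?W = "U \<inter> G -` V"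
  have W: "open ?W" using U(1) V(1) Ck_on_imp_continuous_on[OF U(3)]
    by (simp add: continuous_open_preimage)
  have "Ck_on k ?W (\<lambda>y. F (G y))" for k
    by (rule Ck_on_compose[OF W V(1) V(3) Ck_on_subset[OF U(3)]]) auto
  then show "\<exists>U F. open U \<and> x \<in> U \<and> (\<forall>k. Ck_on k U F) \<and> (\<forall>y\<in>S \<inter> U. F y = f (g y))"
    using W U V x assms(3) by (intro exI[of _ ?W] exI[of _ "\<lambda>y. F (G y)"]) auto
qed

lemma smooth_on_bounded_linear: "bounded_linear L \<Longrightarrow> smooth_on S f \<Longrightarrow> smooth_on S (\<lambda>x. L (f x))"
  by (rule smooth_on_compose[of UNIV L S f]) (auto intro: smooth_on_linear)

lemma smooth_on_Pair:
  assumes f: "smooth_on S f" and g: "smooth_on S g"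
  shows "smooth_on S (\<lambda>x. (f x, g x))"
  unfolding smooth_on_def
proof
  fix x assume x: "x \<in> S"
  obtain U F where U: "open U" "x \<in> U" "\<And>k. Ck_on k U F" "\<And>y. y \<in> S \<Longrightarrow> y \<in> U \<Longrightarrow> F y = f y"
    using smooth_onE[OF f x] by metis
  obtain V G where V: "open V" "x \<in> V" "\<And>k. Ck_on k V G" "\<And>y. y \<in> S \<Longrightarrow> y \<in> V \<Longrightarrow> G y = g y"
    using smooth_onE[OF g x] by metis
  have "Ck_on k (U \<inter> V) (\<lambda>y. (F y, G y))" for k
    using U V by (intro Ck_on_Pair Ck_on_subset[OF U(3)] Ck_on_subset[OF V(3)]) auto
  then show "\<exists>U H. open U \<and> x \<in> U \<and> (\<forall>k. Ck_on k U H) \<and> (\<forall>y\<in>S \<inter> U. H y = (f y, g y))"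
    using U V by (intro exI[of _ "U \<inter> V"] exI[of _ "\<lambda>y. (F y, G y)"]) auto
qed

lemma smooth_on_bilinear:
  assumes P: "bounded_bilinear P" and f: "smooth_on S f" and g: "smooth_on S g"
  shows "smooth_on S (\<lambda>x. P (f x) (g x))"
proof -
  have "Ck_on k UNIV (\<lambda>z. P (fst z) (snd z))" for k
    by (intro Ck_on_bilinear[OF _ P] Ck_on_linear) (auto intro: bounded_linear_fst bounded_linear_snd)
  then have "smooth_on UNIV (\<lambda>z. P (fst z) (snd z))"
    unfolding smooth_on_def by (intro ballI exI[of _ UNIV] exI[of _ "\<lambda>z. P (fst z) (snd z)"]) auto
  from smooth_on_compose[OF this smooth_on_Pair[OF f g]] show ?thesis by simp
qed

lemmas smooth_on_scaleR = smooth_on_bilinear[OF bounded_bilinear_scaleR]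
lemmas smooth_on_inner = smooth_on_bilinear[OF bounded_bilinear_inner]

lemma smooth_on_add: "smooth_on S f \<Longrightarrow> smooth_on S g \<Longrightarrow> smooth_on S (\<lambda>x. f x + g x)"
  using smooth_on_bounded_linear[OF bounded_linear_add[OF bounded_linear_fst bounded_linear_snd] smooth_on_Pair, of S f g]
  by simp

lemma smooth_on_diff: "smooth_on S f \<Longrightarrow> smooth_on S g \<Longrightarrow> smooth_on S (\<lambda>x. f x - g x)"
  using smooth_on_bounded_linear[OF bounded_linear_sub[OF bounded_linear_fst bounded_linear_snd] smooth_on_Pair, of S f g]
  by simp

lemma smooth_on_sum: "(\<And>i. i \<in> I \<Longrightarrow> smooth_on S (f i)) \<Longrightarrow> smooth_on S (\<lambda>x. \<Sum>i\<in>I. f i x)"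
  by (induction I rule: infinite_finite_induct) (simp_all add: smooth_on_const smooth_on_add)

lemma Ck_on_local:
  assumes "\<And>x. x \<in> S \<Longrightarrow> \<exists>U. open U \<and> x \<in> U \<and> Ck_on k U f"
  shows "Ck_on k S f"
  using assms
proof (induction k arbitrary: f)
  case 0
  have "isCont f x" if "x \<in> S" for x
    using 0[OF that] by (auto simp: continuous_on_eq_continuous_at)
  then show ?case by (simp add: continuous_at_imp_continuous_on)
next
  case (Suc k)
  have "f differentiable at x" if "x \<in> S" for x using Suc.prems[OF that] by auto
  moreover have "Ck_on k S (\<lambda>x. frechet_derivative f (at x) v)" for v
  proof (rule Suc.IH)
    fix x assume "x \<in> S"
    from Suc.prems[OF this] obtain U where "open U" "x \<in> U" "Ck_on (Suc k) U f" by blast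
    then show "\<exists>U. open U \<and> x \<in> U \<and> Ck_on k U (\<lambda>x. frechet_derivative f (at x) v)"
      by (intro exI[of _ U]) simp
  qed
  ultimately show ?case by simp
qed

lemma smooth_on_open_iff:
  assumes "open S"
  shows "smooth_on S f \<longleftrightarrow> (\<forall>k. Ck_on k S f)"
proof
  assume f: "smooth_on S f"
  show "\<forall>k. Ck_on k S f"
  proof (intro allI Ck_on_local)
    fix k x assume x: "x \<in> S"
    obtain U F where U: "open U" "x \<in> U" "\<And>k. Ck_on k U F" "\<And>y. y \<in> S \<Longrightarrow> y \<in> U \<Longrightarrow> F y = f y"
      using smooth_onE[OF f x] by metis
    have "Ck_on k (S \<inter> U) F" using Ck_on_subset[OF U(3)] by auto
    then have "Ck_on k (S \<inter> U) f"
      using Ck_on_cong[of "S \<inter> U" F f k] U assms by auto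
    then show "\<exists>U. open U \<and> x \<in> U \<and> Ck_on k U f" using x U assms by (intro exI[of _ "S \<inter> U"]) auto
  qed
qed (use assms in \<open>auto simp: smooth_on_def\<close>)

lemma smooth_on_has_derivative:
  assumes f: "smooth_on S f" and x: "x \<in> S"
  shows "(f has_derivative fderiv S f x) (at x within S)"
proof -
  obtain U F where U: "open U" "x \<in> U" "\<And>k. Ck_on k U F" "\<And>y. y \<in> S \<Longrightarrow> y \<in> U \<Longrightarrow> F y = f y"
    using smooth_onE[OF f x] by metis
  have "(F has_derivative frechet_derivative F (at x)) (at x within (S \<inter> U))"
    using Ck_on_SucD[OF U(3) U(2)] has_derivative_at_withinI by blast
  then have "(f has_derivative frechet_derivative F (at x)) (at x within (S \<inter> U))"
    using U x by (intro has_derivative_transform[where f = F and g = f]) auto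
  then have "f differentiable (at x within S)"
    using at_within_Int_open[OF U(1,2)] by (auto simp: differentiable_def)
  then show ?thesis by (simp add: frechet_derivative_works)
qed

lemma smooth_on_continuous_on: "smooth_on S f \<Longrightarrow> continuous_on S f"
  unfolding continuous_on_eq_continuous_within
  using smooth_on_has_derivative has_derivative_continuous by blast

lemma linear_fderiv: "smooth_on S f \<Longrightarrow> x \<in> S \<Longrightarrow> linear (fderiv S f x)"
  using smooth_on_has_derivative has_derivative_linear by blast

text \<open>On \<open>S\<close> the derivative of a smooth extension is determined by the function on \<open>S\<close>; this transfers
  calculus on open sets to half-spaces.\<close>

lemma smooth_onE_fderiv:
  assumes S: "thick S" and f: "smooth_on S f" and x: "x \<in> S"
  obtains U F where "open U" "x \<in> U" "\<And>k. Ck_on k U F" "\<And>y. y \<in> S \<Longrightarrow> y \<in> U \<Longrightarrow> F y = f y"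
    "\<And>y. y \<in> S \<Longrightarrow> y \<in> U \<Longrightarrow> frechet_derivative F (at y) = fderiv S f y"
proof -
  obtain U F where U: "open U" "x \<in> U" "\<And>k. Ck_on k U F" "\<And>y. y \<in> S \<Longrightarrow> y \<in> U \<Longrightarrow> F y = f y"
    using smooth_onE[OF f x] by metis
  have "frechet_derivative F (at y) = fderiv S f y" if y: "y \<in> S" "y \<in> U" for y
  proof -
    have "(F has_derivative frechet_derivative F (at y)) (at y within (S \<inter> U))"
      using Ck_on_SucD[OF U(3) y(2)] has_derivative_at_withinI by blast
    then have "(f has_derivative frechet_derivative F (at y)) (at y within S)"
      unfolding at_within_Int_open[OF U(1) y(2), of S, symmetric]
      using U y by (intro has_derivative_transform[where f = F and g = f]) auto
    then show ?thesis using thick_fderiv_eq[OF S y(1)] by metis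
  qed
  with U show thesis using that by metis
qed

lemma smooth_on_fderiv:
  assumes S: "thick S" and f: "smooth_on S f"
  shows "smooth_on S (\<lambda>x. fderiv S f x v)"
  unfolding smooth_on_def
proof
  fix x assume x: "x \<in> S"
  obtain U F where U: "open U" "x \<in> U" "\<And>k. Ck_on k U F"
    "\<And>y. y \<in> S \<Longrightarrow> y \<in> U \<Longrightarrow> frechet_derivative F (at y) = fderiv S f y"
    using smooth_onE_fderiv[OF S f x] by metis
  have "Ck_on k U (\<lambda>y. frechet_derivative F (at y) v)" for k
    using U(3)[of "Suc k"] by simp
  then show "\<exists>U F. open U \<and> x \<in> U \<and> (\<forall>k. Ck_on k U F) \<and> (\<forall>y\<in>S \<inter> U. F y = fderiv S f y v)"
    using U by (intro exI[of _ U] exI[of _ "\<lambda>y. frechet_derivative F (at y) v"]) auto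
qed

lemma fderiv_symmetric:
  assumes S: "thick S" and f: "smooth_on S f" and x: "x \<in> S"
  shows "fderiv S (\<lambda>y. fderiv S f y v) x u = fderiv S (\<lambda>y. fderiv S f y u) x v"
proof -
  obtain U F where U: "open U" "x \<in> U" "\<And>k. Ck_on k U F"
    "\<And>y. y \<in> S \<Longrightarrow> y \<in> U \<Longrightarrow> frechet_derivative F (at y) = fderiv S f y"
    using smooth_onE_fderiv[OF S f x] by metis
  have "fderiv S (\<lambda>y. fderiv S f y w) x = frechet_derivative (\<lambda>y. frechet_derivative F (at y) w) (at x)" for w
  proof (rule thick_fderiv_eq[OF S x])
    let ?F' = "\<lambda>y. frechet_derivative F (at y) w"
    have "Ck_on (Suc 0) U ?F'" using U(3)[of "Suc (Suc 0)"] by simp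
    then have "(?F' has_derivative frechet_derivative ?F' (at x)) (at x within (S \<inter> U))"
      using Ck_on_SucD[OF _ U(2)] has_derivative_at_withinI by blast
    then show "((\<lambda>y. fderiv S f y w) has_derivative frechet_derivative ?F' (at x)) (at x within S)"
      unfolding at_within_Int_open[OF U(1,2), of S, symmetric]
      using U x by (auto intro: has_derivative_transform[where f = ?F' and g = "\<lambda>y. fderiv S f y w"])
  qed
  then show ?thesis using second_derivative_symmetric[OF U(1,2,3)] by simp
qed

lemma has_derivative_chain_within:
  assumes "smooth_on T f" "smooth_on S g" "g ` S \<subseteq> T" "x \<in> S"
  shows "((\<lambda>x. f (g x)) has_derivative (\<lambda>v. fderiv T f (g x) (fderiv S g x v))) (at x within S)"
  using has_derivative_in_compose[OF smooth_on_has_derivative[OF assms(2,4)]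
      has_derivative_subset[OF smooth_on_has_derivative[OF assms(1)] assms(3)]] assms by auto

subsection \<open>Smooth families of linear and bilinear maps\<close>

lemma smooth_on_linear_family:
  assumes lin: "\<And>y. y \<in> S \<Longrightarrow> linear (T y)" and T: "\<And>v. smooth_on S (\<lambda>y. T y v)" and V: "smooth_on S V"
  shows "smooth_on S (\<lambda>y. T y (V y))"
proof (rule smooth_on_cong)
  show "smooth_on S (\<lambda>y. \<Sum>b\<in>Basis. (V y \<bullet> b) *\<^sub>R T y b)"
    by (intro smooth_on_sum smooth_on_scaleR smooth_on_inner V T smooth_on_const)
qed (rule linear_basis_expansion[OF lin, symmetric])

lemma smooth_on_bilinear_family:
  assumes l1: "\<And>y w. y \<in> S \<Longrightarrow> linear (\<lambda>v. B y v w)" and l2: "\<And>y v. y \<in> S \<Longrightarrow> linear (B y v)"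
    and B: "\<And>v w. smooth_on S (\<lambda>y. B y v w)" and V: "smooth_on S V" and W: "smooth_on S W"
  shows "smooth_on S (\<lambda>y. B y (V y) (W y))"
proof -
  have "smooth_on S (\<lambda>y. B y v (W y))" for v
    by (rule smooth_on_linear_family[OF l2 B W])
  then have "smooth_on S (\<lambda>y. (\<lambda>v. B y v (W y)) (V y))"
    by (intro smooth_on_linear_family[OF l1 _ V])
  then show ?thesis by simp
qed

lemma fderiv_add:
  assumes "thick S" "x \<in> S" "smooth_on S f" "smooth_on S g"
  shows "fderiv S (\<lambda>y. f y + g y) x u = fderiv S f x u + fderiv S g x u"
  using thick_fderiv_eq[OF assms(1,2) has_derivative_add[OF smooth_on_has_derivative[OF assms(3,2)]
      smooth_on_has_derivative[OF assms(4,2)]]] by simp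

lemma fderiv_scaleR:
  assumes "thick S" "x \<in> S" "smooth_on S f"
  shows "fderiv S (\<lambda>y. c *\<^sub>R f y) x u = c *\<^sub>R fderiv S f x u"
  using thick_fderiv_eq[OF assms(1,2) has_derivative_scaleR_right[OF smooth_on_has_derivative[OF assms(3,2)]]]
  by simp

text \<open>Bilinear families such as metrics and Christoffel symbols are handled one argument at a time, as families
  of linear maps that are smooth for each fixed vector.\<close>

lemma linear_fderiv_family:
  assumes S: "thick S" and x: "x \<in> S" and lin: "\<And>y. y \<in> S \<Longrightarrow> linear (T y)" and T: "\<And>v. smooth_on S (\<lambda>y. T y v)"
  shows "linear (\<lambda>v. fderiv S (\<lambda>y. T y v) x u)"
proof (rule linearI)
  show "fderiv S (\<lambda>y. T y (v + w)) x u = fderiv S (\<lambda>y. T y v) x u + fderiv S (\<lambda>y. T y w) x u" for v w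
    unfolding fderiv_add[OF S x T T, symmetric]
    by (rule arg_cong2[OF fderiv_cong[OF x]]) (auto simp: linear_add[OF lin])
  show "fderiv S (\<lambda>y. T y (c *\<^sub>R v)) x u = c *\<^sub>R fderiv S (\<lambda>y. T y v) x u" for c v
    unfolding fderiv_scaleR[OF S x T, symmetric]
    by (rule arg_cong2[OF fderiv_cong[OF x]]) (auto simp: linear_scale[OF lin])
qed

lemma has_derivative_linear_family:
  fixes T :: "'a::euclidean_space \<Rightarrow> 'b::euclidean_space \<Rightarrow> 'c::euclidean_space"
  assumes S: "thick S" and x: "x \<in> S" and lin: "\<And>y. y \<in> S \<Longrightarrow> linear (T y)" and T: "\<And>v. smooth_on S (\<lambda>y. T y v)"
    and V: "(V has_derivative V') (at x within S)"
  shows "((\<lambda>y. T y (V y)) has_derivative (\<lambda>u. fderiv S (\<lambda>y. T y (V x)) x u + T x (V' u))) (at x within S)"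
proof -
  have "((\<lambda>y. \<Sum>b\<in>Basis. (V y \<bullet> b) *\<^sub>R T y b) has_derivative
      (\<lambda>u. \<Sum>b\<in>Basis. (V x \<bullet> b) *\<^sub>R fderiv S (\<lambda>y. T y b) x u + (V' u \<bullet> b) *\<^sub>R T x b)) (at x within S)"
    by (intro has_derivative_sum has_derivative_scaleR has_derivative_inner_left V
        smooth_on_has_derivative[OF T x])
  also have "(\<lambda>u. \<Sum>b\<in>Basis. (V x \<bullet> b) *\<^sub>R fderiv S (\<lambda>y. T y b) x u + (V' u \<bullet> b) *\<^sub>R T x b) =
      (\<lambda>u. fderiv S (\<lambda>y. T y (V x)) x u + T x (V' u))"
    by (simp add: sum.distrib linear_basis_expansion[OF linear_fderiv_family[OF S x lin T], symmetric]
        linear_basis_expansion[OF lin[OF x], symmetric])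
  finally show ?thesis
    by (rule has_derivative_transform[OF x, rotated]) (rule linear_basis_expansion[OF lin])
qed

lemma has_derivative_bilinear_family:
  assumes S: "thick S" and x: "x \<in> S"
    and l1: "\<And>y w. y \<in> S \<Longrightarrow> linear (\<lambda>v. B y v w)" and l2: "\<And>y v. y \<in> S \<Longrightarrow> linear (B y v)"
    and B: "\<And>v w. smooth_on S (\<lambda>y. B y v w)" and V: "smooth_on S V" and W: "smooth_on S W"
  shows "((\<lambda>y. B y (V y) (W y)) has_derivative (\<lambda>u. fderiv S (\<lambda>y. B y (V x) (W x)) x u
    + B x (fderiv S V x u) (W x) + B x (V x) (fderiv S W x u))) (at x within S)"
proof -
  have "smooth_on S (\<lambda>y. B y v (W y))" for v
    by (rule smooth_on_linear_family[OF l2 B W])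
  then have "((\<lambda>y. (\<lambda>v. B y v (W y)) (V y)) has_derivative
      (\<lambda>u. fderiv S (\<lambda>y. (\<lambda>v. B y v (W y)) (V x)) x u + (\<lambda>v. B x v (W x)) (fderiv S V x u))) (at x within S)"
    by (intro has_derivative_linear_family[OF S x _ _ smooth_on_has_derivative[OF V x]] l1)
  moreover have "fderiv S (\<lambda>y. B y (V x) (W y)) x =
      (\<lambda>u. fderiv S (\<lambda>y. B y (V x) (W x)) x u + B x (V x) (fderiv S W x u))"
    by (rule thick_fderiv_eq[OF S x has_derivative_linear_family[OF S x l2 B smooth_on_has_derivative[OF W x]]])
  ultimately show ?thesis by (simp add: add_ac)
qed

text \<open>Each \<open>T y b\<close> with \<open>b\<close> in the basis has its own smooth extension.  Together they define a linear family on a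
  neighbourhood, which stays injective close to the given point, and there the equation can be solved.\<close>

lemma smooth_on_linear_solution:
  fixes T :: "'a::euclidean_space \<Rightarrow> 'b::euclidean_space \<Rightarrow> 'b"
  assumes lin: "\<And>y. y \<in> S \<Longrightarrow> linear (T y)" and inj: "\<And>y. y \<in> S \<Longrightarrow> inj (T y)"
    and T: "\<And>b. smooth_on S (\<lambda>y. T y b)" and f: "smooth_on S f"
    and eq: "\<And>y. y \<in> S \<Longrightarrow> T y (z y) = f y"
  shows "smooth_on S z"
  unfolding smooth_on_def
proof
  fix x assume x: "x \<in> S"
  have "\<forall>b. \<exists>U F. open U \<and> x \<in> U \<and> (\<forall>k. Ck_on k U F) \<and> (\<forall>y\<in>S \<inter> U. F y = T y b)"
    using T x by (simp add: smooth_on_def)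
  then obtain U G where "\<forall>b. open (U b) \<and> x \<in> U b \<and> (\<forall>k. Ck_on k (U b) (G b)) \<and> (\<forall>y\<in>S \<inter> U b. G b y = T y b)"
    by atomize_elim (drule choice, elim exE, drule choice, blast)
  then have U: "\<And>b. open (U b)" "\<And>b. x \<in> U b" "\<And>b k. Ck_on k (U b) (G b)"
      "\<And>b y. y \<in> S \<Longrightarrow> y \<in> U b \<Longrightarrow> G b y = T y b"
    by simp_all
  obtain V F where V: "open V" "x \<in> V" "\<And>k. Ck_on k V F" "\<And>y. y \<in> S \<Longrightarrow> y \<in> V \<Longrightarrow> F y = f y"
    using smooth_onE[OF f x] by metis
  define W where "W = V \<inter> (\<Inter>b\<in>Basis. U b)"
  have W: "open W" "x \<in> W" using U V by (auto simp: W_def intro!: open_Int open_INT)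
  define R where "R = (\<lambda>y v. \<Sum>b\<in>Basis. (v \<bullet> b) *\<^sub>R G b y)"
  have Rlin: "linear (R y)" for y
    by (auto simp: R_def inner_add_left algebra_simps sum.distrib scaleR_sum_right intro!: linearI)
  have RT: "R y = T y" if "y \<in> S" "y \<in> W" for y
  proof
    fix v
    have "R y v = (\<Sum>b\<in>Basis. (v \<bullet> b) *\<^sub>R T y b)"
      unfolding R_def using that by (intro sum.cong refl) (simp add: U(4) W_def)
    also have "\<dots> = T y v" by (rule linear_basis_expansion[OF lin[OF that(1)], symmetric])
    finally show "R y v = T y v" .
  qed
  have Rb: "Ck_on k W (\<lambda>y. R y v)" for v k
    unfolding R_def
    by (intro Ck_on_sum[OF W(1)] Ck_on_bilinear[OF W(1) bounded_bilinear_scaleR] Ck_on_const Ck_on_subset[OF U(3)])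
      (auto simp: W_def)
  have "isCont (\<lambda>y. R y b) x" for b
    using Ck_on_imp_continuous_on[OF Rb] W by (simp add: continuous_on_eq_continuous_at)
  then obtain c where c: "c > 0" "\<forall>\<^sub>F y in nhds x. \<forall>z. c * norm z \<le> norm (R y z)"
    using linear_family_bounded_below_nearby[of R x] Rlin inj[OF x] RT[OF x W(2)] lin[OF x] by auto
  then obtain N where N: "open N" "x \<in> N" "\<And>y z. y \<in> N \<Longrightarrow> c * norm z \<le> norm (R y z)"
    unfolding eventually_nhds by blast
  have Rinj: "inj (R y)" if "y \<in> N" for y
    unfolding linear_injective_0[OF Rlin]
    using N(3)[OF that] c(1) by (metis mult_le_0_iff norm_eq_zero norm_le_zero_iff not_less)
  define \<zeta> where "\<zeta> = (\<lambda>y. inv (R y) (F y))"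
  have \<zeta>: "R y (\<zeta> y) = F y" if "y \<in> N" for y
    unfolding \<zeta>_def using linear_injective_imp_surjective[OF Rlin Rinj[OF that]] by (simp add: surj_f_inv_f)
  have "Ck_on k (N \<inter> W) \<zeta>" for k
  proof (rule Ck_on_linear_solution[where T = R and f = F])
    show "open (N \<inter> W)" using N(1) W(1) by (rule open_Int)
    show "Ck_on k (N \<inter> W) (\<lambda>y. R y b)" for b by (rule Ck_on_subset[OF Rb Int_lower2])
    have "N \<inter> W \<subseteq> V" by (auto simp: W_def)
    with V(3) show "Ck_on k (N \<inter> W) F" by (rule Ck_on_subset)
  qed (simp_all add: Rlin Rinj \<zeta>)
  moreover have "\<zeta> y = z y" if y: "y \<in> S" "y \<in> N" "y \<in> W" for y
  proof -
    have "R y (\<zeta> y) = f y" using y \<zeta>[OF y(2)] V(4)[OF y(1)] by (simp add: W_def)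
    also have "\<dots> = R y (z y)" using RT[OF y(1,3)] eq[OF y(1)] by simp
    finally have "R y (\<zeta> y) = R y (z y)" .
    then show ?thesis using Rinj[OF y(2)] by (simp add: injD)
  qed
  ultimately show "\<exists>U F. open U \<and> x \<in> U \<and> (\<forall>k. Ck_on k U F) \<and> (\<forall>y\<in>S \<inter> U. F y = z y)"
    using open_Int[OF N(1) W(1)] N(2) W(2) by (intro exI[of _ "N \<inter> W"] exI[of _ \<zeta>]) simp
qed

section \<open>Inner products\<close>

text \<open>Riemannian metrics give inner products that vary from point to point and differ from the one of the
  coordinate space.\<close>

locale inner_form =
  fixes h :: "'e::euclidean_space \<Rightarrow> 'e \<Rightarrow> real"
  assumes sym: "h u v = h v u"
    and add_left: "h (u + v) w = h u w + h v w"
    and scaleR_left: "h (a *\<^sub>R u) v = a * h u v"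
    and positive: "u \<noteq> 0 \<Longrightarrow> h u u > 0"
begin

lemma linear_left: "linear (\<lambda>u. h u v)"
  by (rule linearI) (simp_all add: add_left scaleR_left)

lemma linear_right: "linear (h u)"
  by (rule linearI) (simp_all add: sym[of u] add_left scaleR_left)

lemmas add_right = linear_add[OF linear_right]
  and scaleR_right = linear_scale[OF linear_right, simplified]
  and diff_left = linear_diff[OF linear_left]
  and diff_right = linear_diff[OF linear_right]
  and zero_left [simp] = linear_0[OF linear_left]
  and zero_right [simp] = linear_0[OF linear_right]
  and sum_left = linear_sum[OF linear_left]

lemma self_eq_0_iff: "h u u = 0 \<longleftrightarrow> u = 0"
  by (metis positive less_irrefl zero_left)

lemma nonneg: "h u u \<ge> 0"
  using positive[of u] by (cases "u = 0") auto

lemma eqI: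
  assumes "\<And>w. h u w = h v w"
  shows "u = v"
  using assms[of "u - v"] self_eq_0_iff[of "u - v"] by (simp add: diff_left)

text \<open>Turns \<open>h\<close>-pairings into Euclidean ones, so that equations tested against all vectors become linear equations.\<close>

definition flat :: "'e \<Rightarrow> 'e" where
  "flat u = (\<Sum>b\<in>Basis. h u b *\<^sub>R b)"

lemma linear_flat: "linear flat"
  by (rule linearI) (simp_all add: flat_def add_left scaleR_left scaleR_add_left sum.distrib scaleR_sum_right)

lemma inner_flat: "flat u \<bullet> w = h u w"
proof -
  have "flat u \<bullet> w = (\<Sum>b\<in>Basis. (w \<bullet> b) *\<^sub>R h u b)"
    unfolding flat_def inner_sum_left inner_scaleR_left
    by (intro sum.cong refl) (metis inner_commute mult.commute real_scaleR_def)
  then show ?thesis by (rule trans[OF _ linear_basis_expansion[OF linear_right, symmetric]])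
qed

lemma inj_flat: "inj flat"
  by (rule injI, rule eqI) (metis inner_flat)

lemma ex1_representative:
  assumes "linear \<phi>"
  shows "\<exists>!z. \<forall>w. h z w = \<phi> w"
proof -
  have "surj flat" using linear_injective_imp_surjective[OF linear_flat inj_flat] by simp
  then obtain z where z: "flat z = (\<Sum>b\<in>Basis. \<phi> b *\<^sub>R b)" by (metis surjD)
  have "h z w = \<phi> w" for w
  proof -
    have "h z w = (\<Sum>b\<in>Basis. (w \<bullet> b) *\<^sub>R \<phi> b)"
      unfolding inner_flat[symmetric] z inner_sum_left inner_scaleR_left
      by (intro sum.cong refl) (metis inner_commute mult.commute real_scaleR_def)
    then show ?thesis by (rule trans[OF _ linear_basis_expansion[OF assms, symmetric]])
  qed
  then show ?thesis using eqI by metis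
qed

end

section \<open>The Levi-Civita connection and its curvature in coordinates\<close>

text \<open>The Christoffel symbols of the first kind, that is, the inner product of \<open>christoffel\<close> with a vector.\<close>

definition koszul :: "'e::euclidean_space set \<Rightarrow> ('e \<Rightarrow> 'e \<Rightarrow> 'e \<Rightarrow> real) \<Rightarrow> 'e \<Rightarrow> 'e \<Rightarrow> 'e \<Rightarrow> 'e \<Rightarrow> real" where
  "koszul S h x u v w = (fderiv S (\<lambda>y. h y v w) x u + fderiv S (\<lambda>y. h y u w) x v - fderiv S (\<lambda>y. h y u v) x w) / 2"

locale metric_field =
  fixes S :: "'e::euclidean_space set" and h :: "'e \<Rightarrow> 'e \<Rightarrow> 'e \<Rightarrow> real"
  assumes thick: "thick S"
    and inner_form: "x \<in> S \<Longrightarrow> inner_form (h x)"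
    and smooth: "smooth_on S (\<lambda>x. h x u v)"
begin

abbreviation \<Gamma> where "\<Gamma> \<equiv> christoffel S h"
abbreviation R where "R \<equiv> curvature_coord S h"

lemmas hsym = inner_form.sym[OF inner_form]
  and linear_left = inner_form.linear_left[OF inner_form]
  and linear_right = inner_form.linear_right[OF inner_form]
  and heqI = inner_form.eqI[OF inner_form]

lemma fderiv_metric_sym: "x \<in> S \<Longrightarrow> fderiv S (\<lambda>y. h y u v) x = fderiv S (\<lambda>y. h y v u) x"
  by (rule fderiv_cong) (auto simp: hsym)

lemma linear_fderiv_metric_left: "x \<in> S \<Longrightarrow> linear (\<lambda>u. fderiv S (\<lambda>y. h y u v) x w)"
  by (rule linear_fderiv_family[OF thick _ linear_left smooth])

lemma linear_fderiv_metric_right: "x \<in> S \<Longrightarrow> linear (\<lambda>v. fderiv S (\<lambda>y. h y u v) x w)"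
  by (rule linear_fderiv_family[OF thick _ linear_right smooth])

lemma linear_fderiv_metric: "x \<in> S \<Longrightarrow> linear (fderiv S (\<lambda>y. h y u v) x)"
  by (rule linear_fderiv[OF smooth])

lemma linear_koszul:
  assumes "x \<in> S"
  shows "linear (\<lambda>u. koszul S h x u v w)" "linear (\<lambda>v. koszul S h x u v w)" "linear (koszul S h x u v)"
  unfolding koszul_def
  by (rule linearI; simp add: linear_add[OF linear_fderiv_metric_left[OF assms]] linear_add[OF linear_fderiv_metric_right[OF assms]]
      linear_add[OF linear_fderiv_metric[OF assms]] linear_scale[OF linear_fderiv_metric_left[OF assms]]
      linear_scale[OF linear_fderiv_metric_right[OF assms]] linear_scale[OF linear_fderiv_metric[OF assms]]
      add_divide_distrib diff_divide_distrib algebra_simps)+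

lemma koszul_sym: "x \<in> S \<Longrightarrow> koszul S h x u v w = koszul S h x v u w"
  by (simp add: koszul_def fderiv_metric_sym[of x u v])

lemma koszul_add_swap: "x \<in> S \<Longrightarrow> koszul S h x v w z + koszul S h x v z w = fderiv S (\<lambda>y. h y w z) x v"
  by (simp add: koszul_def fderiv_metric_sym[of x z w] fderiv_metric_sym[of x v w] fderiv_metric_sym[of x v z]
      add_divide_distrib diff_divide_distrib)

lemma smooth_koszul: "smooth_on S (\<lambda>x. koszul S h x u v w)"
proof -
  have "smooth_on S (\<lambda>x. (1 / 2) *\<^sub>R
     (fderiv S (\<lambda>y. h y v w) x u + fderiv S (\<lambda>y. h y u w) x v - fderiv S (\<lambda>y. h y u v) x w))"
    by (intro smooth_on_scaleR smooth_on_const smooth_on_add smooth_on_diff smooth_on_fderiv[OF thick] smooth)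
  then show ?thesis by (rule smooth_on_cong) (simp add: koszul_def)
qed

lemma christoffel_eq:
  assumes "x \<in> S"
  shows "h x (\<Gamma> x u v) w = koszul S h x u v w"
proof -
  have "\<exists>!z. \<forall>w. h x z w = koszul S h x u v w"
    using inner_form.ex1_representative[OF inner_form[OF assms] linear_koszul(3)[OF assms]] .
  from theI'[OF this] show ?thesis
    unfolding christoffel_def koszul_def by blast
qed

lemma christoffel_sym: "x \<in> S \<Longrightarrow> \<Gamma> x u v = \<Gamma> x v u"
  by (rule heqI[of x]) (simp_all add: christoffel_eq, rule koszul_sym)

lemma linear_christoffel:
  assumes x: "x \<in> S"
  shows "linear (\<lambda>u. \<Gamma> x u v)" "linear (\<Gamma> x u)"
  by (rule linearI; rule heqI[OF x]; simp add: christoffel_eq[OF x] linear_add[OF linear_left[OF x]]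
      linear_scale[OF linear_left[OF x]] linear_add[OF linear_koszul(1)[OF x]] linear_scale[OF linear_koszul(1)[OF x]]
      linear_add[OF linear_koszul(2)[OF x]] linear_scale[OF linear_koszul(2)[OF x]])+

text \<open>Vector fields are often known only through their inner products with constant fields.\<close>

lemma smooth_representative:
  assumes z: "\<And>y w. y \<in> S \<Longrightarrow> h y (z y) w = \<phi> y w" and \<phi>: "\<And>w. smooth_on S (\<lambda>y. \<phi> y w)"
  shows "smooth_on S z"
proof (rule smooth_on_linear_solution)
  show "linear (inner_form.flat (h y))" "inj (inner_form.flat (h y))" if "y \<in> S" for y
    using inner_form.linear_flat inner_form.inj_flat inner_form[OF that] by auto
  show "smooth_on S (\<lambda>y. inner_form.flat (h y) b)" for b
  proof (rule smooth_on_cong)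
    show "smooth_on S (\<lambda>y. \<Sum>c\<in>Basis. h y b c *\<^sub>R c)"
      by (intro smooth_on_sum smooth_on_scaleR smooth smooth_on_const)
  qed (simp add: inner_form.flat_def[OF inner_form])
  show "smooth_on S (\<lambda>y. \<Sum>c\<in>Basis. \<phi> y c *\<^sub>R c)"
    by (intro smooth_on_sum smooth_on_scaleR \<phi> smooth_on_const)
  show "inner_form.flat (h y) (z y) = (\<Sum>c\<in>Basis. \<phi> y c *\<^sub>R c)" if "y \<in> S" for y
    by (simp add: inner_form.flat_def[OF inner_form[OF that]] z[OF that])
qed

lemma smooth_christoffel: "smooth_on S (\<lambda>x. \<Gamma> x u v)"
  by (rule smooth_representative[OF christoffel_eq smooth_koszul])

lemma metric_compatible:
  assumes x: "x \<in> S"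
  shows "fderiv S (\<lambda>y. h y a b) x u = h x (\<Gamma> x u a) b + h x a (\<Gamma> x u b)"
  using koszul_add_swap[OF x, of u a b] by (simp add: hsym[OF x, of a] christoffel_eq[OF x])

lemma linear_curvature:
  assumes x: "x \<in> S"
  shows "linear (\<lambda>u. R x u v w)"
proof -
  note l = linear_christoffel[OF x] linear_fderiv[OF smooth_christoffel x]
    linear_fderiv_family[OF thick x linear_christoffel(1) smooth_christoffel]
  show ?thesis
    unfolding curvature_coord_def
    by (rule linearI) (simp_all add: linear_add[OF l(1)] linear_add[OF l(2)] linear_add[OF l(3)] linear_add[OF l(4)]
        linear_scale[OF l(1)] linear_scale[OF l(2)] linear_scale[OF l(3)] linear_scale[OF l(4)] algebra_simps)
qed

text \<open>Moving the derivative from \<open>\<Gamma>\<close> to \<open>koszul\<close> by metric compatibility leaves derivatives of the symbols of the first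
  kind and products of Christoffel symbols.  For tangential arguments the first group is intrinsic to a
  submanifold; only the products see the ambient space.\<close>

lemma curvature_lowered:
  assumes x: "x \<in> S"
  shows "h x (R x u v w) z = fderiv S (\<lambda>y. koszul S h y v w z) x u - fderiv S (\<lambda>y. koszul S h y u w z) x v
    - h x (\<Gamma> x v w) (\<Gamma> x u z) + h x (\<Gamma> x u w) (\<Gamma> x v z)"
proof -
  have D: "fderiv S (\<lambda>y. koszul S h y b w z) x a =
      h x (\<Gamma> x a (\<Gamma> x b w)) z + h x (\<Gamma> x b w) (\<Gamma> x a z) + h x (fderiv S (\<lambda>y. \<Gamma> y b w) x a) z" for a b
  proof -
    have "fderiv S (\<lambda>y. koszul S h y b w z) x a = fderiv S (\<lambda>y. h y (\<Gamma> y b w) z) x a"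
      by (rule arg_cong[where f = "\<lambda>f. f a"], rule fderiv_cong[OF x]) (simp add: christoffel_eq)
    also have "\<dots> = fderiv S (\<lambda>y. h y (\<Gamma> x b w) z) x a + h x (fderiv S (\<lambda>y. \<Gamma> y b w) x a) z"
      using thick_fderiv_eq[OF thick x has_derivative_linear_family[OF thick x linear_left smooth
          smooth_on_has_derivative[OF smooth_christoffel x]]] by simp
    finally show ?thesis by (simp add: metric_compatible[OF x])
  qed
  show ?thesis
    unfolding curvature_coord_def D
    by (simp add: linear_add[OF linear_left[OF x]] linear_diff[OF linear_left[OF x]])
qed

lemma curvature_antisym: "R x u v w = - R x v u w"
  by (simp add: curvature_coord_def)

text \<open>Symmetrising the symbols of the first kind gives a derivative of the metric (\<open>koszul_add_swap\<close>), and second derivatives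
  of the metric commute.\<close>

lemma curvature_skew:
  assumes x: "x \<in> S"
  shows "h x (R x u v w) z = - h x (R x u v z) w"
proof -
  have D: "fderiv S (\<lambda>y. koszul S h y b w z) x a + fderiv S (\<lambda>y. koszul S h y b z w) x a =
      fderiv S (\<lambda>y. fderiv S (\<lambda>y. h y w z) y b) x a" for a b
  proof -
    have "fderiv S (\<lambda>y. koszul S h y b w z) x a + fderiv S (\<lambda>y. koszul S h y b z w) x a =
      fderiv S (\<lambda>y. koszul S h y b w z + koszul S h y b z w) x a"
      by (rule fderiv_add[OF thick x smooth_koszul smooth_koszul, symmetric])
    also have "\<dots> = fderiv S (\<lambda>y. fderiv S (\<lambda>y. h y w z) y b) x a"
      by (rule arg_cong[where f = "\<lambda>f. f a"], rule fderiv_cong[OF x]) (simp add: koszul_add_swap)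
    finally show ?thesis .
  qed
  show ?thesis
    using D[of v u] D[of u v] fderiv_symmetric[OF thick smooth x, of w z u v]
    by (simp add: curvature_lowered[OF x] hsym[OF x, of "\<Gamma> x v z"] hsym[OF x, of "\<Gamma> x u z"])
qed

lemma curvature_pair_swap:
  assumes x: "x \<in> S"
  shows "h x (R x u v v) u = h x (R x v u u) v"
  using curvature_skew[OF x, of u v v u] curvature_antisym[of x u v u]
  by (simp add: linear_neg[OF linear_left[OF x]])

end

subsection \<open>Change of coordinates\<close>

text \<open>A coordinate change that carries one expression of a metric to another.\<close>

locale isometric_change = W: metric_field W h + T: metric_field T k
  for W :: "'e::euclidean_space set" and h and T :: "'e set" and k +
  fixes \<tau> :: "'e \<Rightarrow> 'e"
  assumes maps: "\<tau> ` W \<subseteq> T" and smooth_\<tau>: "smooth_on W \<tau>"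
    and surj_deriv: "x \<in> W \<Longrightarrow> surj (fderiv W \<tau> x)"
    and isometric: "x \<in> W \<Longrightarrow> h x u v = k (\<tau> x) (fderiv W \<tau> x u) (fderiv W \<tau> x v)"
begin

lemma image_in: "x \<in> W \<Longrightarrow> \<tau> x \<in> T"
  using maps by auto

lemma smooth_pull: "smooth_on T f \<Longrightarrow> smooth_on W (\<lambda>x. f (\<tau> x))"
  by (rule smooth_on_compose[OF _ smooth_\<tau> maps])

lemma fderiv_pull:
  "smooth_on T f \<Longrightarrow> x \<in> W \<Longrightarrow> fderiv W (\<lambda>x. f (\<tau> x)) x u = fderiv T f (\<tau> x) (fderiv W \<tau> x u)"
  by (rule fun_cong[OF thick_fderiv_eq[OF W.thick _ has_derivative_chain_within[OF _ smooth_\<tau> maps]]])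

lemma second_sym:
  "x \<in> W \<Longrightarrow> fderiv W (\<lambda>y. fderiv W \<tau> y v) x u = fderiv W (\<lambda>y. fderiv W \<tau> y u) x v"
  by (rule fderiv_symmetric[OF W.thick smooth_\<tau>])

lemmas smooth_d\<tau> = smooth_on_fderiv[OF W.thick smooth_\<tau>]

lemma fderiv_metric:
  assumes x: "x \<in> W"
  shows "fderiv W (\<lambda>y. h y v w) x u =
    fderiv T (\<lambda>z. k z (fderiv W \<tau> x v) (fderiv W \<tau> x w)) (\<tau> x) (fderiv W \<tau> x u)
    + k (\<tau> x) (fderiv W (\<lambda>y. fderiv W \<tau> y v) x u) (fderiv W \<tau> x w)
    + k (\<tau> x) (fderiv W \<tau> x v) (fderiv W (\<lambda>y. fderiv W \<tau> y w) x u)"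
proof -
  have "fderiv W (\<lambda>y. h y v w) x u = fderiv W (\<lambda>y. k (\<tau> y) (fderiv W \<tau> y v) (fderiv W \<tau> y w)) x u"
    by (rule arg_cong[where f = "\<lambda>f. f u"], rule fderiv_cong[OF x]) (rule isometric)
  also have "\<dots> = fderiv W (\<lambda>y. k (\<tau> y) (fderiv W \<tau> x v) (fderiv W \<tau> x w)) x u
    + k (\<tau> x) (fderiv W (\<lambda>y. fderiv W \<tau> y v) x u) (fderiv W \<tau> x w)
    + k (\<tau> x) (fderiv W \<tau> x v) (fderiv W (\<lambda>y. fderiv W \<tau> y w) x u)"
    using thick_fderiv_eq[OF W.thick x has_derivative_bilinear_family[OF W.thick x
          T.linear_left[OF image_in] T.linear_right[OF image_in] smooth_pull[OF T.smooth] smooth_d\<tau> smooth_d\<tau>]]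
    by simp
  finally show ?thesis by (simp add: fderiv_pull[OF T.smooth x])
qed

text \<open>The Koszul formula is not tensorial; its defect is the second derivative of the coordinate change.\<close>

lemma christoffel_change:
  assumes x: "x \<in> W"
  shows "fderiv W \<tau> x (W.\<Gamma> x u v) =
    fderiv W (\<lambda>y. fderiv W \<tau> y v) x u + T.\<Gamma> (\<tau> x) (fderiv W \<tau> x u) (fderiv W \<tau> x v)"
proof (rule T.heqI[OF image_in[OF x]])
  fix w'
  obtain w where w: "w' = fderiv W \<tau> x w" using surj_deriv[OF x] by (metis surjD)
  have "k (\<tau> x) (fderiv W \<tau> x (W.\<Gamma> x u v)) w' = koszul W h x u v w"
    by (simp add: w isometric[OF x, symmetric] W.christoffel_eq[OF x])
  also have "\<dots> = koszul T k (\<tau> x) (fderiv W \<tau> x u) (fderiv W \<tau> x v) w' + k (\<tau> x) (fderiv W (\<lambda>y. fderiv W \<tau> y v) x u) w'"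
    unfolding koszul_def fderiv_metric[OF x] w
    by (simp add: second_sym[OF x, of v u] second_sym[OF x, of w u] second_sym[OF x, of w v]
        T.hsym[OF image_in[OF x], of "fderiv W (\<lambda>y. fderiv W \<tau> y u) x w"]
        T.hsym[OF image_in[OF x], of "fderiv W (\<lambda>y. fderiv W \<tau> y v) x w"] add_divide_distrib diff_divide_distrib)
  finally show "k (\<tau> x) (fderiv W \<tau> x (W.\<Gamma> x u v)) w' =
      k (\<tau> x) (fderiv W (\<lambda>y. fderiv W \<tau> y v) x u + T.\<Gamma> (\<tau> x) (fderiv W \<tau> x u) (fderiv W \<tau> x v)) w'"
    by (simp add: T.christoffel_eq[OF image_in[OF x]] linear_add[OF T.linear_left[OF image_in[OF x]]])
qed

text \<open>Differentiating \<open>christoffel_change\<close> once more, every term that is not tensorial is symmetric in the two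
  directions of differentiation and cancels in the curvature.\<close>

lemma curvature_change:
  assumes x: "x \<in> W"
  shows "fderiv W \<tau> x (W.R x u v w) = T.R (\<tau> x) (fderiv W \<tau> x u) (fderiv W \<tau> x v) (fderiv W \<tau> x w)"
proof -
  let ?d = "\<lambda>v y. fderiv W \<tau> y v"
  let ?dd = "\<lambda>v u y. fderiv W (?d v) y u"
  note Tl = T.linear_christoffel[OF image_in[OF x]]
  have lin_d: "linear (fderiv W \<tau> y)" if "y \<in> W" for y
    using linear_fderiv[OF smooth_\<tau> that] .
  have smooth_dd: "smooth_on W (?dd v u)" for u v
    by (rule smooth_on_fderiv[OF W.thick smooth_d\<tau>])
  have smG: "smooth_on W (\<lambda>y. T.\<Gamma> (\<tau> y) (?d a y) (?d b y))" for a b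
    by (rule smooth_on_bilinear_family[OF T.linear_christoffel(1)[OF image_in] T.linear_christoffel(2)[OF image_in]
          smooth_pull[OF T.smooth_christoffel] smooth_d\<tau> smooth_d\<tau>])
  \<comment> \<open>differentiate the transformation rule of the Christoffel symbols\<close>
  have key: "fderiv W \<tau> x (fderiv W (\<lambda>y. W.\<Gamma> y b w) x a) =
      fderiv W (?dd w b) x a + fderiv T (\<lambda>z. T.\<Gamma> z (?d b x) (?d w x)) (\<tau> x) (?d a x)
      + T.\<Gamma> (\<tau> x) (?dd b a x) (?d w x) + T.\<Gamma> (\<tau> x) (?d b x) (?dd w a x)
      - ?dd (W.\<Gamma> x b w) a x" for a b
  proof -
    have "fderiv W (\<lambda>y. fderiv W \<tau> y (W.\<Gamma> y b w)) x a = fderiv W (\<lambda>y. ?dd w b y + T.\<Gamma> (\<tau> y) (?d b y) (?d w y)) x a"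
      by (rule arg_cong[where f = "\<lambda>f. f a"], rule fderiv_cong[OF x]) (rule christoffel_change)
    moreover have "fderiv W (\<lambda>y. fderiv W \<tau> y (W.\<Gamma> y b w)) x a =
        ?dd (W.\<Gamma> x b w) a x + fderiv W \<tau> x (fderiv W (\<lambda>y. W.\<Gamma> y b w) x a)"
      using thick_fderiv_eq[OF W.thick x has_derivative_linear_family[OF W.thick x lin_d smooth_d\<tau>
            smooth_on_has_derivative[OF W.smooth_christoffel x]]] by simp
    moreover have "fderiv W (\<lambda>y. T.\<Gamma> (\<tau> y) (?d b y) (?d w y)) x a =
        fderiv T (\<lambda>z. T.\<Gamma> z (?d b x) (?d w x)) (\<tau> x) (?d a x)
        + T.\<Gamma> (\<tau> x) (?dd b a x) (?d w x) + T.\<Gamma> (\<tau> x) (?d b x) (?dd w a x)"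
      using thick_fderiv_eq[OF W.thick x has_derivative_bilinear_family[OF W.thick x
            T.linear_christoffel(1)[OF image_in] T.linear_christoffel(2)[OF image_in]
            smooth_pull[OF T.smooth_christoffel] smooth_d\<tau> smooth_d\<tau>]]
      by (simp add: fderiv_pull[OF T.smooth_christoffel x])
    ultimately show ?thesis
      by (simp add: fderiv_add[OF W.thick x smooth_dd smG] algebra_simps)
  qed
  have third: "fderiv W (?dd w v) x u = fderiv W (?dd w u) x v"
    by (rule fderiv_symmetric[OF W.thick smooth_d\<tau> x])
  show ?thesis
    unfolding curvature_coord_def linear_add[OF lin_d[OF x]] linear_diff[OF lin_d[OF x]] key
      christoffel_change[OF x] third
    by (simp add: linear_add[OF Tl(2)] second_sym[OF x, of v u])
qed

end


subsection \<open>The Gauss equation\<close>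



text \<open>A metric near the slice where the first coordinate vanishes, together with the metric that it induces there.\<close>

locale hypersurface = G: metric_field S G + H: metric_field U h
  for S :: "(real \<times> 'e::euclidean_space) set" and G and U :: "'e set" and h +
  assumes slice: "y \<in> U \<Longrightarrow> (0, y) \<in> S"
    and induced: "y \<in> U \<Longrightarrow> h y u v = G (0, y) (0, u) (0, v)"
begin

text \<open>A positive multiple of the second fundamental form: the tangential part of the ambient Christoffel symbol is the
  intrinsic one, and the remaining part is measured by its first coordinate instead of a unit normal.\<close>

definition second_form :: "'e \<Rightarrow> 'e \<Rightarrow> 'e \<Rightarrow> real" where
  "second_form y u v = fst (G.\<Gamma> (0, y) (0, u) (0, v))"

lemma smooth_slice: "smooth_on U (\<lambda>y. (0, y))"
  by (intro smooth_on_linear bounded_linear_Pair bounded_linear_zero bounded_linear_ident)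

lemma fderiv_slice: "y \<in> U \<Longrightarrow> fderiv U (\<lambda>y. (0, y)) y u = (0, u)"
  by (rule fun_cong[OF thick_fderiv_eq[OF H.thick]])
    (auto intro!: bounded_linear_imp_has_derivative bounded_linear_Pair bounded_linear_zero bounded_linear_ident)

lemma smooth_restrict: "smooth_on S f \<Longrightarrow> smooth_on U (\<lambda>y. f (0, y))"
  by (rule smooth_on_compose[OF _ smooth_slice]) (auto intro: slice)

lemma fderiv_restrict:
  "smooth_on S f \<Longrightarrow> y \<in> U \<Longrightarrow> fderiv U (\<lambda>y. f (0, y)) y u = fderiv S f (0, y) (0, u)"
  using fun_cong[OF thick_fderiv_eq[OF H.thick _ has_derivative_chain_within[of S f U "\<lambda>y. (0, y)"]], of y u]
  by (auto simp: fderiv_slice smooth_slice slice image_subset_iff)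

lemma koszul_restrict:
  assumes y: "y \<in> U"
  shows "koszul U h y u v w = koszul S G (0, y) (0, u) (0, v) (0, w)"
proof -
  have "fderiv U (\<lambda>y. h y a b) y c = fderiv S (\<lambda>x. G x (0, a) (0, b)) (0, y) (0, c)" for a b c
  proof -
    have "fderiv U (\<lambda>y. h y a b) y c = fderiv U (\<lambda>y. G (0, y) (0, a) (0, b)) y c"
      by (rule fun_cong[OF fderiv_cong[OF y]]) (rule induced)
    then show ?thesis by (simp add: fderiv_restrict[OF G.smooth y])
  qed
  then show ?thesis by (simp add: koszul_def)
qed

lemma christoffel_tangential: "y \<in> U \<Longrightarrow> G (0, y) (G.\<Gamma> (0, y) (0, u) (0, v)) (0, w) = h y (H.\<Gamma> y u v) w"
  by (simp add: G.christoffel_eq[OF slice] H.christoffel_eq koszul_restrict)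

lemma smooth_second_form: "smooth_on U (\<lambda>y. second_form y u v)"
  unfolding second_form_def
  by (intro smooth_on_bounded_linear[OF bounded_linear_fst] smooth_restrict G.smooth_christoffel)

lemma second_form_sym: "y \<in> U \<Longrightarrow> second_form y u v = second_form y v u"
  unfolding second_form_def by (simp only: G.christoffel_sym[OF slice])

lemma linear_second_form: "y \<in> U \<Longrightarrow> linear (second_form y u)"
  unfolding second_form_def
  using linear_compose[OF linear_compose[OF _ G.linear_christoffel(2)[OF slice]] linear_fst, of "\<lambda>v. (0, v)" y "(0, u)"]
  by (simp add: o_def linear_iff)

text \<open>The \<open>G\<close>-gradient of the first coordinate, rescaled to a vector \<open>n\<close> with first component 1, is orthogonal to the
  slice.  The constant \<open>\<kappa>\<close> is its squared length.\<close>

lemma christoffel_product: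
  assumes y: "y \<in> U"
  obtains \<kappa> where "\<kappa> > 0" "\<And>u v w z. G (0, y) (G.\<Gamma> (0, y) (0, u) (0, v)) (G.\<Gamma> (0, y) (0, w) (0, z)) =
    h y (H.\<Gamma> y u v) (H.\<Gamma> y w z) + \<kappa> * (second_form y u v * second_form y w z)"
proof -
  interpret g: inner_form "G (0, y)" by (rule G.inner_form[OF slice[OF y]])
  obtain \<nu> where \<nu>: "\<And>w. G (0, y) \<nu> w = fst w"
    using g.ex1_representative[OF linear_fst] by blast
  have "\<nu> \<noteq> 0"
  proof
    assume "\<nu> = 0"
    then show False using \<nu>[of "(1, 0)"] by simp
  qed
  then have pos: "fst \<nu> > 0" using g.positive[of \<nu>] \<nu>[of \<nu>] by simp
  define n where "n = (1 / fst \<nu>) *\<^sub>R \<nu>"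
  have n: "G (0, y) n (0, w) = 0" "fst n = 1" for w
    using pos by (auto simp: n_def g.scaleR_left \<nu>)
  have dec: "G.\<Gamma> (0, y) (0, u) (0, v) = (0, H.\<Gamma> y u v) + second_form y u v *\<^sub>R n" for u v
  proof -
    define d where "d = G.\<Gamma> (0, y) (0, u) (0, v) - (0, H.\<Gamma> y u v) - second_form y u v *\<^sub>R n"
    have "fst d = 0" by (simp add: d_def second_form_def n)
    then have d: "d = (0, snd d)" by (simp add: prod_eq_iff)
    have "G (0, y) d (0, w) = 0" for w
      by (simp add: d_def g.diff_left g.scaleR_left n christoffel_tangential[OF y] induced[OF y])
    from this[of "snd d"] d have "G (0, y) d d = 0" by simp
    then have "d = 0" by (simp add: g.self_eq_0_iff)
    then show ?thesis by (simp add: d_def algebra_simps)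
  qed
  show thesis
  proof
    show "G (0, y) n n > 0" by (rule g.positive) (use n in auto)
    have n': "G (0, y) (0, w) n = 0" for w using n g.sym[of "(0, w)" n] by simp
    show "G (0, y) (G.\<Gamma> (0, y) (0, u) (0, v)) (G.\<Gamma> (0, y) (0, w) (0, z)) =
        h y (H.\<Gamma> y u v) (H.\<Gamma> y w z) + G (0, y) n n * (second_form y u v * second_form y w z)" for u v w z
      unfolding dec
      by (simp only: g.add_left g.add_right g.scaleR_left g.scaleR_right n n' induced[OF y]) simp
  qed
qed

text \<open>In \<open>curvature_lowered\<close> the derivative terms agree for the two metrics, since for tangential arguments the symbols of
  the first kind do; the products differ by \<open>christoffel_product\<close>.\<close>

theorem gauss_equation:
  assumes y: "y \<in> U"
  obtains \<kappa> where "\<kappa> > 0" "\<And>u v w z. G (0, y) (G.R (0, y) (0, u) (0, v) (0, w)) (0, z) =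
    h y (H.R y u v w) z - \<kappa> * (second_form y v w * second_form y u z - second_form y u w * second_form y v z)"
proof -
  obtain \<kappa> where \<kappa>: "\<kappa> > 0" "\<And>u v w z. G (0, y) (G.\<Gamma> (0, y) (0, u) (0, v)) (G.\<Gamma> (0, y) (0, w) (0, z)) =
    h y (H.\<Gamma> y u v) (H.\<Gamma> y w z) + \<kappa> * (second_form y u v * second_form y w z)"
    using christoffel_product[OF y] by blast
  have D: "fderiv U (\<lambda>y. koszul U h y v w z) y u =
      fderiv S (\<lambda>x. koszul S G x (0, v) (0, w) (0, z)) (0, y) (0, u)" for u v w z
  proof -
    have "fderiv U (\<lambda>y. koszul U h y v w z) y u = fderiv U (\<lambda>y. koszul S G (0, y) (0, v) (0, w) (0, z)) y u"
      by (rule fun_cong[OF fderiv_cong[OF y]]) (rule koszul_restrict)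
    then show ?thesis by (simp add: fderiv_restrict[OF G.smooth_koszul y])
  qed
  show thesis
    by (rule that[OF \<kappa>(1)])
      (simp add: G.curvature_lowered[OF slice[OF y]] H.curvature_lowered[OF y] D \<kappa>(2) algebra_simps)
qed

end

section \<open>Diagonalisation of symmetric bilinear forms\<close>

context inner_form
begin

definition orthonormal_basis :: "(nat \<Rightarrow> 'e) \<Rightarrow> bool" where
  "orthonormal_basis e \<longleftrightarrow> (\<forall>i<DIM('e). \<forall>j<DIM('e). h (e i) (e j) = (if i = j then 1 else 0)) \<and>
     (\<forall>v. v = (\<Sum>i<DIM('e). h v (e i) *\<^sub>R e i))"

text \<open>Used in two ways: it computes Ricci curvatures in orthonormal bases, and for the identity map it counts the
  members of such a basis.\<close>

lemma trace_expansion: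
  assumes T: "linear T" and ex: "\<And>v. v = (\<Sum>i<m. h v (e i) *\<^sub>R e i)"
  shows "(\<Sum>b\<in>Basis. T b \<bullet> b) = (\<Sum>i<m. h (T (e i)) (e i))"
proof -
  have "T b \<bullet> b = (\<Sum>i<m. h b (e i) * (T (e i) \<bullet> b))" for b
  proof -
    have "T b = T (\<Sum>i<m. h b (e i) *\<^sub>R e i)" using ex[of b] by (rule arg_cong)
    also have "\<dots> = (\<Sum>i<m. h b (e i) *\<^sub>R T (e i))"
      by (simp only: linear_sum[OF T] linear_scale[OF T])
    finally have "T b = (\<Sum>i<m. h b (e i) *\<^sub>R T (e i))" .
    then show ?thesis by (simp only: inner_sum_left inner_scaleR_left)
  qed
  then have "(\<Sum>b\<in>Basis. T b \<bullet> b) = (\<Sum>b\<in>Basis. \<Sum>i<m. h b (e i) * (T (e i) \<bullet> b))"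
    by (rule sum.cong[OF refl])
  also have "\<dots> = (\<Sum>i<m. \<Sum>b\<in>Basis. h b (e i) * (T (e i) \<bullet> b))" by (rule sum.swap)
  also have "\<dots> = (\<Sum>i<m. h (T (e i)) (e i))"
  proof (rule sum.cong[OF refl])
    fix i
    show "(\<Sum>b\<in>Basis. h b (e i) * (T (e i) \<bullet> b)) = h (T (e i)) (e i)"
      by (subst linear_basis_expansion[OF linear_left, of "T (e i)"]) (simp add: mult.commute)
  qed
  finally show ?thesis .
qed

text \<open>The quotient \<open>B v v / h v v\<close> is continuous on the compact Euclidean unit sphere of \<open>V\<close>.\<close>

lemma bilinear_quotient_maximum:
  fixes B :: "'e \<Rightarrow> 'e \<Rightarrow> real"
  assumes B: "bilinear B" and V: "subspace V" "V \<noteq> {0}"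
  obtains e l where "e \<in> V" "h e e = 1" "B e e = l" "\<And>v. v \<in> V \<Longrightarrow> B v v \<le> l * h v v"
proof -
  let ?K = "V \<inter> sphere 0 1"
  have hb: "bounded_bilinear h" "bounded_bilinear B"
    using B linear_left linear_right by (auto simp: bilinear_def bilinear_conv_bounded_bilinear[symmetric])
  have cont: "continuous_on ?K (\<lambda>v. B v v / h v v)"
  proof (rule continuous_on_divide)
    show "continuous_on ?K (\<lambda>v. B v v)" "continuous_on ?K (\<lambda>v. h v v)"
      by (rule bounded_bilinear.continuous_on[OF hb(2) continuous_on_id continuous_on_id],
          rule bounded_bilinear.continuous_on[OF hb(1) continuous_on_id continuous_on_id])
    show "\<forall>v\<in>?K. h v v \<noteq> 0" by (auto simp: self_eq_0_iff)
  qed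
  have "compact ?K" using closed_subspace[OF V(1)] by (auto intro: closed_Int_compact)
  moreover obtain v0 where "v0 \<in> V" "v0 \<noteq> 0" using V subspace_0 by blast
  then have "v0 /\<^sub>R norm v0 \<in> ?K" using V(1) by (auto intro: subspace_scale)
  then have "?K \<noteq> {}" by blast
  ultimately obtain f where f: "f \<in> ?K" "\<And>v. v \<in> ?K \<Longrightarrow> B v v / h v v \<le> B f f / h f f"
    using continuous_attains_sup[OF _ _ cont] by blast
  have "f \<noteq> 0" using f(1) by auto
  then have f0: "f \<noteq> 0" "h f f > 0" using positive[of f] by auto
  define l where "l = B f f / h f f"
  define s where "s = sqrt (h f f)"
  have s: "s * s = h f f" "s \<noteq> 0" using f0(2) by (simp_all add: s_def)
  define e where "e = f /\<^sub>R s"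
  note Bl = bilinear_lmul[OF B] bilinear_rmul[OF B]
  have e: "e \<in> V" "h e e = 1" "B e e = l"
  proof -
    have inv: "inverse s * (inverse s * a) = a / h f f" for a
      using s(2) by (simp add: s(1)[symmetric] field_simps)
    show "e \<in> V" using f(1) V(1) by (auto simp: e_def subspace_scale)
    show "h e e = 1" using f0(2) inv[of "h f f"] by (simp add: e_def scaleR_left scaleR_right)
    show "B e e = l" using inv[of "B f f"] by (simp add: e_def l_def Bl)
  qed
  have max: "B v v \<le> l * h v v" if "v \<in> V" for v
  proof (cases "v = 0")
    case False
    have "v /\<^sub>R norm v \<in> ?K" using False that V(1) by (auto intro: subspace_scale)
    from f(2)[OF this] have "B v v / h v v \<le> l"
      using False by (simp add: scaleR_left scaleR_right Bl l_def)
    then show ?thesis using positive[OF False] by (simp add: pos_divide_le_eq)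
  qed (use Bl(1)[of 0] in simp)
  show thesis using that[OF e max] .
qed

text \<open>The form \<open>l h - B\<close> is nonnegative on \<open>V\<close> and vanishes at \<open>e\<close>; moving from \<open>e\<close> by a small multiple of \<open>w\<close> must not make
  it negative.\<close>

lemma maximiser_orthogonal:
  fixes B :: "'e \<Rightarrow> 'e \<Rightarrow> real"
  assumes B: "bilinear B" and Bsym: "\<And>u v. B u v = B v u" and V: "subspace V"
    and e: "e \<in> V" "h e e = 1" "B e e = l" "\<And>v. v \<in> V \<Longrightarrow> B v v \<le> l * h v v"
    and w: "w \<in> V" "h w e = 0"
  shows "B e w = 0"
proof (rule ccontr)
  assume c: "B e w \<noteq> 0"
  define q where "q = l * h w w - B w w"
  have q: "q \<ge> 0" using e(4)[OF w(1)] by (simp add: q_def)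
  define t where "t = B e w / (q + 1)"
  have "e + t *\<^sub>R w \<in> V" using V e(1) w(1) by (auto intro: subspace_add subspace_scale)
  from e(4)[OF this] have "2 * t * B e w \<le> t\<^sup>2 * q"
    using w(2) e(2,3) sym[of e w] Bsym[of w e]
    by (simp add: bilinear_ladd[OF B] bilinear_radd[OF B] bilinear_lmul[OF B] bilinear_rmul[OF B]
        add_left add_right scaleR_left scaleR_right q_def power2_eq_square algebra_simps)
  moreover have "B e w = t * (q + 1)" using q by (simp add: t_def)
  ultimately have "t\<^sup>2 * (q + 2) \<le> 0" by (simp add: power2_eq_square algebra_simps)
  moreover have "t\<^sup>2 * (q + 2) > 0" using c q by (intro mult_pos_pos) (auto simp: t_def)
  ultimately show False by linarith
qed

lemma diagonal_basis_of_subspace: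
  fixes B :: "'e \<Rightarrow> 'e \<Rightarrow> real"
  assumes B: "bilinear B" and Bsym: "\<And>u v. B u v = B v u" and V: "subspace V"
  shows "\<exists>(m::nat) e. (\<forall>i<m. e i \<in> V) \<and> (\<forall>i<m. \<forall>j<m. h (e i) (e j) = (if i = j then 1 else 0)) \<and>
    (\<forall>i<m. \<forall>j<m. i \<noteq> j \<longrightarrow> B (e i) (e j) = 0) \<and> (\<forall>v\<in>V. v = (\<Sum>i<m. h v (e i) *\<^sub>R e i))"
  using V
proof (induction "dim V" arbitrary: V rule: less_induct)
  case less
  show ?case
  proof (cases "V = {0}")
    case True
    then show ?thesis by (intro exI[of _ "0::nat"]) auto
  next
    case False
    obtain f l where f: "f \<in> V" "h f f = 1" "B f f = l" "\<And>v. v \<in> V \<Longrightarrow> B v v \<le> l * h v v"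
      using bilinear_quotient_maximum[OF B less.prems False] by blast
    define W where "W = {v \<in> V. h v f = 0}"
    have W: "subspace W"
      using less.prems by (auto simp: W_def subspace_def add_left scaleR_left)
    have "f \<notin> W" "W \<subseteq> V" by (auto simp: W_def f(2))
    then have "W \<subset> V" using f(1) by blast
    then have "dim W < dim V"
      using W less.prems by (metis dim_psubset span_eq_iff)
    from less.hyps[OF this W] obtain m :: nat and e where me: "(\<forall>i<m. e i \<in> W) \<and>
        (\<forall>i<m. \<forall>j<m. h (e i) (e j) = (if i = j then 1 else 0)) \<and>
        (\<forall>i<m. \<forall>j<m. i \<noteq> j \<longrightarrow> B (e i) (e j) = 0) \<and> (\<forall>v\<in>W. v = (\<Sum>i<m. h v (e i) *\<^sub>R e i))"
      by blast
    then have e: "\<And>i. i < m \<Longrightarrow> e i \<in> W"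
        "\<And>i j. i < m \<Longrightarrow> j < m \<Longrightarrow> h (e i) (e j) = (if i = j then 1 else 0)"
        "\<And>i j. i < m \<Longrightarrow> j < m \<Longrightarrow> i \<noteq> j \<Longrightarrow> B (e i) (e j) = 0"
      by blast+
    from me have expW: "v = (\<Sum>i<m. h v (e i) *\<^sub>R e i)" if "v \<in> W" for v
      using that by blast
    have eV: "e i \<in> V" "h (e i) f = 0" "h f (e i) = 0" if "i < m" for i
      using e(1)[OF that] sym[of f] by (auto simp: W_def)
    have Bf: "B f (e i) = 0" "B (e i) f = 0" if "i < m" for i
      using maximiser_orthogonal[OF B Bsym less.prems f eV(1)[OF that] eV(2)[OF that]] Bsym[of f] by auto
    define e' where "e' = (\<lambda>i. if i = m then f else e i)"
    have exp: "v = (\<Sum>i<Suc m. h v (e' i) *\<^sub>R e' i)" if v: "v \<in> V" for v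
    proof -
      define w where "w = v - h v f *\<^sub>R f"
      have "w \<in> W"
        using v f(1,2) less.prems by (auto simp: W_def w_def diff_left scaleR_left subspace_diff subspace_scale)
      then have "w = (\<Sum>i<m. h w (e i) *\<^sub>R e i)" by (rule expW)
      also have "\<dots> = (\<Sum>i<m. h v (e' i) *\<^sub>R e' i)"
        by (intro sum.cong refl) (auto simp: w_def e'_def diff_left scaleR_left eV(3))
      finally have "w + h v f *\<^sub>R f = (\<Sum>i<Suc m. h v (e' i) *\<^sub>R e' i)" by (simp add: e'_def)
      moreover have "w + h v f *\<^sub>R f = v" by (simp add: w_def)
      ultimately show ?thesis by simp
    qed
    show ?thesis
    proof (intro exI[of _ "Suc m"] exI[of _ e'] conjI)
      show "\<forall>v\<in>V. v = (\<Sum>i<Suc m. h v (e' i) *\<^sub>R e' i)" using exp by (rule ballI)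
    qed (auto simp: e'_def f(1,2) e eV Bf less_Suc_eq)
  qed
qed

text \<open>The spectral theorem, by splitting off one maximiser after the other.\<close>

theorem diagonal_basis:
  fixes B :: "'e \<Rightarrow> 'e \<Rightarrow> real"
  assumes B: "bilinear B" and Bsym: "\<And>u v. B u v = B v u"
  obtains e where "orthonormal_basis e"
    "\<And>i j. i < DIM('e) \<Longrightarrow> j < DIM('e) \<Longrightarrow> i \<noteq> j \<Longrightarrow> B (e i) (e j) = 0"
proof -
  from diagonal_basis_of_subspace[OF B Bsym subspace_UNIV] obtain m :: nat and e where me: "(\<forall>i<m. e i \<in> UNIV) \<and>
      (\<forall>i<m. \<forall>j<m. h (e i) (e j) = (if i = j then 1 else 0)) \<and>
      (\<forall>i<m. \<forall>j<m. i \<noteq> j \<longrightarrow> B (e i) (e j) = 0) \<and> (\<forall>v\<in>UNIV. v = (\<Sum>i<m. h v (e i) *\<^sub>R e i))"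
    by blast
  from me have ex: "v = (\<Sum>i<m. h v (e i) *\<^sub>R e i)" for v by blast
  from me have orth: "\<And>i j. i < m \<Longrightarrow> j < m \<Longrightarrow> h (e i) (e j) = (if i = j then 1 else 0)" by blast
  \<comment> \<open>the trace of the identity counts the basis\<close>
  have "(\<Sum>b\<in>(Basis::'e set). b \<bullet> b) = (\<Sum>i<m. h (e i) (e i))"
    by (rule trace_expansion[OF linear_ident ex])
  then have "real DIM('e) = real m"
    by (simp add: orth)
  then have m: "m = DIM('e)" by simp
  show thesis
  proof
    show "orthonormal_basis e" unfolding orthonormal_basis_def m[symmetric] using me by blast
    show "B (e i) (e j) = 0" if "i < DIM('e)" "j < DIM('e)" "i \<noteq> j" for i j
      using me that unfolding m by blast
  qed
qed

end

section \<open>Signs of eigenvalues\<close>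

text \<open>If \<open>K\<close> avoids both \<open>a\<close> and \<open>b\<close>, then \<open>l a\<close> and \<open>l b\<close> have the sign opposite to the same sum.  Hence all \<open>l a\<close> have one
  sign, which contradicts any single instance of the hypothesis.\<close>

lemma no_eigenvalues_with_negative_partial_sums:
  fixes l :: "nat \<Rightarrow> real"
  assumes k: "1 \<le> k" "k + 2 \<le> m"
    and neg: "\<And>a K. a < m \<Longrightarrow> K \<subseteq> {..<m} - {a} \<Longrightarrow> card K = k \<Longrightarrow> l a * (\<Sum>i\<in>K. l i) < 0"
  shows False
proof -
  have km: "k \<le> m - 2" "k \<le> m - 1" using k by simp_all
  have same: "l a * l b > 0" if ab: "a < m" "b < m" "a \<noteq> b" for a b
  proof -
    have "card ({..<m} - {a, b}) = m - 2" using ab by (subst card_Diff_subset) auto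
    then obtain K where K: "K \<subseteq> {..<m} - {a, b}" "card K = k"
      using obtain_subset_with_card_n[of k "{..<m} - {a, b}"] km by metis
    have "l a * (\<Sum>i\<in>K. l i) < 0" "l b * (\<Sum>i\<in>K. l i) < 0"
      using neg[of a K] neg[of b K] K ab by auto
    then have "(l a * (\<Sum>i\<in>K. l i)) * (l b * (\<Sum>i\<in>K. l i)) > 0" "(\<Sum>i\<in>K. l i) \<noteq> 0"
      by (auto intro: mult_neg_neg)
    then have "(l a * l b) * ((\<Sum>i\<in>K. l i) * (\<Sum>i\<in>K. l i)) > 0"
      by (simp only: mult_ac)
    then show ?thesis
      by (rule zero_less_mult_pos2) (use \<open>(\<Sum>i\<in>K. l i) \<noteq> 0\<close> in \<open>simp add: zero_less_mult_iff, linarith\<close>)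
  qed
  have "card ({..<m} - {0}) = m - 1" using k by simp
  then obtain K where K: "K \<subseteq> {..<m} - {0}" "card K = k"
    using obtain_subset_with_card_n[of k "{..<m} - {0}"] km by metis
  have "l 0 * (\<Sum>i\<in>K. l i) = (\<Sum>i\<in>K. l 0 * l i)" by (rule sum_distrib_left)
  also have "\<dots> > 0"
    using K k by (intro sum_pos same) (auto intro: finite_subset card_ge_0_finite)
  finally show False using neg[of 0 K] K k by auto
qed

text \<open>If all \<open>l a\<close> had one sign, the product for \<open>a = 0\<close> would be positive; the bound on \<open>m\<close> makes the sum nonempty.\<close>

lemma eigenvalues_of_both_signs:
  fixes l :: "nat \<Rightarrow> real"
  assumes m: "2 \<le> m" and neg: "\<And>a. a < m \<Longrightarrow> l a * (\<Sum>i\<in>{..<m} - {a}. l i) < 0"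
  shows "\<And>a. a < m \<Longrightarrow> l a \<noteq> 0" "\<exists>a<m. l a > 0" "\<exists>a<m. l a < 0"
proof -
  show nz: "l a \<noteq> 0" if "a < m" for a using neg[OF that] by auto
  have ne: "{..<m} - {0} \<noteq> {}" using m by (auto simp: set_eq_iff intro: exI[of _ 1])
  show "\<exists>a<m. l a > 0"
  proof (rule ccontr)
    assume "\<not> ?thesis"
    then have *: "l a < 0" if "a < m" for a using nz[OF that] that by (metis linorder_neqE_linordered_idom)
    have "(\<Sum>i\<in>{..<m} - {0}. - l i) > 0" using * ne by (intro sum_pos) auto
    then have "(\<Sum>i\<in>{..<m} - {0}. l i) < 0" by (simp add: sum_negf)
    then show False using neg[of 0] *[of 0] m by (auto simp: mult_less_0_iff)
  qed
  show "\<exists>a<m. l a < 0"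
  proof (rule ccontr)
    assume "\<not> ?thesis"
    then have *: "l a > 0" if "a < m" for a using nz[OF that] that by (metis linorder_neqE_linordered_idom)
    have "(\<Sum>i\<in>{..<m} - {0}. l i) > 0" using * ne by (intro sum_pos) auto
    then show False using neg[of 0] *[of 0] m by (auto simp: mult_less_0_iff)
  qed
qed

section \<open>Smooth square roots\<close>

text \<open>The equation \<open>s\<^sup>2 = b\<close> turns increments into a linear equation,
  \<open>s(y) (s(y) - s(x)) + (s(y) - s(x)) s(x) = b(y) - b(x)\<close>, whose coefficients are merely continuous at first.  This yields
  differentiability with a derivative that solves a Sylvester equation in \<open>s\<close>, and smoothness follows by
  induction on the order.\<close>

lemma square_root_Ck:
  fixes P :: "'v::euclidean_space \<Rightarrow> 'v \<Rightarrow> 'v" and s :: "'a::euclidean_space \<Rightarrow> 'v"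
  assumes U: "open U" and P: "bounded_bilinear P" and sq: "\<And>y. y \<in> U \<Longrightarrow> P (s y) (s y) = b y"
    and b: "\<And>k. Ck_on k U b" and s: "continuous_on U s"
    and inj: "\<And>y. y \<in> U \<Longrightarrow> inj (\<lambda>X. P (s y) X + P X (s y))"
  shows "Ck_on k U s"
proof -
  interpret P: bounded_bilinear P by (rule P)
  define T where "T = (\<lambda>x y X. P (s y) X + P X (s x))"
  have linT: "linear (T x y)" for x y
    by (rule linearI) (simp_all add: T_def P.add_left P.add_right P.scaleR_left P.scaleR_right scaleR_add_right)
  let ?b' = "\<lambda>x. frechet_derivative b (at x)"
  define s' where "s' = (\<lambda>x u. inv (T x x) (?b' x u))"
  have injT: "inj (T x x)" if "x \<in> U" for x using inj[OF that] by (simp add: T_def)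
  have s': "T x x (s' x u) = ?b' x u" if "x \<in> U" for x u
    using linear_injective_imp_surjective[OF linT injT[OF that]] by (simp add: s'_def surj_f_inv_f)
  have D: "(s has_derivative s' x) (at x)" if x: "x \<in> U" for x
  proof -
    have b': "(b has_derivative ?b' x) (at x)" by (rule Ck_on_SucD[OF b x])
    have "linear (?b' x)" using b' has_derivative_linear by blast
    then have "T x x (s' x (u + v)) = T x x (s' x u + s' x v)" "T x x (s' x (c *\<^sub>R u)) = T x x (c *\<^sub>R s' x u)" for u v c
      by (simp_all add: s'[OF x] linear_add linear_scale linear_add[OF linT] linear_scale[OF linT])
    then have lin: "linear (s' x)" using injD[OF injT[OF x]] by (intro linearI) blast+
    have "((\<lambda>y. s y - s x) has_derivative s' x) (at x)"
    proof (rule linear_equation_solution_has_derivative[where T = "T x" and f = "\<lambda>y. b y - b x" and f' = "?b' x"])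
      show "((\<lambda>y. b y - b x) has_derivative ?b' x) (at x)"
        using has_derivative_diff[OF b' has_derivative_const[of "b x"]] by simp
      have "isCont s x" using s U x by (simp add: continuous_on_eq_continuous_at)
      then show "isCont (\<lambda>y. T x y X) x" for X
        unfolding T_def by (intro continuous_add P.isCont continuous_const)
      show "T x y (s y - s x) = b y - b x" if "y \<in> U" for y
        by (simp add: T_def P.diff_left P.diff_right sq[OF that] sq[OF x])
    qed (use U x linT injT lin s' in auto)
    then have "((\<lambda>y. (s y - s x) + s x) has_derivative (\<lambda>u. s' x u + 0)) (at x)"
      by (intro has_derivative_add has_derivative_const)
    then show ?thesis by simp
  qed
  show ?thesis
  proof (induction k)
    case (Suc k)
    show ?case
    proof (rule Ck_on_SucI[OF U D])
      fix u
      show "Ck_on k U (\<lambda>x. s' x u)"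
      proof (rule Ck_on_linear_solution[OF U, where T = "\<lambda>y. T y y" and f = "\<lambda>y. ?b' y u"])
        show "Ck_on k U (\<lambda>y. T y y X)" for X
          unfolding T_def by (intro Ck_on_add[OF U] Ck_on_bilinear[OF U P] Suc.IH Ck_on_const)
        show "Ck_on k U (\<lambda>y. ?b' y u)" using b[of "Suc k"] by simp
      qed (use linT injT s' in auto)
    qed
  qed (use s in simp)
qed

subsection \<open>The Euclidean space of endomorphisms\<close>

text \<open>A finite index type of cardinality \<open>DIM('e)\<close> makes the endomorphisms of \<open>'e\<close> a Euclidean space, so that the calculus
  above applies to functions with values in endomorphisms.\<close>

typedef (overloaded) 'e basis_index = "Basis :: 'e::euclidean_space set"
  by (rule ex_in_conv[THEN iffD2]) (rule nonempty_Basis)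

instance basis_index :: (euclidean_space) finite
proof
  have "(UNIV :: 'a basis_index set) = Abs_basis_index ` Basis"
    by (metis Abs_basis_index_cases UNIV_eq_I image_eqI)
  then show "finite (UNIV :: 'a basis_index set)" by (metis finite_Basis finite_imageI)
qed

type_synonym 'e endo = "'e ^ 'e basis_index"

definition endo_apply :: "'e::euclidean_space endo \<Rightarrow> 'e \<Rightarrow> 'e" where
  "endo_apply Z v = (\<Sum>i\<in>UNIV. (v \<bullet> Rep_basis_index i) *\<^sub>R Z $ i)"

definition endo_of :: "('e::euclidean_space \<Rightarrow> 'e) \<Rightarrow> 'e endo" where
  "endo_of T = (\<chi> i. T (Rep_basis_index i))"

lemma endo_apply_of: "linear T \<Longrightarrow> endo_apply (endo_of T) v = T v"
proof -
  assume T: "linear T"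
  have bij: "bij_betw Rep_basis_index UNIV (Basis :: 'a set)"
    by (simp add: bij_betw_def inj_on_def Rep_basis_index_inject type_definition.Rep_range[OF type_definition_basis_index])
  have "endo_apply (endo_of T) v = (\<Sum>i\<in>UNIV. (\<lambda>b. (v \<bullet> b) *\<^sub>R T b) (Rep_basis_index i))"
    by (simp add: endo_apply_def endo_of_def)
  also have "\<dots> = (\<Sum>b\<in>Basis. (v \<bullet> b) *\<^sub>R T b)" by (rule sum.reindex_bij_betw[OF bij])
  finally show ?thesis by (simp add: linear_basis_expansion[OF T, symmetric])
qed

lemma linear_endo_apply: "linear (endo_apply Z)" "linear (\<lambda>Z. endo_apply Z v)"
  by (rule linearI; simp add: endo_apply_def inner_add_left scaleR_add_left scaleR_add_right sum.distrib scaleR_sum_right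
      mult.commute)+

lemma endo_eqI:
  assumes "\<And>v. endo_apply X v = endo_apply Y v"
  shows "X = Y"
proof -
  have "endo_apply Z (Rep_basis_index i) = Z $ i" for Z :: "'a endo" and i
  proof -
    have "(Rep_basis_index i \<bullet> Rep_basis_index j) *\<^sub>R Z $ j = (if j = i then Z $ j else 0)" for j
      using Rep_basis_index[of i] Rep_basis_index[of j] by (auto simp: inner_Basis Rep_basis_index_inject)
    then show ?thesis by (simp add: endo_apply_def)
  qed
  then show ?thesis using assms by (metis vec_eq_iff)
qed

definition endo_comp :: "'e::euclidean_space endo \<Rightarrow> 'e endo \<Rightarrow> 'e endo" where
  "endo_comp X Y = endo_of (\<lambda>v. endo_apply X (endo_apply Y v))"

lemma endo_apply_comp: "endo_apply (endo_comp X Y) v = endo_apply X (endo_apply Y v)"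
  unfolding endo_comp_def
  by (rule endo_apply_of) (rule linear_compose[OF linear_endo_apply(1) linear_endo_apply(1), unfolded o_def])

lemma bounded_bilinear_endo_comp: "bounded_bilinear endo_comp"
proof -
  note l = linear_endo_apply
  have "bilinear endo_comp"
    unfolding bilinear_def
    by (intro conjI allI; rule linearI; rule endo_eqI;
        simp add: endo_apply_comp linear_add[OF l(2)] linear_scale[OF l(2)] linear_add[OF l(1)] linear_scale[OF l(1)])
  then show ?thesis by (simp add: bilinear_conv_bounded_bilinear)
qed

lemma Ck_on_endo_of:
  fixes T :: "'a::euclidean_space \<Rightarrow> 'e::euclidean_space \<Rightarrow> 'e"
  assumes U: "open U" and T: "\<And>v. Ck_on k U (\<lambda>y. T y v)"
  shows "Ck_on k U (\<lambda>y. endo_of (T y))"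
proof -
  have ax: "bounded_linear (axis i :: 'e \<Rightarrow> 'e endo)" for i
    unfolding linear_conv_bounded_linear[symmetric]
    by (rule linearI) (auto simp: axis_def vec_eq_iff)
  have "endo_of (T y) = (\<Sum>i\<in>UNIV. axis i (T y (Rep_basis_index i)))" for y
    by (simp add: vec_eq_iff endo_of_def axis_def if_distrib[of "\<lambda>x. x $ _"] cong: if_cong)
  then show ?thesis
    using Ck_on_sum[OF U Ck_on_bounded_linear[OF U ax T]] by simp
qed

section \<open>Spectral splitting of a symmetric bilinear form\<close>

context inner_form
begin

lemma linear_eqI_orthonormal_basis:
  assumes e: "orthonormal_basis e" and f: "linear f" and g: "linear g" and eq: "\<And>i. i < DIM('e) \<Longrightarrow> f (e i) = g (e i)"
  shows "f v = g v"
proof -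
  have v: "v = (\<Sum>i<DIM('e). h v (e i) *\<^sub>R e i)" using e unfolding orthonormal_basis_def by blast
  have "f (\<Sum>i<DIM('e). h v (e i) *\<^sub>R e i) = g (\<Sum>i<DIM('e). h v (e i) *\<^sub>R e i)"
    by (simp add: linear_sum[OF f] linear_sum[OF g] linear_scale[OF f] linear_scale[OF g] eq)
  then show ?thesis by (simp only: v[symmetric])
qed

lemma orthonormal_basisD:
  assumes "orthonormal_basis e"
  shows "i < DIM('e) \<Longrightarrow> j < DIM('e) \<Longrightarrow> h (e i) (e j) = (if i = j then 1 else 0)"
    and "v = (\<Sum>i<DIM('e). h v (e i) *\<^sub>R e i)"
  using assms unfolding orthonormal_basis_def by blast+

lemma orthonormal_basis_nonzero:
  assumes "orthonormal_basis e" "i < DIM('e)"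
  shows "e i \<noteq> 0"
proof
  assume "e i = 0"
  then show False using orthonormal_basisD(1)[OF assms(1) assms(2) assms(2)] by simp
qed

lemma orthonormal_basis_sum:
  assumes e: "orthonormal_basis e" and j: "j < DIM('e)"
  shows "(\<Sum>i<DIM('e). c i * h (e j) (e i)) = c j"
proof -
  have "(\<Sum>i<DIM('e). c i * h (e j) (e i)) = (\<Sum>i<DIM('e). if i = j then c i else 0)"
    using e j by (intro sum.cong refl) (auto simp: orthonormal_basis_def)
  then show ?thesis using j by simp
qed

lemma orthonormal_basis_sum_scaleR:
  fixes f :: "nat \<Rightarrow> 'b::real_vector"
  assumes e: "orthonormal_basis e" and j: "j < DIM('e)"
  shows "(\<Sum>i<DIM('e). h (e j) (e i) *\<^sub>R f i) = f j"
proof -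
  have "(\<Sum>i<DIM('e). h (e j) (e i) *\<^sub>R f i) = (\<Sum>i<DIM('e). if i = j then f i else 0)"
    using e j by (intro sum.cong refl) (auto simp: orthonormal_basis_def)
  then show ?thesis using j by simp
qed

lemma eigenbasis:
  assumes L: "linear L" and adj: "\<And>u v. h (L u) v = h u (L v)"
  obtains e l where "orthonormal_basis e" "\<And>i. i < DIM('e) \<Longrightarrow> L (e i) = l i *\<^sub>R e i"
proof -
  have "bilinear (\<lambda>u v. h (L u) v)"
    unfolding bilinear_def using linear_compose[OF L linear_left] linear_right by (simp add: o_def)
  moreover have "h (L u) v = h (L v) u" for u v using adj[of u v] sym by simp
  ultimately obtain e where e: "orthonormal_basis e"
      "\<And>i j. i < DIM('e) \<Longrightarrow> j < DIM('e) \<Longrightarrow> i \<noteq> j \<Longrightarrow> h (L (e i)) (e j) = 0"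
    using diagonal_basis[of "\<lambda>u v. h (L u) v"] by blast
  have "L (e i) = h (L (e i)) (e i) *\<^sub>R e i" if i: "i < DIM('e)" for i
  proof -
    have "L (e i) = (\<Sum>j<DIM('e). h (L (e i)) (e j) *\<^sub>R e j)"
      using e(1) unfolding orthonormal_basis_def by blast
    also have "\<dots> = (\<Sum>j<DIM('e). if j = i then h (L (e i)) (e j) *\<^sub>R e j else 0)"
      using e(2)[OF i] by (intro sum.cong refl) auto
    also have "\<dots> = h (L (e i)) (e i) *\<^sub>R e i" using i by simp
    finally show ?thesis .
  qed
  then show thesis by (rule that[OF e(1), of "\<lambda>i. h (L (e i)) (e i)"])
qed

text \<open>The absolute value of an \<open>h\<close>-selfadjoint endomorphism, acting by \<open>\<bar>l\<bar>\<close> on the eigenvectors for \<open>l\<close>.\<close>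

lemma absolute_value:
  assumes L: "linear L" and adj: "\<And>u v. h (L u) v = h u (L v)"
  shows "\<exists>S. linear S \<and> (\<forall>v. S (S v) = L (L v)) \<and> (\<forall>v. h (S v) v \<ge> 0) \<and> (\<forall>l v. L v = l *\<^sub>R v \<longrightarrow> S v = \<bar>l\<bar> *\<^sub>R v)"
proof -
  obtain e l where e: "orthonormal_basis e" and l: "\<And>i. i < DIM('e) \<Longrightarrow> L (e i) = l i *\<^sub>R e i"
    using eigenbasis[OF L adj] by blast
  define S where "S = (\<lambda>v. \<Sum>i<DIM('e). (\<bar>l i\<bar> * h v (e i)) *\<^sub>R e i)"
  have S: "linear S"
    by (rule linearI) (simp_all add: S_def add_left scaleR_left algebra_simps sum.distrib scaleR_sum_right)
  have eig: "S v = \<bar>k\<bar> *\<^sub>R v" if "L v = k *\<^sub>R v" for k v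
  proof -
    have "\<bar>l i\<bar> * h v (e i) = \<bar>k\<bar> * h v (e i)" if i: "i < DIM('e)" for i
    proof -
      have "k * h v (e i) = l i * h v (e i)"
        using adj[of v "e i"] unfolding l[OF i] \<open>L v = k *\<^sub>R v\<close> by (simp only: scaleR_left scaleR_right)
      then show ?thesis by auto
    qed
    then have "S v = (\<Sum>i<DIM('e). (\<bar>k\<bar> * h v (e i)) *\<^sub>R e i)"
      unfolding S_def by (intro sum.cong refl) (metis lessThan_iff)
    also have "\<dots> = \<bar>k\<bar> *\<^sub>R (\<Sum>i<DIM('e). h v (e i) *\<^sub>R e i)"
      by (simp add: scaleR_sum_right)
    also have "(\<Sum>i<DIM('e). h v (e i) *\<^sub>R e i) = v"
      using e unfolding orthonormal_basis_def by metis
    finally show ?thesis .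
  qed
  have "S (S v) = L (L v)" for v
  proof (rule linear_eqI_orthonormal_basis[OF e, of "\<lambda>v. S (S v)" "\<lambda>v. L (L v)"])
    show "linear (\<lambda>v. S (S v))" "linear (\<lambda>v. L (L v))"
      using linear_compose[OF S S] linear_compose[OF L L] by (simp_all add: o_def)
    show "S (S (e i)) = L (L (e i))" if "i < DIM('e)" for i
      by (simp add: eig[OF l[OF that]] l[OF that] linear_scale[OF S] linear_scale[OF L])
  qed
  moreover have "h (S v) v \<ge> 0" for v
  proof -
    have "h (S v) v = (\<Sum>i<DIM('e). \<bar>l i\<bar> * (h v (e i) * h v (e i)))"
      unfolding S_def sum_left scaleR_left by (intro sum.cong refl) (metis sym mult.assoc)
    also have "\<dots> \<ge> 0" by (intro sum_nonneg mult_nonneg_nonneg[OF abs_ge_zero] zero_le_square)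
    finally show ?thesis .
  qed
  ultimately show ?thesis using S eig by blast
qed

end

text \<open>Positive definiteness is uniform near a point.\<close>

lemma inner_form_bounded_below_nearby:
  fixes h :: "'a::metric_space \<Rightarrow> 'e::euclidean_space \<Rightarrow> 'e \<Rightarrow> real"
  assumes h: "\<forall>\<^sub>F y in nhds x. inner_form (h y)" and cont: "\<And>u v. isCont (\<lambda>y. h y u v) x"
  obtains c where "c > 0" "\<forall>\<^sub>F y in nhds x. \<forall>w. c * (norm w * norm w) \<le> h y w w"
proof -
  interpret x: inner_form "h x" using eventually_nhds_x_imp_x[OF h] .
  have "(UNIV :: 'e set) \<noteq> {0}" using nonempty_Basis nonzero_Basis by blast
  moreover have "bilinear ((\<bullet>) :: 'e \<Rightarrow> 'e \<Rightarrow> real)"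
    using bilinear_conv_bounded_bilinear bounded_bilinear_inner by blast
  ultimately obtain l where l: "\<And>v. v \<bullet> v \<le> l * h x v v"
    using x.bilinear_quotient_maximum[of "(\<bullet>)" UNIV] subspace_UNIV by (metis UNIV_I)
  obtain b :: 'e where b: "b \<in> Basis" using nonempty_Basis by blast
  have "l * h x b b > 0" using l[of b] b by simp
  then have l0: "l > 0" using x.positive[of b] nonzero_Basis[OF b] by (simp add: zero_less_mult_iff)
  define c where "c = 1 / (2 * l)"
  have c: "c > 0" using l0 by (simp add: c_def)
  have lower: "2 * c * (norm w * norm w) \<le> h x w w" for w
    using l[of w] l0 by (simp add: c_def dot_square_norm power2_eq_square field_simps)
  let ?E = "\<lambda>y. \<Sum>b\<in>Basis. norm ((\<Sum>b'\<in>Basis. h y b b' *\<^sub>R b') - (\<Sum>b'\<in>Basis. h x b b' *\<^sub>R b'))"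
  have "isCont (\<lambda>y. \<Sum>b'\<in>Basis. h y b b' *\<^sub>R b') x" for b
    by (intro continuous_sum continuous_scaleR cont continuous_const)
  then have "(?E \<longlongrightarrow> (\<Sum>b\<in>(Basis::'e set). 0)) (at x)"
    by (intro tendsto_sum tendsto_norm_zero LIM_zero isContD)
  then have "\<forall>\<^sub>F y in at x. ?E y < c"
    using c order_tendstoD(2)[of ?E 0 "at x" c] by simp
  then have "\<forall>\<^sub>F y in nhds x. ?E y < c"
    using c by (auto simp: eventually_at_filter elim: eventually_mono)
  then have "\<forall>\<^sub>F y in nhds x. \<forall>w. c * (norm w * norm w) \<le> h y w w"
    using h
  proof eventually_elim
    case (elim y)
    interpret y: inner_form "h y" by (rule elim(2))
    show ?case
    proof
      fix w
      have "norm (y.flat w - x.flat w) \<le> (\<Sum>b\<in>Basis. norm (y.flat b - x.flat b)) * norm w"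
        by (rule linear_family_difference_bound[OF y.linear_flat x.linear_flat])
      also have "(\<Sum>b\<in>Basis. norm (y.flat b - x.flat b)) = ?E y"
        by (simp add: y.flat_def x.flat_def)
      also have "?E y * norm w \<le> c * norm w" using elim(1) by (intro mult_right_mono) auto
      finally have "norm (y.flat w - x.flat w) * norm w \<le> c * norm w * norm w"
        by (intro mult_right_mono) auto
      moreover have "\<bar>(y.flat w - x.flat w) \<bullet> w\<bar> \<le> norm (y.flat w - x.flat w) * norm w"
        by (rule Cauchy_Schwarz_ineq2)
      moreover have "(y.flat w - x.flat w) \<bullet> w = h y w w - h x w w"
        by (simp add: inner_diff_left y.inner_flat x.inner_flat)
      ultimately show "c * (norm w * norm w) \<le> h y w w"
        using lower[of w] by (simp add: mult.assoc)
    qed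
  qed
  with c show thesis using that by blast
qed

text \<open>The sum of the eigenspaces for eigenvalues of the sign of \<open>\<sigma>\<close>, which is 1 or -1 in all uses.  Rescaling \<open>L\<close> by a positive
  factor does not change it.\<close>

definition eigen_span :: "('e::euclidean_space \<Rightarrow> 'e) \<Rightarrow> real \<Rightarrow> 'e set" where
  "eigen_span L \<sigma> = span {v. \<exists>l>0. L v = (\<sigma> * l) *\<^sub>R v}"

locale selfadjoint_family =
  fixes U :: "'a::euclidean_space set" and h :: "'a \<Rightarrow> 'e::euclidean_space \<Rightarrow> 'e \<Rightarrow> real" and L :: "'a \<Rightarrow> 'e \<Rightarrow> 'e"
  assumes U: "open U" and inner: "y \<in> U \<Longrightarrow> inner_form (h y)" and smooth_h: "smooth_on U (\<lambda>y. h y u v)"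
    and lin: "y \<in> U \<Longrightarrow> linear (L y)" and inj: "y \<in> U \<Longrightarrow> inj (L y)"
    and adj: "y \<in> U \<Longrightarrow> h y (L y u) v = h y u (L y v)" and smooth_L: "smooth_on U (\<lambda>y. L y v)"
begin

text \<open>Continuity of the root is proved on the eigenvectors \<open>v\<close> at a point \<open>x\<close>: if \<open>s\<close> is the eigenvalue of \<open>S x\<close>, then
  \<open>(S y + s) (S y v - s v) = L y (L y v) - L x (L x v)\<close>, and \<open>S y + s\<close> is bounded below by \<open>s\<close>.  The Sylvester operator of
  \<open>square_root_Ck\<close> is injective by the same argument, as \<open>S y + s\<close> is injective.\<close>

lemma smooth_absolute_value:
  obtains S where "\<And>y. y \<in> U \<Longrightarrow> linear (S y)" "\<And>v. smooth_on U (\<lambda>y. S y v)"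
    "\<And>y l v. y \<in> U \<Longrightarrow> L y v = l *\<^sub>R v \<Longrightarrow> S y v = \<bar>l\<bar> *\<^sub>R v"
proof -
  have "\<forall>y\<in>U. \<exists>S. linear S \<and> (\<forall>v. S (S v) = L y (L y v)) \<and> (\<forall>v. h y (S v) v \<ge> 0) \<and>
      (\<forall>l v. L y v = l *\<^sub>R v \<longrightarrow> S v = \<bar>l\<bar> *\<^sub>R v)"
  proof
    fix y assume y: "y \<in> U"
    show "\<exists>S. linear S \<and> (\<forall>v. S (S v) = L y (L y v)) \<and> (\<forall>v. h y (S v) v \<ge> 0) \<and>
      (\<forall>l v. L y v = l *\<^sub>R v \<longrightarrow> S v = \<bar>l\<bar> *\<^sub>R v)"
      using inner_form.absolute_value[OF inner[OF y] lin[OF y] adj[OF y]] .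
  qed
  from bchoice[OF this] obtain S where S: "\<forall>y\<in>U. linear (S y) \<and> (\<forall>v. S y (S y v) = L y (L y v)) \<and> (\<forall>v. h y (S y v) v \<ge> 0) \<and>
      (\<forall>l v. L y v = l *\<^sub>R v \<longrightarrow> S y v = \<bar>l\<bar> *\<^sub>R v)"
    by blast
  then have linS: "\<And>y. y \<in> U \<Longrightarrow> linear (S y)" and sqS: "\<And>y v. y \<in> U \<Longrightarrow> S y (S y v) = L y (L y v)"
    and posS: "\<And>y v. y \<in> U \<Longrightarrow> h y (S y v) v \<ge> 0"
    and eigS: "\<And>y l v. y \<in> U \<Longrightarrow> L y v = l *\<^sub>R v \<Longrightarrow> S y v = \<bar>l\<bar> *\<^sub>R v" by blast+
  have smooth_LL: "smooth_on U (\<lambda>y. L y (L y v))" for v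
    by (rule smooth_on_linear_family[OF lin smooth_L smooth_L])
  have eigne: "l \<noteq> 0" if "y \<in> U" "L y v = l *\<^sub>R v" "v \<noteq> 0" for y l v
    using that inj[OF that(1)] lin[OF that(1)] by (metis linear_injective_0 scaleR_zero_left)
  have cont_eig: "isCont (\<lambda>y. S y v) x" if x: "x \<in> U" and v: "L x v = l *\<^sub>R v" "v \<noteq> 0" for x v l
  proof -
    define s where "s = \<bar>l\<bar>"
    have s: "s > 0" using eigne[OF x v] by (simp add: s_def)
    have evU: "\<forall>\<^sub>F y in nhds x. y \<in> U" using U x by (simp add: eventually_nhds_in_open)
    have "isCont (\<lambda>y. h y u w) x" for u w
      using smooth_on_continuous_on[OF smooth_h] U x by (simp add: continuous_on_eq_continuous_at)
    moreover have "\<forall>\<^sub>F y in nhds x. inner_form (h y)" using evU by eventually_elim (rule inner)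
    ultimately obtain c where c: "c > 0" "\<forall>\<^sub>F y in nhds x. \<forall>w. c * (norm w * norm w) \<le> h y w w"
      using inner_form_bounded_below_nearby[of h x] by blast
    define r where "r = (\<lambda>y. L y (L y v) - L x (L x v))"
    define f where "f = (\<lambda>y. \<Sum>b\<in>Basis. h y (r y) b *\<^sub>R b)"
    have smooth_r: "smooth_on U r" unfolding r_def by (intro smooth_on_diff smooth_LL smooth_on_const)
    have "smooth_on U (\<lambda>y. h y (r y) b)" for b
      by (rule smooth_on_linear_family[OF inner_form.linear_left[OF inner] smooth_h smooth_r])
    then have "smooth_on U f" unfolding f_def by (intro smooth_on_sum smooth_on_scaleR smooth_on_const)
    then have "isCont f x" using smooth_on_continuous_on U x by (metis continuous_on_eq_continuous_at)
    moreover have "f x = 0" by (simp add: f_def r_def inner_form.zero_left[OF inner[OF x]])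
    ultimately have f0: "(f \<longlongrightarrow> 0) (at x)" by (simp add: isCont_def)
    have bound: "norm (S y v - S x v) \<le> norm (f y) / (s * c)"
      if y: "y \<in> U" and cy: "\<And>w. c * (norm w * norm w) \<le> h y w w" for y
    proof -
      interpret y: inner_form "h y" by (rule inner[OF y])
      define w where "w = S y v - s *\<^sub>R v"
      have Sx: "S x v = s *\<^sub>R v" using eigS[OF x v(1)] by (simp add: s_def)
      have "S y w + s *\<^sub>R w = r y"
      proof -
        have "L x (L x v) = (s * s) *\<^sub>R v" by (simp add: v(1) linear_scale[OF lin[OF x]] s_def)
        then show ?thesis
          by (simp add: w_def r_def linear_diff[OF linS[OF y]] linear_scale[OF linS[OF y]] sqS[OF y] algebra_simps)
      qed
      then have "h y (r y) w = h y (S y w) w + s * h y w w"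
        by (metis y.add_left y.scaleR_left)
      then have "s * h y w w \<le> h y (r y) w" using posS[OF y, of w] by simp
      also have "h y (r y) w = f y \<bullet> w" using y.inner_flat[of "r y" w] by (simp add: f_def y.flat_def)
      also have "\<dots> \<le> norm (f y) * norm w" using norm_cauchy_schwarz .
      finally have "s * h y w w \<le> norm (f y) * norm w" .
      moreover have "s * (c * (norm w * norm w)) \<le> s * h y w w" using cy s by (intro mult_left_mono) auto
      ultimately have "(s * c * norm w) * norm w \<le> norm (f y) * norm w" by (simp add: mult.assoc)
      then have "s * c * norm w \<le> norm (f y)"
        by (cases "w = 0") (auto simp: mult_le_cancel_right)
      then show ?thesis using s c(1) by (simp add: w_def Sx pos_le_divide_eq mult.commute)
    qed
    have "\<forall>\<^sub>F y in nhds x. norm (S y v - S x v) \<le> norm (f y) / (s * c)"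
      using evU c(2) by eventually_elim (rule bound, auto)
    then have "\<forall>\<^sub>F y in at x. norm (S y v - S x v) \<le> norm (f y) / (s * c)"
      by (simp add: eventually_at_filter eventually_mono)
    moreover have "((\<lambda>y. norm (f y) / (s * c)) \<longlongrightarrow> 0) (at x)"
      using tendsto_divide[OF tendsto_norm_zero[OF f0] tendsto_const, of "s * c"] s c(1) by simp
    ultimately have "((\<lambda>y. S y v - S x v) \<longlongrightarrow> 0) (at x)"
      by (rule Lim_null_comparison)
    then show ?thesis by (simp add: isCont_def LIM_zero_iff)
  qed
  have cont: "continuous_on U (\<lambda>y. S y v)" for v
  proof (rule continuous_at_imp_continuous_on, rule ballI)
    fix x assume x: "x \<in> U"
    interpret x: inner_form "h x" by (rule inner[OF x])
    obtain e l where e: "x.orthonormal_basis e" and l: "\<And>i. i < DIM('e) \<Longrightarrow> L x (e i) = l i *\<^sub>R e i"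
      using x.eigenbasis[OF lin[OF x] adj[OF x]] by blast
    have "e i \<noteq> 0" if "i < DIM('e)" for i
      by (rule x.orthonormal_basis_nonzero[OF e that])
    then have "isCont (\<lambda>y. S y (e i)) x" if "i < DIM('e)" for i
      using cont_eig[OF x l[OF that]] that by simp
    then have "isCont (\<lambda>y. \<Sum>i<DIM('e). h x v (e i) *\<^sub>R S y (e i)) x"
      by (intro continuous_sum continuous_scaleR continuous_const) auto
    moreover have "S y v = (\<Sum>i<DIM('e). h x v (e i) *\<^sub>R S y (e i))" if y: "y \<in> U" for y
    proof -
      have "v = (\<Sum>i<DIM('e). h x v (e i) *\<^sub>R e i)"
        using e unfolding x.orthonormal_basis_def by blast
      then have "S y v = S y (\<Sum>i<DIM('e). h x v (e i) *\<^sub>R e i)" by (rule arg_cong)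
      then show ?thesis by (simp only: linear_sum[OF linS[OF y]] linear_scale[OF linS[OF y]])
    qed
    moreover have "\<forall>\<^sub>F y in nhds x. y \<in> U" using U x by (simp add: eventually_nhds_in_open)
    ultimately have "\<forall>\<^sub>F y in nhds x. S y v = (\<Sum>i<DIM('e). h x v (e i) *\<^sub>R S y (e i))"
      by (auto elim: eventually_mono)
    then show "isCont (\<lambda>y. S y v) x"
      using \<open>isCont (\<lambda>y. \<Sum>i<DIM('e). h x v (e i) *\<^sub>R S y (e i)) x\<close>
      by (simp add: isCont_cong[of "\<lambda>y. S y v"])
  qed
  define s where "s = (\<lambda>y. endo_of (S y))"
  have sS: "endo_apply (s y) v = S y v" if "y \<in> U" for y v
    using endo_apply_of[OF linS[OF that]] by (simp add: s_def)
  have smooth: "Ck_on k U s" for k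
  proof (rule square_root_Ck[OF U bounded_bilinear_endo_comp])
    show "endo_comp (s y) (s y) = endo_of (\<lambda>v. L y (L y v))" if y: "y \<in> U" for y
    proof (rule endo_eqI)
      have "linear (\<lambda>v. L y (L y v))" using linear_compose[OF lin[OF y] lin[OF y]] by (simp add: o_def)
      then show "endo_apply (endo_comp (s y) (s y)) v = endo_apply (endo_of (\<lambda>v. L y (L y v))) v" for v
        by (simp add: endo_apply_comp sS[OF y] sqS[OF y] endo_apply_of)
    qed
    show "Ck_on k U (\<lambda>y. endo_of (\<lambda>v. L y (L y v)))" for k
      using smooth_LL unfolding smooth_on_open_iff[OF U] by (intro Ck_on_endo_of[OF U]) blast
    show "continuous_on U s"
      using Ck_on_endo_of[OF U, of 0 S] cont by (simp add: s_def)
    show "inj (\<lambda>X. endo_comp (s y) X + endo_comp X (s y))" if y: "y \<in> U" for y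
    proof -
      interpret y: inner_form "h y" by (rule inner[OF y])
      interpret comp: bounded_bilinear endo_comp by (rule bounded_bilinear_endo_comp)
      obtain e l where e: "y.orthonormal_basis e" and l: "\<And>i. i < DIM('e) \<Longrightarrow> L y (e i) = l i *\<^sub>R e i"
        using y.eigenbasis[OF lin[OF y] adj[OF y]] by blast
      have "linear (\<lambda>X. endo_comp (s y) X + endo_comp X (s y))"
        by (rule linearI) (simp_all add: comp.add_left comp.add_right comp.scaleR_left comp.scaleR_right scaleR_add_right)
      moreover have "X = 0" if X: "endo_comp (s y) X + endo_comp X (s y) = 0" for X
      proof (rule endo_eqI)
        fix v
        have "endo_apply X (e i) = endo_apply 0 (e i)" if i: "i < DIM('e)" for i
        proof -
          let ?w = "endo_apply X (e i)"
          have "e i \<noteq> 0" by (rule y.orthonormal_basis_nonzero[OF e i])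
          then have li: "\<bar>l i\<bar> > 0" using eigne[OF y l[OF i]] by simp
          have "endo_apply (endo_comp (s y) X + endo_comp X (s y)) (e i) = 0"
            using X linear_0[OF linear_endo_apply(2)] by simp
          then have "S y ?w + \<bar>l i\<bar> *\<^sub>R ?w = 0"
            by (simp add: linear_add[OF linear_endo_apply(2)] endo_apply_comp sS[OF y] eigS[OF y l[OF i]]
                linear_scale[OF linear_endo_apply(1)])
          then have "h y (S y ?w) ?w + \<bar>l i\<bar> * h y ?w ?w = 0"
            by (metis y.add_left y.scaleR_left y.zero_left)
          moreover have "\<bar>l i\<bar> * h y ?w ?w \<ge> 0" using y.nonneg by simp
          ultimately have "\<bar>l i\<bar> * h y ?w ?w = 0" using posS[OF y, of ?w] by linarith
          then have "?w = 0" using li y.self_eq_0_iff by simp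
          then show ?thesis using linear_0[OF linear_endo_apply(2)] by simp
        qed
        then show "endo_apply X v = endo_apply 0 v"
          by (rule y.linear_eqI_orthonormal_basis[OF e linear_endo_apply(1) linear_endo_apply(1)])
      qed
      ultimately show ?thesis using linear_injective_0 by blast
    qed
  qed
  have "smooth_on U (\<lambda>y. S y v)" for v
  proof (rule smooth_on_cong)
    have sm: "smooth_on U s" unfolding smooth_on_open_iff[OF U] by (rule allI, rule smooth)
    have "bounded_linear (\<lambda>Z :: 'e endo. endo_apply Z v)"
      using linear_endo_apply(2) by (simp add: linear_conv_bounded_linear)
    from smooth_on_bounded_linear[OF this sm] show "smooth_on U (\<lambda>y. endo_apply (s y) v)" .
  qed (rule sS)
  then show thesis using that[of S] linS eigS by blast
qed


lemma eigenbasis_at: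
  assumes y: "y \<in> U"
  obtains e l where "inner_form.orthonormal_basis (h y) e" "\<And>i. i < DIM('e) \<Longrightarrow> L y (e i) = l i *\<^sub>R e i"
    "\<And>i. i < DIM('e) \<Longrightarrow> l i \<noteq> 0"
proof -
  interpret y: inner_form "h y" by (rule inner[OF y])
  obtain e l where e: "y.orthonormal_basis e" and l: "\<And>i. i < DIM('e) \<Longrightarrow> L y (e i) = l i *\<^sub>R e i"
    using y.eigenbasis[OF lin[OF y] adj[OF y]] by blast
  have "l i \<noteq> 0" if i: "i < DIM('e)" for i
  proof
    assume "l i = 0"
    then have "L y (e i) = 0" using l[OF i] by simp
    moreover have "L y 0 = 0" using linear_0[OF lin[OF y]] .
    ultimately have "e i = 0" using inj[OF y] by (metis injD)
    then show False using y.orthonormal_basis_nonzero[OF e i] by simp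
  qed
  from that[OF e l this] show thesis .
qed

lemma subspace_eigen_span: "subspace (eigen_span (L y) \<sigma>)"
  by (simp add: eigen_span_def)

lemma eigen_spanI: "L y v = (\<sigma> * l) *\<^sub>R v \<Longrightarrow> l > 0 \<Longrightarrow> v \<in> eigen_span (L y) \<sigma>"
  unfolding eigen_span_def by (rule span_base) blast

text \<open>So \<open>eigen_span (L y) \<sigma>\<close> is the range of the smooth family \<open>S y + \<sigma> L y\<close>.\<close>

lemma eigen_span_absolute_value:
  assumes y: "y \<in> U" and S: "linear S" "\<And>l v. L y v = l *\<^sub>R v \<Longrightarrow> S v = \<bar>l\<bar> *\<^sub>R v" and \<sigma>: "\<sigma> = 1 \<or> \<sigma> = -1"
  shows "v \<in> eigen_span (L y) \<sigma> \<Longrightarrow> S v = \<sigma> *\<^sub>R L y v" and "S v + \<sigma> *\<^sub>R L y v \<in> eigen_span (L y) \<sigma>"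
proof -
  have lin\<sigma>: "linear (\<lambda>v. \<sigma> *\<^sub>R L y v)" using lin[OF y] by (rule linear_compose_scale_right)
  show "S v = \<sigma> *\<^sub>R L y v" if v: "v \<in> eigen_span (L y) \<sigma>"
  proof (rule linear_eq_on_span[OF S(1) lin\<sigma>])
    show "v \<in> span {v. \<exists>l>0. L y v = (\<sigma> * l) *\<^sub>R v}" using v by (simp add: eigen_span_def)
    fix w assume "w \<in> {v. \<exists>l>0. L y v = (\<sigma> * l) *\<^sub>R v}"
    then obtain l where l: "l > 0" "L y w = (\<sigma> * l) *\<^sub>R w" by blast
    show "S w = \<sigma> *\<^sub>R L y w" using S(2)[OF l(2)] l(2) \<sigma> l(1) by (auto simp: abs_mult)
  qed
  interpret y: inner_form "h y" by (rule inner[OF y])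
  obtain e l where e: "y.orthonormal_basis e" and l: "\<And>i. i < DIM('e) \<Longrightarrow> L y (e i) = l i *\<^sub>R e i"
    using eigenbasis_at[OF y] by metis
  have linT: "linear (\<lambda>v. S v + \<sigma> *\<^sub>R L y v)" using S(1) lin\<sigma> by (rule linear_compose_add)
  have "S (e i) + \<sigma> *\<^sub>R L y (e i) \<in> eigen_span (L y) \<sigma>" if i: "i < DIM('e)" for i
  proof -
    have eq: "S (e i) + \<sigma> *\<^sub>R L y (e i) = (\<bar>l i\<bar> + \<sigma> * l i) *\<^sub>R e i"
      by (simp add: l[OF i] S(2)[OF l[OF i]] scaleR_add_left)
    show ?thesis
    proof (cases "\<bar>l i\<bar> + \<sigma> * l i = 0")
      case True
      then show ?thesis unfolding eq by (simp add: subspace_0[OF subspace_eigen_span])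
    next
      case False
      then have "\<sigma> * l i > 0" using \<sigma> by auto
      moreover have "L y (e i) = (\<sigma> * (\<sigma> * l i)) *\<^sub>R e i" using l[OF i] \<sigma> by auto
      ultimately have "e i \<in> eigen_span (L y) \<sigma>" by (intro eigen_spanI)
      then show ?thesis unfolding eq by (rule subspace_scale[OF subspace_eigen_span])
    qed
  qed
  then have "(\<Sum>i<DIM('e). h y v (e i) *\<^sub>R (S (e i) + \<sigma> *\<^sub>R L y (e i))) \<in> eigen_span (L y) \<sigma>"
    by (intro subspace_sum[OF subspace_eigen_span] subspace_scale[OF subspace_eigen_span]) auto
  also have "(\<Sum>i<DIM('e). h y v (e i) *\<^sub>R (S (e i) + \<sigma> *\<^sub>R L y (e i))) =
      (\<lambda>v. S v + \<sigma> *\<^sub>R L y v) (\<Sum>i<DIM('e). h y v (e i) *\<^sub>R e i)"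
    by (simp only: linear_sum[OF linT] linear_scale[OF linT])
  also have "(\<Sum>i<DIM('e). h y v (e i) *\<^sub>R e i) = v" using y.orthonormal_basisD(2)[OF e] by metis
  finally show "S v + \<sigma> *\<^sub>R L y v \<in> eigen_span (L y) \<sigma>" .
qed

lemma eigen_span_Int:
  assumes y: "y \<in> U"
  shows "eigen_span (L y) 1 \<inter> eigen_span (L y) (-1) = {0}"
proof -
  obtain S where S: "\<And>y. y \<in> U \<Longrightarrow> linear (S y)" "\<And>y l v. y \<in> U \<Longrightarrow> L y v = l *\<^sub>R v \<Longrightarrow> S y v = \<bar>l\<bar> *\<^sub>R v"
    using smooth_absolute_value by metis
  have "v = 0" if "v \<in> eigen_span (L y) 1" "v \<in> eigen_span (L y) (-1)" for v
  proof -
    have "S y v = L y v" "S y v = - L y v"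
      using eigen_span_absolute_value(1)[OF y S(1)[OF y] S(2)[OF y]] that by force+
    then have "L y v + L y v = 0" by (metis add.right_inverse)
    then have "2 *\<^sub>R L y v = 0" by (simp only: scaleR_2)
    then have "L y v = L y 0" by (simp add: linear_0[OF lin[OF y]])
    then show ?thesis using inj[OF y] by (metis injD)
  qed
  then show ?thesis using subspace_0[OF subspace_eigen_span] by blast
qed

lemma eigen_span_sum:
  assumes y: "y \<in> U"
  obtains u w where "u \<in> eigen_span (L y) 1" "w \<in> eigen_span (L y) (-1)" "v = u + w"
proof -
  obtain S where S: "\<And>y. y \<in> U \<Longrightarrow> linear (S y)" "\<And>y l v. y \<in> U \<Longrightarrow> L y v = l *\<^sub>R v \<Longrightarrow> S y v = \<bar>l\<bar> *\<^sub>R v"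
    using smooth_absolute_value by metis
  obtain v' where v': "L y v' = v"
    using linear_injective_imp_surjective[OF lin[OF y] inj[OF y]] by (metis surjD)
  let ?u = "(1/2) *\<^sub>R (S y v' + 1 *\<^sub>R L y v')" and ?w = "(-1/2) *\<^sub>R (S y v' + (-1) *\<^sub>R L y v')"
  have "?u \<in> eigen_span (L y) 1"
    by (rule subspace_scale[OF subspace_eigen_span eigen_span_absolute_value(2)[OF y S(1)[OF y] S(2)[OF y]]]) simp_all
  moreover have "?w \<in> eigen_span (L y) (-1)"
    by (rule subspace_scale[OF subspace_eigen_span eigen_span_absolute_value(2)[OF y S(1)[OF y] S(2)[OF y]]]) simp_all
  moreover have "v = ?u + ?w"
  proof -
    have "v = (1/2) *\<^sub>R v + (1/2) *\<^sub>R v" by (metis scaleR_add_right scaleR_half_double)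
    then show ?thesis by (simp add: v' algebra_simps)
  qed
  ultimately show thesis by (rule that)
qed

text \<open>Apply \<open>S y \<plusminus> L y\<close> to the eigenvectors at \<open>x\<close>, with the sign of the eigenvalue at \<open>x\<close>.  At \<open>x\<close> this gives multiples of
  the eigenvectors, so nearby it still gives a basis.  Each of its members lies in one of the two
  complementary spaces, hence those in \<open>eigen_span (L y) \<sigma>\<close> span it.\<close>

lemma eigen_span_frame:
  assumes x: "x \<in> U" and \<sigma>: "\<sigma> = 1 \<or> \<sigma> = -1"
  obtains W and r :: nat and Y where "open W" "x \<in> W" "W \<subseteq> U" "\<And>i. smooth_on W (Y i)"
    "\<And>y. y \<in> W \<Longrightarrow> inj_on (\<lambda>i. Y i y) {..<r}" "\<And>y. y \<in> W \<Longrightarrow> independent ((\<lambda>i. Y i y) ` {..<r})"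
    "\<And>y. y \<in> W \<Longrightarrow> eigen_span (L y) \<sigma> = span ((\<lambda>i. Y i y) ` {..<r})"
proof -
  obtain S where S: "\<And>y. y \<in> U \<Longrightarrow> linear (S y)" "\<And>v. smooth_on U (\<lambda>y. S y v)"
      "\<And>y l v. y \<in> U \<Longrightarrow> L y v = l *\<^sub>R v \<Longrightarrow> S y v = \<bar>l\<bar> *\<^sub>R v"
    using smooth_absolute_value by metis
  interpret x: inner_form "h x" by (rule inner[OF x])
  obtain e l where e: "x.orthonormal_basis e" and l: "\<And>i. i < DIM('e) \<Longrightarrow> L x (e i) = l i *\<^sub>R e i"
      and l0: "\<And>i. i < DIM('e) \<Longrightarrow> l i \<noteq> 0"
    using eigenbasis_at[OF x] by metis
  \<comment> \<open>\<open>\<tau> i\<close> is the sign of \<open>l i\<close>; \<open>M y\<close> maps the eigenbasis at \<open>x\<close> to the frame \<open>Z\<close> at \<open>y\<close>\<close>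
  define \<tau> where "\<tau> = (\<lambda>i. if \<sigma> * l i > 0 then \<sigma> else - \<sigma>)"
  have \<tau>: "\<tau> i = 1 \<or> \<tau> i = -1" for i using \<sigma> by (auto simp: \<tau>_def)
  define Z where "Z = (\<lambda>i y. S y (e i) + \<tau> i *\<^sub>R L y (e i))"
  define M where "M = (\<lambda>y v. \<Sum>i<DIM('e). h x v (e i) *\<^sub>R Z i y)"
  have smZ: "smooth_on U (Z i)" for i
    unfolding Z_def by (intro smooth_on_add smooth_on_scaleR smooth_on_const S(2) smooth_L)
  have linM: "linear (M y)" for y
    by (rule linearI) (simp_all add: M_def x.add_left x.scaleR_left scaleR_add_left sum.distrib scaleR_sum_right)
  have Me: "M y (e i) = Z i y" if "i < DIM('e)" for i y
    unfolding M_def by (rule x.orthonormal_basis_sum_scaleR[OF e that])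
  \<comment> \<open>at \<open>x\<close> itself the frame consists of multiples of the eigenvectors\<close>
  have Zx: "Z i x = (2 * \<bar>l i\<bar>) *\<^sub>R e i" if i: "i < DIM('e)" for i
  proof -
    have "\<tau> i * l i = \<bar>l i\<bar>" using \<sigma> l0[OF i] by (auto simp: \<tau>_def)
    then show ?thesis by (simp add: Z_def l[OF i] S(3)[OF x l[OF i]] flip: scaleR_add_left)
  qed
  have injx: "inj (M x)"
    unfolding linear_injective_0[OF linM]
  proof (intro allI impI)
    fix v assume v: "M x v = 0"
    have "h x v (e j) = 0" if j: "j < DIM('e)" for j
    proof -
      have "M x v = (\<Sum>i<DIM('e). (h x v (e i) * (2 * \<bar>l i\<bar>)) *\<^sub>R e i)"
        unfolding M_def by (intro sum.cong refl) (simp add: Zx)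
      then have "h x (M x v) (e j) = (\<Sum>i<DIM('e). (h x v (e i) * (2 * \<bar>l i\<bar>)) * h x (e i) (e j))"
        by (simp only: x.sum_left x.scaleR_left)
      also have "\<dots> = (\<Sum>i<DIM('e). (h x v (e i) * (2 * \<bar>l i\<bar>)) * h x (e j) (e i))"
        by (intro sum.cong refl) (metis x.sym)
      also have "\<dots> = h x v (e j) * (2 * \<bar>l j\<bar>)" by (rule x.orthonormal_basis_sum[OF e j])
      finally show ?thesis using v l0[OF j] by simp
    qed
    then have "(\<Sum>i<DIM('e). h x v (e i) *\<^sub>R e i) = 0" by simp
    then show "v = 0" using x.orthonormal_basisD(2)[OF e, of v] by metis
  qed
  have "isCont (\<lambda>y. Z i y) x" for i
    using smooth_on_continuous_on[OF smZ] U x by (simp add: continuous_on_eq_continuous_at)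
  then have "isCont (\<lambda>y. M y b) x" for b
    unfolding M_def by (intro continuous_sum continuous_scaleR continuous_const)
  then obtain c where c: "c > 0" "\<forall>\<^sub>F y in nhds x. \<forall>z. c * norm z \<le> norm (M y z)"
    using linear_family_bounded_below_nearby[of M x, OF always_eventually[OF allI[OF linM]] linM injx] by metis
  then obtain N where N: "open N" "x \<in> N" "\<And>y z. y \<in> N \<Longrightarrow> c * norm z \<le> norm (M y z)"
    unfolding eventually_nhds by blast
  have injM: "inj (M y)" if "y \<in> N" for y
    unfolding linear_injective_0[OF linM]
    using N(3)[OF that] c(1) by (metis mult_le_0_iff norm_eq_zero norm_le_zero_iff not_less)
  define I where "I = {i. i < DIM('e) \<and> \<sigma> * l i > 0}"
  have finI: "finite I" by (simp add: I_def)
  obtain \<phi> where \<phi>: "bij_betw \<phi> {0..<card I} I" using ex_bij_betw_nat_finite[OF finI] by blast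
  have \<phi>': "bij_betw \<phi> {..<card I} I" using \<phi> by (simp add: atLeast0LessThan)
  have \<phi>I: "\<phi> ` {..<card I} = I" "inj_on \<phi> {..<card I}" using \<phi>' by (auto simp: bij_betw_def)
  have inje: "inj_on e {..<DIM('e)}"
  proof (rule inj_onI)
    fix i j assume ij: "i \<in> {..<DIM('e)}" "j \<in> {..<DIM('e)}" "e i = e j"
    then have "h x (e i) (e j) = 1" using x.orthonormal_basisD(1)[OF e, of j j] by simp
    then show "i = j" using x.orthonormal_basisD(1)[OF e, of i j] ij by (auto split: if_splits)
  qed
  have inde: "independent (e ` {..<DIM('e)})"
  proof (rule card_le_dim_spanning[of _ UNIV])
    have "v \<in> span (e ` {..<DIM('e)})" for v
    proof -
      have "(\<Sum>i<DIM('e). h x v (e i) *\<^sub>R e i) \<in> span (e ` {..<DIM('e)})"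
        by (intro span_sum span_scale span_base) auto
      then show ?thesis using x.orthonormal_basisD(2)[OF e, of v] by metis
    qed
    then show "UNIV \<subseteq> span (e ` {..<DIM('e)})" by blast
    show "card (e ` {..<DIM('e)}) \<le> dim (UNIV :: 'e set)"
      using card_image_le[of "{..<DIM('e)}" e] by simp
  qed auto
  show thesis
  proof (rule that[of "N \<inter> U" "\<lambda>i. Z (\<phi> i)" "card I"])
    show "open (N \<inter> U)" using N(1) U by (rule open_Int)
    show "x \<in> N \<inter> U" "N \<inter> U \<subseteq> U" using N(2) x by auto
    show "smooth_on (N \<inter> U) (Z (\<phi> i))" for i by (rule smooth_on_subset[OF smZ]) simp
    fix y assume y: "y \<in> N \<inter> U"
    then have yN: "y \<in> N" and yU: "y \<in> U" by auto
    have img0: "(\<lambda>i. Z (\<phi> i) y) ` {..<card I} = (\<lambda>i. Z i y) ` I"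
    proof -
      have "(\<lambda>i. Z (\<phi> i) y) ` {..<card I} = (\<lambda>i. Z i y) ` (\<phi> ` {..<card I})" by (simp only: image_image)
      then show ?thesis by (simp only: \<phi>I(1))
    qed
    have img: "(\<lambda>i. Z (\<phi> i) y) ` {..<card I} = M y ` (e ` I)"
    proof -
      have "M y ` (e ` I) = (\<lambda>i. Z i y) ` I"
        unfolding image_image by (intro image_cong refl) (simp add: Me I_def)
      then show ?thesis unfolding img0 by simp
    qed
    have injZ: "inj_on (\<lambda>i. Z i y) I"
    proof (rule inj_onI)
      fix i j assume ij: "i \<in> I" "j \<in> I" "Z i y = Z j y"
      then have "M y (e i) = M y (e j)" by (simp add: Me I_def)
      then have "e i = e j" using injM[OF yN] by (simp add: injD)
      then show "i = j" using inje ij by (auto simp: I_def inj_on_def)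
    qed
    show "inj_on (\<lambda>i. Z (\<phi> i) y) {..<card I}"
      using comp_inj_on[OF \<phi>I(2), of "\<lambda>i. Z i y"] injZ \<phi>I(1) by (simp add: o_def)
    have "independent (e ` I)" by (rule independent_mono[OF inde]) (auto simp: I_def)
    then show "independent ((\<lambda>i. Z (\<phi> i) y) ` {..<card I})"
      unfolding img using injM[OF yN] linM by (intro linear_independent_injective_image) (auto intro: inj_on_subset)
    have Zin: "Z i y \<in> eigen_span (L y) (\<tau> i)" for i
      unfolding Z_def by (rule eigen_span_absolute_value(2)[OF yU S(1)[OF yU] S(3)[OF yU] \<tau>])
    show "eigen_span (L y) \<sigma> = span ((\<lambda>i. Z (\<phi> i) y) ` {..<card I})"
    proof
      have "Z i y \<in> eigen_span (L y) \<sigma>" if "i \<in> I" for i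
        using Zin[of i] that by (simp add: \<tau>_def I_def)
      then show "span ((\<lambda>i. Z (\<phi> i) y) ` {..<card I}) \<subseteq> eigen_span (L y) \<sigma>"
        unfolding img0 by (intro span_minimal subspace_eigen_span) auto
      show "eigen_span (L y) \<sigma> \<subseteq> span ((\<lambda>i. Z (\<phi> i) y) ` {..<card I})"
      proof
        fix v assume v: "v \<in> eigen_span (L y) \<sigma>"
        obtain a where a: "M y a = v"
          using linear_injective_imp_surjective[OF linM injM[OF yN]] by (metis surjD)
        let ?f = "\<lambda>i. h x a (e i) *\<^sub>R Z i y"
        have split: "{..<DIM('e)} = I \<union> ({..<DIM('e)} - I)" by (auto simp: I_def)
        define p where "p = sum ?f I"
        define q where "q = sum ?f ({..<DIM('e)} - I)"
        have "v = p + q"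
          unfolding a[symmetric] M_def p_def q_def by (subst split, rule sum.union_disjoint) (auto simp: finI)
        have p: "p \<in> eigen_span (L y) \<sigma>"
          unfolding p_def using \<open>\<And>i. i \<in> I \<Longrightarrow> Z i y \<in> eigen_span (L y) \<sigma>\<close>
          by (intro subspace_sum[OF subspace_eigen_span] subspace_scale[OF subspace_eigen_span])
        have "Z i y \<in> eigen_span (L y) (- \<sigma>)" if "i \<in> {..<DIM('e)} - I" for i
          using Zin[of i] that by (auto simp: \<tau>_def I_def)
        then have q: "q \<in> eigen_span (L y) (- \<sigma>)"
          unfolding q_def by (intro subspace_sum[OF subspace_eigen_span] subspace_scale[OF subspace_eigen_span])
        have "q = v - p" using \<open>v = p + q\<close> by simp
        then have "q \<in> eigen_span (L y) \<sigma>" using subspace_diff[OF subspace_eigen_span v p] by simp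
        then have "q \<in> eigen_span (L y) 1 \<inter> eigen_span (L y) (-1)" using q \<sigma> by auto
        then have "v = p" using eigen_span_Int[OF yU] \<open>v = p + q\<close> by simp
        also have "p \<in> span ((\<lambda>i. Z i y) ` I)"
          unfolding p_def by (intro span_sum span_scale span_base) auto
        finally show "v \<in> span ((\<lambda>i. Z (\<phi> i) y) ` {..<card I})"
          unfolding img0 .
      qed
    qed
  qed
qed

end

section \<open>Atlases with unique derivatives\<close>

text \<open>What the atlas of an open subset of a manifold with boundary and the atlas of the boundary have in common.\<close>

locale thick_atlas =
  fixes A :: "('p, 'e::euclidean_space) chart set"
  assumes inj_chart: "c \<in> A \<Longrightarrow> inj_on (snd c) (fst c)"
    and thick_image: "c \<in> A \<Longrightarrow> thick (chart_image c)"
    and overlap_open: "c \<in> A \<Longrightarrow> d \<in> A \<Longrightarrow> \<exists>W. open W \<and> snd c ` (fst c \<inter> fst d) = chart_image c \<inter> W"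
    and smooth_transition: "c \<in> A \<Longrightarrow> d \<in> A \<Longrightarrow> smooth_on (snd c ` (fst c \<inter> fst d)) (transition c d)"
begin

lemma chart_inv_chart [simp]: "c \<in> A \<Longrightarrow> p \<in> fst c \<Longrightarrow> chart_inv c (snd c p) = p"
  unfolding chart_inv_def using inj_chart by (rule inv_into_f_f)

lemma transition_chart [simp]: "c \<in> A \<Longrightarrow> p \<in> fst c \<Longrightarrow> transition c d (snd c p) = snd d p"
  by (simp add: transition_def)

lemma chart_in_image: "p \<in> fst c \<Longrightarrow> snd c p \<in> chart_image c"
  by (simp add: chart_image_def)

lemma chart_image_cases:
  assumes "c \<in> A" "x \<in> chart_image c"
  obtains p where "p \<in> fst c" "x = snd c p" "chart_inv c x = p"
  using assms by (auto simp: chart_image_def)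

lemma transition_image: "c \<in> A \<Longrightarrow> transition c d ` (snd c ` (fst c \<inter> fst d)) = snd d ` (fst c \<inter> fst d)"
  by (auto simp: image_iff)

lemma thick_overlap: "c \<in> A \<Longrightarrow> d \<in> A \<Longrightarrow> thick (snd c ` (fst c \<inter> fst d))"
  using overlap_open[of c d] thick_Int_open[OF thick_image] by metis

lemma transition_has_derivative:
  assumes "c \<in> A" "d \<in> A" "p \<in> fst c" "p \<in> fst d"
  shows "(transition c d has_derivative transition_deriv c d p) (at (snd c p) within (snd c ` (fst c \<inter> fst d)))"
  unfolding transition_deriv_def
  by (rule smooth_on_has_derivative[OF smooth_transition]) (use assms in auto)

lemma linear_transition_deriv:
  "c \<in> A \<Longrightarrow> d \<in> A \<Longrightarrow> p \<in> fst c \<Longrightarrow> p \<in> fst d \<Longrightarrow> linear (transition_deriv c d p)"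
  using transition_has_derivative has_derivative_linear by blast

text \<open>The cocycle condition.  The chain rule is applied on the triple overlap, which is relatively open and hence
  determines the derivatives.\<close>

lemma transition_deriv_comp:
  assumes c: "c \<in> A" and d: "d \<in> A" and e: "e \<in> A" and p: "p \<in> fst c" "p \<in> fst d" "p \<in> fst e"
  shows "transition_deriv d e p (transition_deriv c d p u) = transition_deriv c e p u"
proof -
  let ?T = "snd c ` (fst c \<inter> fst d) \<inter> snd c ` (fst c \<inter> fst e)"
  obtain W where W: "open W" "snd c ` (fst c \<inter> fst e) = chart_image c \<inter> W"
    using overlap_open[OF c e] by blast
  have T: "?T = snd c ` (fst c \<inter> fst d) \<inter> W"
    unfolding W(2) by (auto simp: chart_image_def)
  have thT: "thick ?T" unfolding T by (rule thick_Int_open[OF thick_overlap[OF c d] W(1)])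
  have xT: "snd c p \<in> ?T" using p by blast
  have T_eq: "?T = snd c ` (fst c \<inter> fst d \<inter> fst e)"
    using inj_on_image_Int[OF inj_chart[OF c], of "fst c \<inter> fst d" "fst c \<inter> fst e"] by (simp add: Int_ac)
  have img: "transition c d ` ?T \<subseteq> snd d ` (fst d \<inter> fst e)"
    unfolding T_eq by (auto simp: c)
  have "(transition c d has_derivative transition_deriv c d p) (at (snd c p) within ?T)"
    by (rule has_derivative_subset[OF transition_has_derivative[OF c d p(1,2)]]) blast
  moreover have "(transition d e has_derivative transition_deriv d e p) (at (transition c d (snd c p)) within transition c d ` ?T)"
    using has_derivative_subset[OF transition_has_derivative[OF d e p(2,3)] img] c p by simp
  ultimately have "((\<lambda>x. transition d e (transition c d x)) has_derivative
      (\<lambda>u. transition_deriv d e p (transition_deriv c d p u))) (at (snd c p) within ?T)"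
    by (rule has_derivative_in_compose)
  moreover have "transition d e (transition c d x) = transition c e x" if "x \<in> ?T" for x
    using that unfolding T_eq by (auto simp: c d)
  ultimately have "(transition c e has_derivative (\<lambda>u. transition_deriv d e p (transition_deriv c d p u))) (at (snd c p) within ?T)"
    using xT by (intro has_derivative_transform[where g = "transition c e" and f = "\<lambda>x. transition d e (transition c d x)"]) auto
  moreover have "(transition c e has_derivative transition_deriv c e p) (at (snd c p) within ?T)"
    by (rule has_derivative_subset[OF transition_has_derivative[OF c e p(1,3)]]) blast
  ultimately show ?thesis
    using thick_fderiv_eq[OF thT xT] by metis
qed

lemma transition_deriv_refl:
  assumes c: "c \<in> A" and p: "p \<in> fst c"
  shows "transition_deriv c c p u = u"
proof -
  have im: "snd c ` (fst c \<inter> fst c) = chart_image c" by (simp add: chart_image_def)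
  have "(transition c c has_derivative (\<lambda>u. u)) (at (snd c p) within chart_image c)"
    using p by (intro has_derivative_transform[where f = "\<lambda>x. x" and g = "transition c c"] has_derivative_ident chart_in_image)
      (auto simp: c chart_image_def)
  from thick_fderiv_eq[OF thick_image[OF c] chart_in_image[OF p] this]
  show ?thesis unfolding transition_deriv_def im by simp
qed

lemma transition_deriv_inverse:
  "c \<in> A \<Longrightarrow> d \<in> A \<Longrightarrow> p \<in> fst c \<Longrightarrow> p \<in> fst d \<Longrightarrow> transition_deriv d c p (transition_deriv c d p u) = u"
  by (simp add: transition_deriv_comp transition_deriv_refl)

lemma bij_transition_deriv:
  assumes "c \<in> A" "d \<in> A" "p \<in> fst c" "p \<in> fst d"
  shows "bij (transition_deriv c d p)"
  by (rule bijI') (metis transition_deriv_inverse assms)+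

subsection \<open>Tangent vectors\<close>

lemma tvec_of_in:
  assumes "c \<in> A" "p \<in> fst c"
  shows "tvec_of A c p u \<in> tangent_space A p"
  unfolding tangent_space_def tvec_of_def using assms by (auto simp: transition_deriv_comp)

lemma tvec_of_chart: "c \<in> A \<Longrightarrow> p \<in> fst c \<Longrightarrow> tvec_of A c p u c = u"
  by (simp add: tvec_of_def transition_deriv_refl)

lemma tvec_of_component:
  assumes c: "c \<in> A" "p \<in> fst c" and v: "v \<in> tangent_space A p"
  shows "tvec_of A c p (v c) = v"
proof
  fix d
  have 1: "\<forall>c\<in>A. \<forall>d\<in>A. p \<in> fst c \<longrightarrow> p \<in> fst d \<longrightarrow> v d = transition_deriv c d p (v c)"
    using v unfolding tangent_space_def mem_Collect_eq by (rule conjunct1)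
  have 2: "\<forall>c. \<not> (c \<in> A \<and> p \<in> fst c) \<longrightarrow> v c = 0"
    using v unfolding tangent_space_def mem_Collect_eq by (rule conjunct2)
  show "tvec_of A c p (v c) d = v d"
  proof (cases "d \<in> A \<and> p \<in> fst d")
    case True
    then have "v d = transition_deriv c d p (v c)" using 1 c by blast
    then show ?thesis using True by (simp only: tvec_of_def if_True simp_thms)
  next
    case False
    then have "v d = 0" using 2 by blast
    then show ?thesis using False by (simp only: tvec_of_def if_False)
  qed
qed

lemma tangent_component:
  assumes z: "z \<in> tangent_space A p" and c: "c \<in> A" "d \<in> A" and p: "p \<in> fst c" "p \<in> fst d"
  shows "transition_deriv c d p (z c) = z d"
  using fun_cong[OF tvec_of_component[OF c(1) p(1) z], of d] c p by (simp add: tvec_of_def)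

lemma tvec_of_change:
  "c \<in> A \<Longrightarrow> d \<in> A \<Longrightarrow> p \<in> fst c \<Longrightarrow> p \<in> fst d \<Longrightarrow> tvec_of A d p (transition_deriv c d p u) = tvec_of A c p u"
  by (auto simp: tvec_of_def fun_eq_iff transition_deriv_comp)

lemma linear_tvec_of:
  assumes "c \<in> A" "p \<in> fst c"
  shows "linear (tvec_of A c p)"
proof -
  have lin: "linear (transition_deriv c d p)" if "d \<in> A" "p \<in> fst d" for d
    using linear_transition_deriv assms that by blast
  show ?thesis
    by (rule linearI) (auto simp: tvec_of_def fun_eq_iff scaleR_fun_def linear_add[OF lin] linear_scale[OF lin])
qed

lemma inj_tvec_of: "c \<in> A \<Longrightarrow> p \<in> fst c \<Longrightarrow> inj (tvec_of A c p)"
  by (rule injI) (metis tvec_of_chart)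

lemma tangent_space_eq_range:
  assumes "c \<in> A" "p \<in> fst c"
  shows "tangent_space A p = range (tvec_of A c p)"
proof
  show "tangent_space A p \<subseteq> range (tvec_of A c p)"
  proof
    fix v assume "v \<in> tangent_space A p"
    from tvec_of_component[OF assms this] show "v \<in> range (tvec_of A c p)" by (metis rangeI)
  qed
qed (use tvec_of_in[OF assms] in auto)

lemma some_chart:
  assumes "c \<in> A" "p \<in> fst c"
  shows "some_chart A p \<in> A" "p \<in> fst (some_chart A p)"
proof -
  have "some_chart A p \<in> A \<and> p \<in> fst (some_chart A p)"
    unfolding some_chart_def by (rule someI[of "\<lambda>c. c \<in> A \<and> p \<in> fst c" c]) (use assms in simp)
  then show "some_chart A p \<in> A" "p \<in> fst (some_chart A p)" by auto
qed

end

subsection \<open>Metrics\<close>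

text \<open>Levi-Civita connection and curvature are local.\<close>

lemma (in metric_field) local_restriction:
  assumes W: "open W"
  shows "metric_field (S \<inter> W) h"
    and "x \<in> S \<inter> W \<Longrightarrow> christoffel (S \<inter> W) h x = \<Gamma> x"
    and "x \<in> S \<inter> W \<Longrightarrow> curvature_coord (S \<inter> W) h x = R x"
proof -
  show "metric_field (S \<inter> W) h"
    by (rule metric_field.intro) (auto intro: thick_Int_open[OF thick W] smooth_on_subset[OF smooth] dest: inner_form)
  have fd: "fderiv (S \<inter> W) f x = fderiv S f x" if "x \<in> S \<inter> W" for x and f :: "'e \<Rightarrow> 'z::real_normed_vector"
    using at_within_Int_open[OF W, of x S] that by simp
  have chr: "christoffel (S \<inter> W) h x = \<Gamma> x" if "x \<in> S \<inter> W" for x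
    using at_within_Int_open[OF W, of x S] that by (intro ext) (simp add: christoffel_def)
  then show "x \<in> S \<inter> W \<Longrightarrow> christoffel (S \<inter> W) h x = \<Gamma> x" .
  show "curvature_coord (S \<inter> W) h x = R x" if x: "x \<in> S \<inter> W"
  proof -
    have "fderiv (S \<inter> W) (\<lambda>y. christoffel (S \<inter> W) h y v w) x = fderiv (S \<inter> W) (\<lambda>y. \<Gamma> y v w) x" for v w
      by (rule fderiv_cong[OF x]) (simp add: chr)
    then have "fderiv (S \<inter> W) (\<lambda>y. christoffel (S \<inter> W) h y v w) x = fderiv S (\<lambda>y. \<Gamma> y v w) x" for v w
      using fd[OF x] by metis
    then show ?thesis by (simp add: curvature_coord_def fun_eq_iff chr[OF x])
  qed
qed

locale riemannian_atlas = thick_atlas A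
  for A :: "('p, 'e::euclidean_space) chart set" +
  fixes g :: "('p, 'e) metric"
  assumes metric: "riemannian_metric A g"
begin

lemma in_domain: "c \<in> A \<Longrightarrow> p \<in> fst c \<Longrightarrow> p \<in> \<Union> (fst ` A)"
  by blast

lemma metric_coord_chart:
  "c \<in> A \<Longrightarrow> p \<in> fst c \<Longrightarrow> metric_coord A g c (snd c p) u v = g p (tvec_of A c p u) (tvec_of A c p v)"
  by (simp add: metric_coord_def)

lemma metric_via_coord:
  "c \<in> A \<Longrightarrow> p \<in> fst c \<Longrightarrow> u \<in> tangent_space A p \<Longrightarrow> v \<in> tangent_space A p \<Longrightarrow>
    g p u v = metric_coord A g c (snd c p) (u c) (v c)"
  by (simp add: metric_coord_chart tvec_of_component)

lemma metric_field_coord: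
  assumes c: "c \<in> A"
  shows "metric_field (chart_image c) (metric_coord A g c)"
proof (rule metric_field.intro)
  show "thick (chart_image c)" by (rule thick_image[OF c])
  show "smooth_on (chart_image c) (\<lambda>x. metric_coord A g c x u v)" for u v
    using metric c by (simp add: riemannian_metric_def)
  fix x assume "x \<in> chart_image c"
  then obtain p where p: "p \<in> fst c" "x = snd c p" using chart_image_cases[OF c] by metis
  note T = tvec_of_in[OF c p(1)] and lin = linear_tvec_of[OF c p(1)]
  note M = bspec[OF conjunct1[OF metric[unfolded riemannian_metric_def]] in_domain[OF c p(1)]]
  have m1: "\<And>u v. u \<in> tangent_space A p \<Longrightarrow> v \<in> tangent_space A p \<Longrightarrow> g p u v = g p v u"
    using conjunct1[OF M] by blast
  have m2: "\<And>u v w. u \<in> tangent_space A p \<Longrightarrow> v \<in> tangent_space A p \<Longrightarrow> w \<in> tangent_space A p \<Longrightarrow>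
      g p (u + v) w = g p u w + g p v w"
    using conjunct1[OF conjunct2[OF M]] by blast
  have m3: "\<And>a u v. u \<in> tangent_space A p \<Longrightarrow> v \<in> tangent_space A p \<Longrightarrow> g p (a *\<^sub>R u) v = a * g p u v"
    using conjunct1[OF conjunct2[OF conjunct2[OF M]]] by blast
  have m4: "\<And>u. u \<in> tangent_space A p \<Longrightarrow> u \<noteq> 0 \<Longrightarrow> g p u u > 0"
    using conjunct2[OF conjunct2[OF conjunct2[OF M]]] by blast
  show "inner_form (metric_coord A g c x)"
  proof
    fix u v w :: 'e and a :: real
    show "metric_coord A g c x u v = metric_coord A g c x v u"
      unfolding p(2) metric_coord_chart[OF c p(1)] by (rule m1[OF T T])
    show "metric_coord A g c x (u + v) w = metric_coord A g c x u w + metric_coord A g c x v w"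
      unfolding p(2) metric_coord_chart[OF c p(1)] linear_add[OF lin] by (rule m2[OF T T T])
    show "metric_coord A g c x (a *\<^sub>R u) v = a * metric_coord A g c x u v"
      unfolding p(2) metric_coord_chart[OF c p(1)] linear_scale[OF lin] by (rule m3[OF T T])
    show "metric_coord A g c x u u > 0" if "u \<noteq> 0"
    proof -
      have "tvec_of A c p u \<noteq> 0"
        using that injD[OF inj_tvec_of[OF c p(1)], of u 0] linear_0[OF lin] by auto
      then show ?thesis unfolding p(2) metric_coord_chart[OF c p(1)] by (rule m4[OF T])
    qed
  qed
qed

lemma isometric_change_coord:
  assumes c: "c \<in> A" and d: "d \<in> A"
  shows "isometric_change (snd c ` (fst c \<inter> fst d)) (metric_coord A g c) (chart_image d) (metric_coord A g d) (transition c d)"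
proof -
  obtain W where W: "open W" "snd c ` (fst c \<inter> fst d) = chart_image c \<inter> W"
    using overlap_open[OF c d] by blast
  interpret O: metric_field "snd c ` (fst c \<inter> fst d)" "metric_coord A g c"
    unfolding W(2) by (rule metric_field.local_restriction(1)[OF metric_field_coord[OF c] W(1)])
  interpret T: metric_field "chart_image d" "metric_coord A g d" by (rule metric_field_coord[OF d])
  show ?thesis
  proof
    show "transition c d ` (snd c ` (fst c \<inter> fst d)) \<subseteq> chart_image d"
      unfolding transition_image[OF c] by (auto simp: chart_image_def)
    show "smooth_on (snd c ` (fst c \<inter> fst d)) (transition c d)" by (rule smooth_transition[OF c d])
    fix x assume "x \<in> snd c ` (fst c \<inter> fst d)"
    then obtain p where p: "p \<in> fst c" "p \<in> fst d" "x = snd c p" by blast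
    have td: "fderiv (snd c ` (fst c \<inter> fst d)) (transition c d) x = transition_deriv c d p"
      by (simp add: transition_deriv_def p(3))
    show "surj (fderiv (snd c ` (fst c \<inter> fst d)) (transition c d) x)"
      unfolding td using bij_transition_deriv[OF c d p(1,2)] by (rule bij_is_surj)
    show "metric_coord A g c x u v = metric_coord A g d (transition c d x)
        (fderiv (snd c ` (fst c \<inter> fst d)) (transition c d) x u)
        (fderiv (snd c ` (fst c \<inter> fst d)) (transition c d) x v)" for u v
      unfolding td unfolding p(3) transition_chart[OF c p(1)] metric_coord_chart[OF c p(1)] metric_coord_chart[OF d p(2)]
        tvec_of_change[OF c d p(1,2)] ..
  qed
qed

abbreviation curv where "curv c \<equiv> curvature_coord (chart_image c) (metric_coord A g c)"
abbreviation chris where "chris c \<equiv> christoffel (chart_image c) (metric_coord A g c)"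

lemma restrict_to_overlap:
  assumes c: "c \<in> A" and d: "d \<in> A" and p: "p \<in> fst c" "p \<in> fst d"
  shows "christoffel (snd c ` (fst c \<inter> fst d)) (metric_coord A g c) (snd c p) = chris c (snd c p)"
    and "curvature_coord (snd c ` (fst c \<inter> fst d)) (metric_coord A g c) (snd c p) = curv c (snd c p)"
proof -
  obtain W where W: "open W" "snd c ` (fst c \<inter> fst d) = chart_image c \<inter> W"
    using overlap_open[OF c d] by blast
  have "snd c p \<in> chart_image c \<inter> W" using p W(2) by blast
  from metric_field.local_restriction(2,3)[OF metric_field_coord[OF c] W(1) this]
  show "christoffel (snd c ` (fst c \<inter> fst d)) (metric_coord A g c) (snd c p) = chris c (snd c p)"
    and "curvature_coord (snd c ` (fst c \<inter> fst d)) (metric_coord A g c) (snd c p) = curv c (snd c p)"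
    unfolding W(2) .
qed

lemma christoffel_transition:
  assumes c: "c \<in> A" and d: "d \<in> A" and p: "p \<in> fst c" "p \<in> fst d"
  shows "transition_deriv c d p (chris c (snd c p) u v) =
    fderiv (snd c ` (fst c \<inter> fst d)) (\<lambda>x. fderiv (snd c ` (fst c \<inter> fst d)) (transition c d) x v) (snd c p) u
    + chris d (snd d p) (transition_deriv c d p u) (transition_deriv c d p v)"
proof -
  interpret isometric_change "snd c ` (fst c \<inter> fst d)" "metric_coord A g c" "chart_image d" "metric_coord A g d" "transition c d"
    by (rule isometric_change_coord[OF c d])
  have "snd c p \<in> snd c ` (fst c \<inter> fst d)" using p by blast
  from christoffel_change[OF this, of u v] show ?thesis
    by (simp add: restrict_to_overlap[OF c d p] c p transition_deriv_def)
qed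

lemma curvature_transition:
  assumes c: "c \<in> A" and d: "d \<in> A" and p: "p \<in> fst c" "p \<in> fst d"
  shows "transition_deriv c d p (curv c (snd c p) u v w) =
    curv d (snd d p) (transition_deriv c d p u) (transition_deriv c d p v) (transition_deriv c d p w)"
proof -
  interpret isometric_change "snd c ` (fst c \<inter> fst d)" "metric_coord A g c" "chart_image d" "metric_coord A g d" "transition c d"
    by (rule isometric_change_coord[OF c d])
  have "snd c p \<in> snd c ` (fst c \<inter> fst d)" using p by blast
  from curvature_change[OF this, of u v w] show ?thesis
    by (simp add: restrict_to_overlap[OF c d p] c p transition_deriv_def)
qed

text \<open>\<open>riemann\<close> is defined chart by chart; that the components belong to one tangent vector is the tensor property of
  the curvature.  Without it the metric could not be evaluated on it in coordinates.\<close>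

lemma riemann_in:
  assumes "u \<in> tangent_space A p" "v \<in> tangent_space A p" "w \<in> tangent_space A p"
  shows "riemann A g p u v w \<in> tangent_space A p"
proof -
  have "transition_deriv c d p (curv c (snd c p) (u c) (v c) (w c)) = curv d (snd d p) (u d) (v d) (w d)"
    if "c \<in> A" "d \<in> A" "p \<in> fst c" "p \<in> fst d" for c d
    unfolding curvature_transition[OF that] tangent_component[OF assms(1) that] tangent_component[OF assms(2) that]
      tangent_component[OF assms(3) that] ..
  then show ?thesis
    unfolding tangent_space_def riemann_def by simp
qed

lemma orthonormal_at_tvec_of:
  assumes c: "c \<in> A" "p \<in> fst c"
    and o: "\<And>i j. i \<le> k \<Longrightarrow> j \<le> k \<Longrightarrow> metric_coord A g c (snd c p) (e i) (e j) = (if i = j then 1 else 0)"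
  shows "orthonormal_at A g p k (\<lambda>i. tvec_of A c p (e i))"
  using o unfolding orthonormal_at_def by (simp add: tvec_of_in[OF c] metric_coord_chart[OF c])

text \<open>For orthonormal vectors the denominators of the sectional curvatures are 1.\<close>

lemma intermediate_ricci_tvec_of:
  assumes c: "c \<in> A" "p \<in> fst c"
    and o: "\<And>i j. i \<le> k \<Longrightarrow> j \<le> k \<Longrightarrow> metric_coord A g c (snd c p) (e i) (e j) = (if i = j then 1 else 0)"
  shows "intermediate_ricci A g k p (\<lambda>i. tvec_of A c p (e i)) =
    (\<Sum>i=1..k. metric_coord A g c (snd c p) (curv c (snd c p) (e 0) (e i) (e i)) (e 0))"
  unfolding intermediate_ricci_def
proof (rule sum.cong[OF refl])
  fix i assume i: "i \<in> {1..k}"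
  let ?t = "\<lambda>i. tvec_of A c p (e i)"
  note T = tvec_of_in[OF c]
  have g: "g p (?t a) (?t b) = (if a = b then 1 else 0)" if "a \<le> k" "b \<le> k" for a b
    using o[OF that] unfolding metric_coord_chart[OF c] .
  have "g p (riemann A g p (?t 0) (?t i) (?t i)) (?t 0) =
      metric_coord A g c (snd c p) (riemann A g p (?t 0) (?t i) (?t i) c) (?t 0 c)"
    by (rule metric_via_coord[OF c riemann_in[OF T T T] T])
  also have "\<dots> = metric_coord A g c (snd c p) (curv c (snd c p) (e 0) (e i) (e i)) (e 0)"
    using c by (simp add: riemann_def tvec_of_chart)
  finally show "sectional_curvature A g p (?t 0) (?t i) =
      metric_coord A g c (snd c p) (curv c (snd c p) (e 0) (e i) (e i)) (e 0)"
    using i g[of 0 0] g[of i i] g[of 0 i] by (simp add: sectional_curvature_def)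
qed

end

section \<open>Manifolds with boundary\<close>

lemma half_space_iff: "x \<in> half_space \<longleftrightarrow> fst x \<ge> 0"
  by (cases x) (simp add: half_space_def)

lemma thick_half_space: "thick (half_space :: (real \<times> 'e::euclidean_space) set)"
  unfolding thick_def
proof (intro ballI allI impI)
  fix x i :: "real \<times> 'e" and e :: real
  assume x: "x \<in> half_space" and i: "i \<in> Basis" and e: "e > 0"
  have "fst i \<ge> 0" using i by (auto simp: Basis_prod_def)
  then have "x + (e / 2) *\<^sub>R i \<in> half_space" using x e by (simp add: half_space_iff)
  then show "\<exists>d. 0 < \<bar>d\<bar> \<and> \<bar>d\<bar> < e \<and> x + d *\<^sub>R i \<in> half_space"
    using e by (intro exI[of _ "e / 2"]) auto
qed



locale bounded_manifold =
  fixes M :: "'p topology" and A :: "('p, real \<times> 'e::euclidean_space) chart set"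
  assumes manifold: "smooth_manifold_with_boundary M A"
begin

abbreviation bd where "bd \<equiv> manifold_boundary A"

definition rchart :: "'p set \<Rightarrow> ('p, real \<times> 'e) chart \<Rightarrow> ('p, real \<times> 'e) chart" where
  "rchart N c = (fst c \<inter> N, snd c)"

definition bchart :: "('p, real \<times> 'e) chart \<Rightarrow> ('p, 'e) chart" where
  "bchart c = (fst c \<inter> bd, snd \<circ> snd c)"

lemma restrict_atlas_eq: "restrict_atlas N A = rchart N ` A"
  by (simp add: restrict_atlas_def rchart_def[abs_def])

lemma boundary_atlas_eq: "boundary_atlas A = bchart ` A"
  by (simp add: boundary_atlas_def bchart_def[abs_def])

lemma fst_chart [simp]: "fst (rchart N c) = fst c \<inter> N" "snd (rchart N c) = snd c"
    "fst (bchart c) = fst c \<inter> bd" "snd (bchart c) p = snd (snd c p)"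
  by (simp_all add: rchart_def bchart_def)

lemma atlas: "smooth_atlas half_space M A"
  using manifold by (simp add: smooth_manifold_with_boundary_def)

lemma chart_facts:
  assumes "c \<in> A"
  shows "openin M (fst c)" "openin (top_of_set half_space) (chart_image c)"
    "homeomorphic_map (subtopology M (fst c)) (top_of_set (chart_image c)) (snd c)" "fst c \<subseteq> topspace M"
  using atlas assms openin_subset unfolding smooth_atlas_def by blast+

lemma smooth_chart_transition: "c \<in> A \<Longrightarrow> d \<in> A \<Longrightarrow> smooth_on (snd c ` (fst c \<inter> fst d)) (transition c d)"
  using atlas unfolding smooth_atlas_def by blast

lemma inj_on_chart:
  assumes c: "c \<in> A"
  shows "inj_on (snd c) (fst c)"
  using homeomorphic_imp_injective_map[OF chart_facts(3)[OF c]] chart_facts(4)[OF c]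
  by (simp add: Int_absorb1)

lemma chart_nonneg:
  assumes c: "c \<in> A" and p: "p \<in> fst c"
  shows "fst (snd c p) \<ge> 0"
proof -
  have "chart_image c \<subseteq> half_space" using openin_subset[OF chart_facts(2)[OF c]] by simp
  moreover have "snd c p \<in> chart_image c" using p by (simp add: chart_image_def)
  ultimately show ?thesis using half_space_iff by blast
qed

lemma image_open:
  assumes c: "c \<in> A" and V: "openin M V"
  shows "\<exists>W. open W \<and> snd c ` (fst c \<inter> V) = half_space \<inter> W"
proof -
  have "openin (subtopology M (fst c)) (fst c \<inter> V)" by (rule openin_subtopology_Int2[OF V])
  then have "openin (top_of_set (chart_image c)) (snd c ` (fst c \<inter> V))"
    using homeomorphic_imp_open_map[OF chart_facts(3)[OF c]] by (simp add: open_map_def)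
  then have "openin (top_of_set half_space) (snd c ` (fst c \<inter> V))"
    using chart_facts(2)[OF c] by (rule openin_trans)
  then show ?thesis unfolding openin_open by blast
qed

lemma transition_on_chart:
  assumes "inj_on (snd c) (fst c)" "p \<in> fst c"
  shows "transition c d (snd c p) = snd d p"
  using inv_into_f_f[OF assms] by (simp add: transition_def chart_inv_def)

lemma thick_atlas_restrict:
  assumes N: "openin M N"
  shows "thick_atlas (restrict_atlas N A)"
proof
  fix c' assume "c' \<in> restrict_atlas N A"
  then obtain c where c: "c \<in> A" "c' = rchart N c" by (auto simp: restrict_atlas_eq)
  show inj: "inj_on (snd c') (fst c')"
    using inj_on_subset[OF inj_on_chart[OF c(1)], of "fst c \<inter> N"] by (simp add: c(2))
  have img: "chart_image c' = snd c ` (fst c \<inter> N)" by (simp add: c(2) chart_image_def)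
  obtain W where W: "open W" "snd c ` (fst c \<inter> N) = half_space \<inter> W" using image_open[OF c(1) N] by blast
  show "thick (chart_image c')" unfolding img W(2) by (rule thick_Int_open[OF thick_half_space W(1)])
  fix d' assume "d' \<in> restrict_atlas N A"
  then obtain d where d: "d \<in> A" "d' = rchart N d" by (auto simp: restrict_atlas_eq)
  have ov: "snd c' ` (fst c' \<inter> fst d') = snd c ` (fst c \<inter> (fst d \<inter> N))" by (auto simp: c(2) d(2))
  have "openin M (fst d \<inter> N)" using chart_facts(1)[OF d(1)] N by (rule openin_Int)
  then obtain W' where W': "open W'" "snd c ` (fst c \<inter> (fst d \<inter> N)) = half_space \<inter> W'"
    using image_open[OF c(1)] by blast
  have "snd c ` (fst c \<inter> (fst d \<inter> N)) \<subseteq> snd c ` (fst c \<inter> N)" by blast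
  then have "snd c' ` (fst c' \<inter> fst d') = chart_image c' \<inter> W'"
    unfolding ov img W(2) W'(2) by blast
  then show "\<exists>W. open W \<and> snd c' ` (fst c' \<inter> fst d') = chart_image c' \<inter> W" using W'(1) by blast
  show "smooth_on (snd c' ` (fst c' \<inter> fst d')) (transition c' d')"
  proof (rule smooth_on_cong)
    show "smooth_on (snd c' ` (fst c' \<inter> fst d')) (transition c d)"
      by (rule smooth_on_subset[OF smooth_chart_transition[OF c(1) d(1)]]) (auto simp: ov)
    fix x assume "x \<in> snd c' ` (fst c' \<inter> fst d')"
    then obtain p where p: "p \<in> fst c'" "p \<in> fst d'" "x = snd c' p" by blast
    then show "transition c d x = transition c' d' x"
      using transition_on_chart[OF inj p(1), of d'] transition_on_chart[OF inj_on_chart[OF c(1)], of p d]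
      by (simp add: c(2) d(2))
  qed
qed

lemma thick_atlas_self: "thick_atlas A"
proof -
  have "rchart (topspace M) c = c" if "c \<in> A" for c
    using chart_facts(4)[OF that] by (simp add: rchart_def Int_absorb2)
  then have "restrict_atlas (topspace M) A = A"
    unfolding restrict_atlas_eq by (simp add: image_cong[OF refl, of A "rchart (topspace M)" "\<lambda>c. c"])
  then show ?thesis using thick_atlas_restrict[OF openin_topspace] by simp
qed

sublocale T: thick_atlas A by (rule thick_atlas_self)

text \<open>Invariance of the boundary: if some chart puts \<open>p\<close> on the boundary and another one in the interior, the first
  coordinate of the transition map has a minimum at an interior point, so its derivative there vanishes and
  the transition map is not invertible to first order.\<close>

lemma boundary_chart_zero:
  assumes c: "c \<in> A" "p \<in> fst c" and p: "p \<in> bd"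
  shows "fst (snd c p) = 0"
proof (rule ccontr)
  assume "fst (snd c p) \<noteq> 0"
  then have pos: "fst (snd c p) > 0" using chart_nonneg[OF c] by simp
  obtain d where d: "d \<in> A" "p \<in> fst d" "fst (snd d p) = 0" using p by (auto simp: manifold_boundary_def)
  let ?O = "snd c ` (fst c \<inter> fst d)" and ?t = "transition_deriv c d p"
  obtain W where W: "open W" "?O = half_space \<inter> W" using image_open[OF c(1) chart_facts(1)[OF d(1)]] by blast
  define V where "V = W \<inter> {z. fst z > 0}"
  have V: "open V" unfolding V_def by (intro open_Int W open_Collect_less continuous_intros)
  have VO: "V \<subseteq> ?O" unfolding W(2) by (auto simp: V_def half_space_iff)
  have xV: "snd c p \<in> V" using c(2) d(2) pos W(2) by (auto simp: V_def)
  have "(transition c d has_derivative ?t) (at (snd c p) within V)"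
    by (rule has_derivative_subset[OF T.transition_has_derivative[OF c(1) d(1) c(2) d(2)] VO])
  then have "(transition c d has_derivative ?t) (at (snd c p))"
    using at_within_open[OF xV V] by simp
  then have D: "((\<lambda>z. fst (transition c d z)) has_derivative (\<lambda>u. fst (?t u))) (at (snd c p))"
    by (rule has_derivative_fst)
  have "(\<lambda>u. fst (?t u)) = (\<lambda>u. 0)"
  proof (rule differential_zero_maxmin[OF xV V D])
    have "fst (transition c d (snd c p)) \<le> fst (transition c d z)" if z: "z \<in> V" for z
    proof -
      obtain q where q: "q \<in> fst c" "q \<in> fst d" "z = snd c q" using z VO by blast
      show ?thesis using chart_nonneg[OF d(1) q(2)] d(3) c q by simp
    qed
    then show "(\<forall>z\<in>V. fst (transition c d z) \<le> fst (transition c d (snd c p))) \<or>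
        (\<forall>z\<in>V. fst (transition c d (snd c p)) \<le> fst (transition c d z))" by blast
  qed
  moreover obtain u where "?t u = (1, 0)"
    using bij_is_surj[OF T.bij_transition_deriv[OF c(1) d(1) c(2) d(2)]] by (metis surjD)
  ultimately show False by (metis fst_conv zero_neq_one)
qed

lemma boundary_chart_pair: "c \<in> A \<Longrightarrow> p \<in> fst c \<Longrightarrow> p \<in> bd \<Longrightarrow> snd c p = (0, snd (snd c p))"
  by (simp add: prod_eq_iff boundary_chart_zero)

text \<open>Boundary points are those whose coordinates lie in the slice, by \<open>boundary_chart_zero\<close> in every chart.\<close>

lemma boundary_image:
  assumes c: "c \<in> A"
  shows "snd (bchart c) ` (fst c \<inter> bd \<inter> V) = {y. (0, y) \<in> snd c ` (fst c \<inter> V)}"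
proof (intro equalityI subsetI)
  fix y assume "y \<in> snd (bchart c) ` (fst c \<inter> bd \<inter> V)"
  then obtain p where p: "p \<in> fst c" "p \<in> bd" "p \<in> V" "y = snd (snd c p)" by auto
  then have "(0, y) = snd c p" using boundary_chart_pair[OF c] by simp
  then show "y \<in> {y. (0, y) \<in> snd c ` (fst c \<inter> V)}" using p by blast
next
  fix y assume "y \<in> {y. (0, y) \<in> snd c ` (fst c \<inter> V)}"
  then obtain p where p: "p \<in> fst c" "p \<in> V" "(0, y) = snd c p" by auto
  have "p \<in> bd" unfolding manifold_boundary_def using c p by (auto intro!: bexI[of _ c] simp: p(3)[symmetric])
  then show "y \<in> snd (bchart c) ` (fst c \<inter> bd \<inter> V)"
    using p by (intro image_eqI[of _ _ p]) (auto simp: p(3)[symmetric])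
qed

lemma boundary_image_open:
  assumes c: "c \<in> A" and V: "openin M V"
  shows "open (snd (bchart c) ` (fst c \<inter> bd \<inter> V))"
proof -
  obtain W where W: "open W" "snd c ` (fst c \<inter> V) = half_space \<inter> W" using image_open[OF c V] by blast
  have "{y. (0, y) \<in> half_space \<inter> W} = (\<lambda>y. (0, y)) -` W" by (auto simp: half_space_iff)
  moreover have "open ((\<lambda>y::'e. (0::real, y)) -` W)"
    using W(1) by (intro open_vimage continuous_intros)
  ultimately show ?thesis unfolding boundary_image[OF c] W(2) by simp
qed

lemma inj_on_bchart: "c \<in> A \<Longrightarrow> inj_on (snd (bchart c)) (fst (bchart c))"
proof (rule inj_onI)
  fix p q assume c: "c \<in> A" and pq: "p \<in> fst (bchart c)" "q \<in> fst (bchart c)" "snd (bchart c) p = snd (bchart c) q"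
  then have "snd c p = snd c q" using boundary_chart_pair[OF c, of p] boundary_chart_pair[OF c, of q] by simp
  then show "p = q" using inj_on_chart[OF c] pq by (auto dest: inj_onD)
qed

lemma transition_boundary:
  assumes c: "c \<in> A" "d \<in> A" and p: "p \<in> fst c" "p \<in> fst d" "p \<in> bd"
  shows "transition (bchart c) (bchart d) (snd (snd c p)) = snd (snd d p)"
  using transition_on_chart[OF inj_on_bchart[OF c(1)], of p "bchart d"] p by simp

lemma thick_atlas_boundary: "thick_atlas (boundary_atlas A)"
proof
  fix c' assume "c' \<in> boundary_atlas A"
  then obtain c where c: "c \<in> A" "c' = bchart c" by (auto simp: boundary_atlas_eq)
  show "inj_on (snd c') (fst c')" unfolding c(2) by (rule inj_on_bchart[OF c(1)])
  have "chart_image c' = snd (bchart c) ` (fst c \<inter> bd \<inter> topspace M)"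
    using chart_facts(4)[OF c(1)] by (auto simp: chart_image_def c(2))
  then have opn: "open (chart_image c')" using boundary_image_open[OF c(1) openin_topspace] by simp
  then show "thick (chart_image c')" by (rule thick_open)
  fix d' assume "d' \<in> boundary_atlas A"
  then obtain d where d: "d \<in> A" "d' = bchart d" by (auto simp: boundary_atlas_eq)
  have ov: "snd c' ` (fst c' \<inter> fst d') = snd (bchart c) ` (fst c \<inter> bd \<inter> fst d)"
    by (auto simp: c(2) d(2))
  have "open (snd c' ` (fst c' \<inter> fst d'))"
    unfolding ov by (rule boundary_image_open[OF c(1) chart_facts(1)[OF d(1)]])
  moreover have "snd c' ` (fst c' \<inter> fst d') \<subseteq> chart_image c'" by (auto simp: chart_image_def)
  ultimately show "\<exists>W. open W \<and> snd c' ` (fst c' \<inter> fst d') = chart_image c' \<inter> W" by blast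
  show "smooth_on (snd c' ` (fst c' \<inter> fst d')) (transition c' d')"
  proof (rule smooth_on_cong)
    have "smooth_on (snd c' ` (fst c' \<inter> fst d')) (\<lambda>y. transition c d (0, y))"
    proof (rule smooth_on_compose[OF smooth_chart_transition[OF c(1) d(1)]])
      show "smooth_on (snd c' ` (fst c' \<inter> fst d')) (\<lambda>y. (0, y))"
        by (intro smooth_on_linear bounded_linear_Pair bounded_linear_zero bounded_linear_ident)
      show "(\<lambda>y. (0, y)) ` (snd c' ` (fst c' \<inter> fst d')) \<subseteq> snd c ` (fst c \<inter> fst d)"
        unfolding ov boundary_image[OF c(1)] by auto
    qed
    then show "smooth_on (snd c' ` (fst c' \<inter> fst d')) (\<lambda>y. snd (transition c d (0, y)))"
      by (rule smooth_on_bounded_linear[OF bounded_linear_snd])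
    fix y assume "y \<in> snd c' ` (fst c' \<inter> fst d')"
    then obtain p where p: "p \<in> fst c" "p \<in> bd" "p \<in> fst d" "y = snd (snd c p)" unfolding ov by auto
    then show "snd (transition c d (0, y)) = transition c' d' y"
      using transition_boundary[OF c(1) d(1), of p] boundary_chart_pair[OF c(1) p(1,2)] transition_on_chart[OF inj_on_chart[OF c(1)] p(1), of d]
      by (simp add: c(2) d(2))
  qed
qed

end

section \<open>The boundary as a hypersurface\<close>

subsection \<open>The shape operator\<close>

context hypersurface
begin

definition shape :: "'e \<Rightarrow> 'e \<Rightarrow> 'e" where
  "shape y u = (THE z. \<forall>w. h y z w = second_form y u w)"

lemma shape_eq:
  assumes "y \<in> U"
  shows "h y (shape y u) w = second_form y u w"
proof -
  have "\<exists>!z. \<forall>w. h y z w = second_form y u w"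
    using inner_form.ex1_representative[OF H.inner_form[OF assms] linear_second_form[OF assms]] .
  from theI'[OF this] show ?thesis unfolding shape_def by blast
qed

lemma linear_second_form_left: "y \<in> U \<Longrightarrow> linear (\<lambda>u. second_form y u v)"
  using linear_second_form[of y v] second_form_sym[of y _ v] by (simp add: linear_iff)

lemma bilinear_second_form: "y \<in> U \<Longrightarrow> bilinear (second_form y)"
  by (simp add: bilinear_def linear_second_form linear_second_form_left)

lemma linear_shape:
  assumes y: "y \<in> U"
  shows "linear (shape y)"
  by (rule linearI; rule H.heqI[OF y]; simp add: shape_eq[OF y] linear_add[OF H.linear_left[OF y]]
      linear_scale[OF H.linear_left[OF y]] linear_add[OF linear_second_form_left[OF y]]
      linear_scale[OF linear_second_form_left[OF y]])

lemma shape_adjoint: "y \<in> U \<Longrightarrow> h y (shape y u) v = h y u (shape y v)"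
  by (simp add: shape_eq H.hsym[of y u] second_form_sym[of y u v])

lemma smooth_shape: "smooth_on U (\<lambda>y. shape y u)"
  by (rule H.smooth_representative[OF shape_eq smooth_second_form])

end

text \<open>\<open>ricci\<close> is a trace in the coordinates of a chosen chart; in an orthonormal basis it becomes a sum that may be
  computed in any chart.\<close>

lemma (in riemannian_atlas) ricci_trace:
  assumes c: "c \<in> A" "p \<in> fst c" and u: "u \<in> tangent_space A p" and v: "v \<in> tangent_space A p"
    and e: "inner_form.orthonormal_basis (metric_coord A g c (snd c p)) e"
  shows "ricci A g p u v = (\<Sum>i<DIM('e). g p (riemann A g p (tvec_of A c p (e i)) u v) (tvec_of A c p (e i)))"
proof -
  define d where "d = some_chart A p"
  have d: "d \<in> A" "p \<in> fst d" using some_chart[OF c] by (simp_all add: d_def)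
  let ?t = "transition_deriv c d p"
  define e' where "e' i = ?t (e i)" for i
  interpret C: metric_field "chart_image c" "metric_coord A g c" by (rule metric_field_coord[OF c(1)])
  interpret D: metric_field "chart_image d" "metric_coord A g d" by (rule metric_field_coord[OF d(1)])
  note xd = chart_in_image[OF d(2)] and xc = chart_in_image[OF c(2)]
  interpret C0: inner_form "metric_coord A g c (snd c p)" by (rule C.inner_form[OF xc])
  interpret D0: inner_form "metric_coord A g d (snd d p)" by (rule D.inner_form[OF xd])
  have iso: "metric_coord A g d (snd d p) (?t a) (?t b) = metric_coord A g c (snd c p) a b" for a b
    by (simp add: metric_coord_chart[OF c] metric_coord_chart[OF d] tvec_of_change[OF c(1) d(1) c(2) d(2)])
  have lt: "linear ?t" by (rule linear_transition_deriv[OF c(1) d(1) c(2) d(2)])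
  have ex: "w = (\<Sum>i<DIM('e). metric_coord A g d (snd d p) w (e' i) *\<^sub>R e' i)" for w
  proof -
    obtain z where z: "w = ?t z" using bij_is_surj[OF bij_transition_deriv[OF c(1) d(1) c(2) d(2)]] by (metis surjD)
    have "?t z = ?t (\<Sum>i<DIM('e). metric_coord A g c (snd c p) z (e i) *\<^sub>R e i)"
      using C0.orthonormal_basisD(2)[OF e, of z] by (rule arg_cong)
    also have "\<dots> = (\<Sum>i<DIM('e). metric_coord A g d (snd d p) w (e' i) *\<^sub>R e' i)"
      by (simp add: linear_sum[OF lt] linear_scale[OF lt] z e'_def iso)
    finally show ?thesis unfolding z .
  qed
  have "ricci A g p u v = (\<Sum>b\<in>Basis. curv d (snd d p) b (u d) (v d) \<bullet> b)"
    unfolding ricci_def Let_def d_def[symmetric]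
    by (intro sum.cong refl) (simp add: riemann_def d tvec_of_chart)
  also have "\<dots> = (\<Sum>i<DIM('e). metric_coord A g d (snd d p) (curv d (snd d p) (e' i) (u d) (v d)) (e' i))"
    by (rule D0.trace_expansion[OF D.linear_curvature[OF xd] ex])
  also have "\<dots> = (\<Sum>i<DIM('e). g p (riemann A g p (tvec_of A c p (e i)) u v) (tvec_of A c p (e i)))"
  proof (intro sum.cong refl)
    fix i
    have t: "tvec_of A c p (e i) d = e' i" using d by (simp add: tvec_of_def e'_def)
    have "g p (riemann A g p (tvec_of A c p (e i)) u v) (tvec_of A c p (e i)) =
      metric_coord A g d (snd d p) (riemann A g p (tvec_of A c p (e i)) u v d) (tvec_of A c p (e i) d)"
      by (rule metric_via_coord[OF d riemann_in[OF tvec_of_in[OF c] u v] tvec_of_in[OF c]])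
    then show "metric_coord A g d (snd d p) (curv d (snd d p) (e' i) (u d) (v d)) (e' i) =
        g p (riemann A g p (tvec_of A c p (e i)) u v) (tvec_of A c p (e i))"
      by (simp add: riemann_def d t)
  qed
  finally show ?thesis .
qed

subsection \<open>The boundary inside an open neighbourhood\<close>

locale boundary_neighborhood = bounded_manifold M A
  for M :: "'p topology" and A :: "('p, real \<times> 'e::euclidean_space) chart set" +
  fixes N :: "'p set"
  assumes N: "openin M N" and bdN: "bd \<subseteq> N"
begin

sublocale RA: thick_atlas "restrict_atlas N A" by (rule thick_atlas_restrict[OF N])
sublocale BA: thick_atlas "boundary_atlas A" by (rule thick_atlas_boundary)

abbreviation nbA where "nbA \<equiv> restrict_atlas N A"
abbreviation bdA where "bdA \<equiv> boundary_atlas A"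
abbreviation rc where "rc \<equiv> rchart N"

lemma rc_in [simp]: "c \<in> A \<Longrightarrow> rc c \<in> nbA"
  by (simp add: restrict_atlas_eq)

lemma bchart_in [simp]: "c \<in> A \<Longrightarrow> bchart c \<in> bdA"
  by (simp add: boundary_atlas_eq)

lemma bd_in_N [simp]: "p \<in> bd \<Longrightarrow> p \<in> N"
  using bdN by blast

abbreviation slice where "slice c d \<equiv> snd (bchart c) ` (fst c \<inter> bd \<inter> fst d)"
abbreviation over where "over c d \<equiv> snd (rc c) ` (fst (rc c) \<inter> fst (rc d))"

lemma thick_slice: "c \<in> A \<Longrightarrow> d \<in> A \<Longrightarrow> thick (slice c d)"
  by (rule thick_open) (rule boundary_image_open, auto intro: chart_facts)

lemma slice_overlap: "slice c d = snd (bchart c) ` (fst (bchart c) \<inter> fst (bchart d))"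
  by auto

lemma slice_in_over: "c \<in> A \<Longrightarrow> y \<in> slice c d \<Longrightarrow> (0, y) \<in> over c d"
proof -
  assume c: "c \<in> A" and "y \<in> slice c d"
  then obtain q where q: "q \<in> fst c" "q \<in> bd" "q \<in> fst d" "y = snd (snd c q)" by auto
  then have "(0, y) = snd (rc c) q" using boundary_chart_pair[OF c, of q] by simp
  then show ?thesis using q by auto
qed

lemma pair_zero_has_derivative: "((\<lambda>y::'e. (0::real, y)) has_derivative (\<lambda>u. (0, u))) (at y within S)"
  by (intro bounded_linear_imp_has_derivative bounded_linear_Pair bounded_linear_zero bounded_linear_ident)

text \<open>Derivatives along the boundary are ambient derivatives in directions tangent to the slice.\<close>

lemma slice_has_derivative:
  assumes c: "c \<in> A" "d \<in> A" and p: "p \<in> fst c" "p \<in> fst d" "p \<in> bd" and f: "smooth_on (over c d) f"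
  shows "((\<lambda>y. f (0, y)) has_derivative (\<lambda>u. fderiv (over c d) f (snd c p) (0, u))) (at (snd (snd c p)) within slice c d)"
proof (rule has_derivative_in_compose[OF pair_zero_has_derivative])
  have "snd c p \<in> over c d" using p by auto
  then have "(f has_derivative fderiv (over c d) f (snd c p)) (at (snd c p) within over c d)"
    by (rule smooth_on_has_derivative[OF f])
  then show "(f has_derivative fderiv (over c d) f (snd c p)) (at (0, snd (snd c p)) within (\<lambda>y. (0, y)) ` slice c d)"
    unfolding boundary_chart_pair[OF c(1) p(1,3), symmetric]
    by (rule has_derivative_subset) (use slice_in_over[OF c(1)] in blast)
qed

lemma transition_slice:
  assumes c: "c \<in> A" "d \<in> A" and y: "y \<in> slice c d"
  shows "transition (rc c) (rc d) (0, y) = (0, transition (bchart c) (bchart d) y)"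
proof -
  obtain q where q: "q \<in> fst c" "q \<in> bd" "q \<in> fst d" "y = snd (snd c q)" using y by auto
  have "transition (rc c) (rc d) (snd (rc c) q) = snd (rc d) q"
    by (rule RA.transition_chart) (use c q in auto)
  moreover have "transition (bchart c) (bchart d) (snd (bchart c) q) = snd (bchart d) q"
    by (rule BA.transition_chart) (use c q in auto)
  ultimately show ?thesis
    using boundary_chart_pair[OF c(1) q(1,2)] boundary_chart_pair[OF c(2) q(3,2)] q(4) by simp
qed

lemma transition_deriv_boundary:
  assumes c: "c \<in> A" "d \<in> A" and p: "p \<in> fst c" "p \<in> fst d" "p \<in> bd"
  shows "transition_deriv (rc c) (rc d) p (0, u) = (0, transition_deriv (bchart c) (bchart d) p u)"
proof -
  let ?y = "snd (snd c p)"
  have y: "?y \<in> slice c d" using p by auto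
  have "((\<lambda>y. transition (rc c) (rc d) (0, y)) has_derivative (\<lambda>u. transition_deriv (rc c) (rc d) p (0, u))) (at ?y within slice c d)"
    using slice_has_derivative[OF c p RA.smooth_transition[OF rc_in[OF c(1)] rc_in[OF c(2)]]]
    by (simp add: transition_deriv_def)
  moreover have "((\<lambda>y. transition (rc c) (rc d) (0, y)) has_derivative
      (\<lambda>u. (0, transition_deriv (bchart c) (bchart d) p u))) (at ?y within slice c d)"
  proof (rule has_derivative_transform[OF y])
    have "(transition (bchart c) (bchart d) has_derivative transition_deriv (bchart c) (bchart d) p) (at ?y within slice c d)"
      using BA.transition_has_derivative[OF bchart_in[OF c(1)] bchart_in[OF c(2)], of p] p
      unfolding slice_overlap by simp
    then show "((\<lambda>y. (0, transition (bchart c) (bchart d) y)) has_derivative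
      (\<lambda>u. (0, transition_deriv (bchart c) (bchart d) p u))) (at ?y within slice c d)"
      by (intro has_derivative_Pair has_derivative_const)
  qed (rule transition_slice[OF c])
  ultimately show ?thesis using thick_fderiv_eq[OF thick_slice[OF c] y] by metis
qed

text \<open>Along the slice the derivatives in tangential directions stay tangential, so differentiating them once more
  along the slice produces nothing transversal.  This removes the defect term of \<open>christoffel_change\<close> from
  the second fundamental form.\<close>

lemma second_transition_deriv_boundary:
  assumes c: "c \<in> A" "d \<in> A" and p: "p \<in> fst c" "p \<in> fst d" "p \<in> bd"
  shows "fst (fderiv (over c d) (\<lambda>x. fderiv (over c d) (transition (rc c) (rc d)) x (0, v)) (snd c p) (0, u)) = 0"
proof -
  let ?y = "snd (snd c p)" and ?G = "\<lambda>x. fderiv (over c d) (transition (rc c) (rc d)) x (0, v)"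
  have y: "?y \<in> slice c d" using p by auto
  have "smooth_on (over c d) ?G"
    by (rule smooth_on_fderiv[OF RA.thick_overlap RA.smooth_transition]) (use c in auto)
  from has_derivative_fst[OF slice_has_derivative[OF c p this]]
  have "((\<lambda>y. fst (?G (0, y))) has_derivative (\<lambda>u. fst (fderiv (over c d) ?G (snd c p) (0, u)))) (at ?y within slice c d)" .
  moreover have "((\<lambda>y. fst (?G (0, y))) has_derivative (\<lambda>u. 0)) (at ?y within slice c d)"
  proof (rule has_derivative_transform[OF y _ has_derivative_const[of 0]])
    fix z assume "z \<in> slice c d"
    then obtain q where q: "q \<in> fst c" "q \<in> bd" "q \<in> fst d" "z = snd (snd c q)" by auto
    have "(0, z) = snd (rc c) q" using boundary_chart_pair[OF c(1) q(1,2)] q(4) by simp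
    then have "?G (0, z) = transition_deriv (rc c) (rc d) q (0, v)" by (simp add: transition_deriv_def)
    then show "fst (?G (0, z)) = 0" using transition_deriv_boundary[OF c q(1,3,2)] by simp
  qed
  ultimately show ?thesis using thick_fderiv_eq[OF thick_slice[OF c] y] by metis
qed

lemma fst_transition_deriv:
  assumes c: "c \<in> A" "d \<in> A" and p: "p \<in> fst c" "p \<in> fst d" "p \<in> bd"
  shows "fst (transition_deriv (rc c) (rc d) p w) = fst w * fst (transition_deriv (rc c) (rc d) p (1, 0))"
proof -
  let ?t = "transition_deriv (rc c) (rc d) p"
  have lin: "linear ?t" by (rule RA.linear_transition_deriv) (use c p in auto)
  have "w = fst w *\<^sub>R (1, 0) + (0, snd w)" by (simp add: prod_eq_iff)
  then have "?t w = fst w *\<^sub>R ?t (1, 0) + ?t (0, snd w)"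
    using linear_add[OF lin, of "fst w *\<^sub>R (1, 0)" "(0, snd w)"] linear_scale[OF lin, of "fst w" "(1, 0)"] by simp
  then show ?thesis by (simp add: transition_deriv_boundary[OF c p])
qed

text \<open>Transition maps preserve the half-space, so the derivative of an inward vector is not outward, and it is not
  tangential as the derivative is bijective.\<close>

lemma transition_deriv_inward:
  assumes c: "c \<in> A" "d \<in> A" and p: "p \<in> fst c" "p \<in> fst d" "p \<in> bd"
  shows "fst (transition_deriv (rc c) (rc d) p (1, 0)) > 0"
proof -
  let ?t = "transition_deriv (rc c) (rc d) p" and ?x = "snd c p" and ?\<tau> = "transition (rc c) (rc d)"
  have ne: "fst (?t (1, 0)) \<noteq> 0"
  proof
    assume z: "fst (?t (1, 0)) = 0"
    have "bij ?t" by (rule RA.bij_transition_deriv) (use c p in auto)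
    then obtain w where "?t w = (1, 0)" using bij_is_surj by (metis surjD)
    then show False using fst_transition_deriv[OF c p, of w] z by simp
  qed
  have "\<not> fst (?t (1, 0)) < 0"
  proof
    assume neg: "fst (?t (1, 0)) < 0"
    have sm: "smooth_on (over c d) ?\<tau>" by (rule RA.smooth_transition) (use c in auto)
    have xo: "?x \<in> over c d" using p by auto
    have th: "thick (over c d)" by (rule RA.thick_overlap) (use c in auto)
    obtain U F where U: "open U" "?x \<in> U" "\<And>k. Ck_on k U F" "\<And>y. y \<in> over c d \<Longrightarrow> y \<in> U \<Longrightarrow> F y = ?\<tau> y"
      "\<And>y. y \<in> over c d \<Longrightarrow> y \<in> U \<Longrightarrow> frechet_derivative F (at y) = fderiv (over c d) ?\<tau> y"
      using smooth_onE_fderiv[OF th sm xo] by metis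
    have F': "(F has_derivative ?t) (at ?x)"
      using Ck_on_SucD[OF U(3) U(2)] U(5)[OF xo U(2)] by (simp add: transition_deriv_def)
    have lin: "linear ?t" by (rule RA.linear_transition_deriv) (use c p in auto)
    define G where "G = (\<lambda>s. fst (F (?x + s *\<^sub>R (1, 0))))"
    have "((\<lambda>s. F (?x + s *\<^sub>R (1, 0))) has_derivative (\<lambda>s. ?t (s *\<^sub>R (1, 0)))) (at 0)"
    proof (rule has_derivative_compose[where g = F and g' = ?t and f = "\<lambda>s. ?x + s *\<^sub>R (1, 0)" and f' = "\<lambda>s. s *\<^sub>R (1, 0)"])
      show "(F has_derivative ?t) (at (?x + 0 *\<^sub>R (1, 0)))"
        using F' by (simp add: zero_prod_def[symmetric])
    qed (auto intro!: derivative_eq_intros)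
    from has_derivative_fst[OF this] have "(G has_derivative (\<lambda>s. fst (?t (s *\<^sub>R (1, 0))))) (at 0)"
      by (simp add: G_def)
    moreover have "(\<lambda>s. fst (?t (s *\<^sub>R (1, 0)))) = (*) (fst (?t (1, 0)))"
    proof
      fix s
      show "fst (?t (s *\<^sub>R (1, 0))) = fst (?t (1, 0)) * s"
        using fst_transition_deriv[OF c p, of "s *\<^sub>R (1, 0)"] by (simp add: mult.commute)
    qed
    ultimately have G': "(G has_real_derivative fst (?t (1, 0))) (at 0)"
      by (simp add: has_field_derivative_def)
    obtain \<delta> where \<delta>: "\<delta> > 0" "\<And>s. 0 < s \<Longrightarrow> s < \<delta> \<Longrightarrow> G (0 + s) < G 0"
      using DERIV_neg_dec_right[OF G' neg] by blast
    have "openin M (fst d \<inter> N)" using chart_facts(1)[OF c(2)] N by (rule openin_Int)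
    then obtain W where W: "open W" "snd c ` (fst c \<inter> (fst d \<inter> N)) = half_space \<inter> W"
      using image_open[OF c(1)] by blast
    have ov: "over c d = half_space \<inter> W" unfolding W(2)[symmetric] by auto
    have "?x \<in> W \<inter> U" using xo U(2) unfolding ov by blast
    then obtain r where r: "r > 0" "ball ?x r \<subseteq> W \<inter> U"
      using open_Int[OF W(1) U(1)] open_contains_ball by blast
    define s where "s = min \<delta> r / 2"
    have s: "0 < s" "s < \<delta>" "s < r" using \<delta>(1) r(1) by (auto simp: s_def)
    let ?z = "?x + s *\<^sub>R (1, 0)"
    have "dist ?x ?z = norm (s *\<^sub>R (1::real, 0::'e))" by (metis add_diff_cancel_left' dist_commute dist_norm)
    also have "\<dots> = s" using s(1) by (simp add: norm_prod_def)
    finally have "?z \<in> W \<inter> U" using r(2) s(3) by auto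
    moreover have "?z \<in> half_space"
      using s(1) boundary_chart_zero[OF c(1) p(1,3)] by (simp add: half_space_iff)
    ultimately have z: "?z \<in> over c d" "?z \<in> U" unfolding ov by auto
    have nn: "fst (?\<tau> w) \<ge> 0" if w: "w \<in> over c d" for w
    proof -
      obtain q where q: "q \<in> fst (rc c)" "q \<in> fst (rc d)" "w = snd (rc c) q" using w by blast
      have "?\<tau> w = snd (rc d) q" unfolding q(3) by (rule RA.transition_chart) (use c q in auto)
      then show ?thesis using chart_nonneg[OF c(2), of q] q(2) by simp
    qed
    have "?\<tau> (snd (rc c) p) = snd (rc d) p" by (rule RA.transition_chart) (use c p in auto)
    then have "G 0 = 0" using U(4)[OF xo U(2)] boundary_chart_zero[OF c(2) p(2,3)]
      by (simp add: G_def zero_prod_def[symmetric])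
    moreover have "G s \<ge> 0" using nn[OF z(1)] U(4)[OF z] by (simp add: G_def)
    ultimately show False using \<delta>(2)[OF s(1,2)] by simp
  qed
  with ne show ?thesis by linarith
qed

text \<open>The inclusion of the boundary has coordinate expression \<open>y \<mapsto> (0, y)\<close> in corresponding charts; \<open>differential\<close> uses an
  arbitrary chart at \<open>p\<close>, and the cocycle condition leads back to the given one.\<close>

lemma differential_inclusion:
  assumes c: "c \<in> A" and p: "p \<in> fst c" "p \<in> bd"
  shows "differential bdA nbA (\<lambda>q. q) p (tvec_of bdA (bchart c) p u) =
    tvec_of nbA (rc c) p (0, u)"
proof
  fix d'
  let ?v = "tvec_of bdA (bchart c) p u"
  show "differential bdA nbA (\<lambda>q. q) p ?v d' =
    tvec_of nbA (rc c) p (0, u) d'"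
  proof (cases "d' \<in> nbA \<and> p \<in> fst d'")
    case False
    then show ?thesis by (simp only: differential_def tvec_of_def if_not_P simp_thms)
  next
    case True
    then obtain d where d: "d \<in> A" "d' = rc d" "p \<in> fst d" by (auto simp: restrict_atlas_eq)
    define c0 where "c0 = some_chart bdA p"
    have "c0 \<in> bdA" "p \<in> fst c0"
      using BA.some_chart[OF bchart_in[OF c], of p] p by (simp_all add: c0_def)
    then obtain c1 where c1: "c1 \<in> A" "c0 = bchart c1" "p \<in> fst c1" by (auto simp: boundary_atlas_eq)
    have set: "snd c0 ` {q \<in> fst c0. q \<in> fst d'} = slice c1 d" by (auto simp: c1(2) d(2))
    have y: "snd c0 p \<in> slice c1 d" using c1 d p by auto
    have "((\<lambda>y. transition (rc c1) (rc d) (0, y)) has_derivative (\<lambda>u. transition_deriv (rc c1) (rc d) p (0, u)))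
        (at (snd c0 p) within slice c1 d)"
      using slice_has_derivative[OF c1(1) d(1) c1(3) d(3) p(2) RA.smooth_transition[OF rc_in[OF c1(1)] rc_in[OF d(1)]]]
      by (simp add: transition_deriv_def c1(2))
    then have "((snd d' \<circ> (\<lambda>q. q) \<circ> chart_inv c0) has_derivative (\<lambda>u. transition_deriv (rc c1) (rc d) p (0, u)))
        (at (snd c0 p) within slice c1 d)"
    proof (rule has_derivative_transform[OF y, rotated])
      fix z assume "z \<in> slice c1 d"
      then obtain q where q: "q \<in> fst c1" "q \<in> bd" "q \<in> fst d" "z = snd c0 q" by (auto simp: c1(2))
      have "chart_inv c0 (snd c0 q) = q"
        unfolding c1(2) by (rule BA.chart_inv_chart) (use c1 q in auto)
      moreover have "transition (rc c1) (rc d) (snd (rc c1) q) = snd (rc d) q"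
        by (rule RA.transition_chart) (use c1 q in auto)
      ultimately show "(snd d' \<circ> (\<lambda>q. q) \<circ> chart_inv c0) z = transition (rc c1) (rc d) (0, z)"
        using boundary_chart_pair[OF c1(1) q(1,2)] q(4) by (simp add: c1(2) d(2))
    qed
    then have fd: "frechet_derivative (snd d' \<circ> (\<lambda>q. q) \<circ> chart_inv c0) (at (snd c0 p) within slice c1 d) =
        (\<lambda>u. transition_deriv (rc c1) (rc d) p (0, u))"
      by (rule thick_fderiv_eq[OF thick_slice[OF c1(1) d(1)] y])
    have "differential bdA nbA (\<lambda>q. q) p ?v d' =
        transition_deriv (rc c1) (rc d) p (0, ?v c0)"
      using True unfolding differential_def Let_def c0_def[symmetric] set fd by simp
    also have "?v c0 = transition_deriv (bchart c) (bchart c1) p u"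
      using c1 p by (simp add: tvec_of_def)
    also have "(0, transition_deriv (bchart c) (bchart c1) p u) = transition_deriv (rc c) (rc c1) p (0, u)"
      by (rule transition_deriv_boundary[OF c c1(1) p(1) c1(3) p(2), symmetric])
    also have "transition_deriv (rc c1) (rc d) p (transition_deriv (rc c) (rc c1) p (0, u)) = transition_deriv (rc c) (rc d) p (0, u)"
      by (rule RA.transition_deriv_comp) (use c c1 d p in auto)
    finally show ?thesis using True by (simp add: tvec_of_def d(2))
  qed
qed

end

section \<open>Comparison of the boundary metric with the interior metric\<close>

text \<open>Matches the indexing of \<open>orthonormal_at\<close>, where the index 0 is the distinguished vector.\<close>

lemma enumeration_with_first:
  assumes K: "finite K" "a \<notin> K" "card K = k"
  obtains f :: "nat \<Rightarrow> 'a" where "f 0 = a" "bij_betw f {1..k} K" "inj_on f {..k}" "f ` {..k} = insert a K"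
proof -
  obtain f where f: "bij_betw f {1..k} K" using ex_bij_betw_nat_finite_1[OF K(1)] K(3) by auto
  define f' where "f' = f(0 := a)"
  have eq: "f' i = f i" if "i \<in> {1..k}" for i using that by (auto simp: f'_def)
  have bij: "bij_betw f' {1..k} K" using f bij_betw_cong[of "{1..k}" f' f K] eq by blast
  have ins: "{..k} = insert 0 {1..k}" by auto
  have img: "f' ` {1..k} = K" using bij by (rule bij_betw_imp_surj_on)
  have "inj_on f' (insert 0 {1..k})"
    unfolding inj_on_insert using bij_betw_imp_inj_on[OF bij] img K(2) by (auto simp: f'_def)
  then have "inj_on f' {..k}" unfolding ins .
  moreover have "f' ` {..k} = insert a K" unfolding ins image_insert img by (simp add: f'_def)
  moreover have "f' 0 = a" by (simp add: f'_def)
  ultimately show thesis using that bij by blast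
qed

locale boundary_metric = boundary_neighborhood M A N
  for M :: "'p topology" and A :: "('p, real \<times> 'e::euclidean_space) chart set" and N +
  fixes g and \<gamma>
  assumes g: "riemannian_metric nbA g"
    and \<gamma>: "riemannian_metric bdA \<gamma>"
    and induces: "induces_on_boundary A N g \<gamma>"
begin

sublocale R: riemannian_atlas "nbA" g
  by (intro riemannian_atlas.intro RA.thick_atlas_axioms riemannian_atlas_axioms.intro g)

sublocale B: riemannian_atlas "bdA" \<gamma>
  by (intro riemannian_atlas.intro BA.thick_atlas_axioms riemannian_atlas_axioms.intro \<gamma>)

abbreviation G where "G c \<equiv> metric_coord nbA g (rc c)"
abbreviation h where "h c \<equiv> metric_coord bdA \<gamma> (bchart c)"
abbreviation S where "S c \<equiv> chart_image (rc c)"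
abbreviation U where "U c \<equiv> chart_image (bchart c)"

lemma boundary_coordinate_cases:
  assumes c: "c \<in> A" and y: "y \<in> U c"
  obtains p where "p \<in> fst c" "p \<in> bd" "y = snd (snd c p)" "(0, y) = snd c p"
proof -
  obtain p where p: "p \<in> fst c" "p \<in> bd" "y = snd (snd c p)"
    using y by (auto simp: chart_image_def)
  then show thesis using that boundary_chart_pair[OF c p(1,2)] by simp
qed

text \<open>The hypothesis that \<open>g\<close> induces \<open>\<gamma>\<close>, in coordinates.\<close>

lemma hypersurface_chart:
  assumes c: "c \<in> A"
  shows "hypersurface (S c) (G c) (U c) (h c)"
proof -
  interpret G: metric_field "S c" "G c" by (rule R.metric_field_coord[OF rc_in[OF c]])
  interpret H: metric_field "U c" "h c" by (rule B.metric_field_coord[OF bchart_in[OF c]])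
  show ?thesis
  proof
    fix y assume "y \<in> U c"
    then obtain p where p: "p \<in> fst c" "p \<in> bd" "y = snd (snd c p)" "(0, y) = snd c p"
      using boundary_coordinate_cases[OF c] by metis
    have pr: "p \<in> fst (rc c)" and pb: "p \<in> fst (bchart c)" using p by auto
    show "(0, y) \<in> S c" unfolding p(4) chart_image_def using pr by auto
    fix u v
    let ?t = "tvec_of bdA (bchart c) p"
    note T = BA.tvec_of_in[OF bchart_in[OF c] pb]
    have "h c (snd (bchart c) p) u v = \<gamma> p (?t u) (?t v)"
      by (rule B.metric_coord_chart[OF bchart_in[OF c] pb])
    also have "\<dots> = pullback_metric bdA nbA (\<lambda>q. q) g p (?t u) (?t v)"
      using induces p(2) T unfolding induces_on_boundary_def by metis
    also have "\<dots> = G c (snd (rc c) p) (0, u) (0, v)"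
      unfolding pullback_metric_def differential_inclusion[OF c p(1,2)]
      by (rule R.metric_coord_chart[OF rc_in[OF c] pr, symmetric])
    finally show "h c y u v = G c (0, y) (0, u) (0, v)" using p(3,4) by simp
  qed
qed

abbreviation second where "second c \<equiv> hypersurface.second_form (S c) (G c)"
abbreviation shp where "shp c \<equiv> hypersurface.shape (S c) (G c) (h c)"

lemma inner_boundary: "c \<in> A \<Longrightarrow> p \<in> fst c \<Longrightarrow> p \<in> bd \<Longrightarrow> inner_form (h c (snd (snd c p)))"
  using metric_field.inner_form[OF B.metric_field_coord[OF bchart_in], of c "snd (snd c p)"]
  by (auto simp: chart_image_def)

text \<open>Gauss equation in an eigenbasis: the mixed terms of the second form vanish, and what separates the curvature
  sum of \<open>g\<close> from that of \<open>\<gamma>\<close> is a positive multiple of the product of eigenvalues.\<close>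

lemma eigenvalue_products_negative:
  assumes gt: "intermediate_ricci_gt nbA g k \<sigma>"
    and c: "c \<in> A" and p: "p \<in> fst c" "p \<in> bd"
    and e: "inner_form.orthonormal_basis (h c (snd (snd c p))) e"
    and diag: "\<And>i j. i < DIM('e) \<Longrightarrow> j < DIM('e) \<Longrightarrow> i \<noteq> j \<Longrightarrow> second c (snd (snd c p)) (e i) (e j) = 0"
    and a: "a < DIM('e)" and K: "K \<subseteq> {..<DIM('e)} - {a}" "card K = k"
    and le: "(\<Sum>i\<in>K. h c (snd (snd c p)) (B.curv (bchart c) (snd (snd c p)) (e a) (e i) (e i)) (e a)) \<le> \<sigma>"
  shows "second c (snd (snd c p)) (e a) (e a) * (\<Sum>i\<in>K. second c (snd (snd c p)) (e i) (e i)) < 0"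
proof -
  let ?y = "snd (snd c p)"
  interpret Y: hypersurface "S c" "G c" "U c" "h c" by (rule hypersurface_chart[OF c])
  interpret y: inner_form "h c ?y" by (rule inner_boundary[OF c p])
  have pr: "p \<in> fst (rc c)" using p by auto
  have yU: "?y \<in> U c" using p by (auto simp: chart_image_def)
  have x: "snd (rc c) p = (0, ?y)" using boundary_chart_pair[OF c p] by simp
  have orth: "h c ?y (e i) (e j) = (if i = j then 1 else 0)" if "i < DIM('e)" "j < DIM('e)" for i j
    by (rule y.orthonormal_basisD(1)[OF e that])
  obtain \<kappa> where \<kappa>: "\<kappa> > 0" "\<And>u v w z. G c (0, ?y) (Y.G.R (0, ?y) (0, u) (0, v) (0, w)) (0, z) =
    h c ?y (Y.H.R ?y u v w) z - \<kappa> * (second c ?y v w * second c ?y u z - second c ?y u w * second c ?y v z)"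
    using Y.gauss_equation[OF yU] by blast
  have "finite K" "a \<notin> K" using K(1) finite_subset by blast+
  then obtain f where f: "f 0 = a" "bij_betw f {1..k} K" "inj_on f {..k}" "f ` {..k} = insert a K"
    using enumeration_with_first[of K a k] K(2) by blast
  have fD: "f i < DIM('e)" if "i \<le> k" for i
    using that f(4) K(1) a by (metis (no_types, lifting) DiffD1 atMost_iff imageI insertE lessThan_iff subsetD)
  have finj: "f i = f j \<longleftrightarrow> i = j" if "i \<le> k" "j \<le> k" for i j
    using f(3) that by (auto dest: inj_onD)
  let ?E = "\<lambda>i. (0::real, e (f i))"
  have oG: "G c (snd (rc c) p) (?E i) (?E j) = (if i = j then 1 else 0)" if "i \<le> k" "j \<le> k" for i j
    unfolding x Y.induced[OF yU, symmetric] using orth[OF fD[OF that(1)] fD[OF that(2)]] finj[OF that] by simp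
  have "orthonormal_at nbA g p k (\<lambda>i. tvec_of nbA (rc c) p (?E i))"
    by (rule R.orthonormal_at_tvec_of[OF rc_in[OF c] pr oG])
  then have "\<sigma> < intermediate_ricci nbA g k p (\<lambda>i. tvec_of nbA (rc c) p (?E i))"
    using gt R.in_domain[OF rc_in[OF c] pr] unfolding intermediate_ricci_gt_def by blast
  also have "\<dots> = (\<Sum>i=1..k. G c (0, ?y) (Y.G.R (0, ?y) (?E 0) (?E i) (?E i)) (?E 0))"
    by (rule R.intermediate_ricci_tvec_of[OF rc_in[OF c] pr oG, unfolded x])
  also have "\<dots> = (\<Sum>i=1..k. (\<lambda>i. G c (0, ?y) (Y.G.R (0, ?y) (0, e a) (0, e i) (0, e i)) (0, e a)) (f i))"
    by (simp only: f(1))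
  also have "\<dots> = (\<Sum>i\<in>K. G c (0, ?y) (Y.G.R (0, ?y) (0, e a) (0, e i) (0, e i)) (0, e a))"
    by (rule sum.reindex_bij_betw[OF f(2)])
  also have "\<dots> = (\<Sum>i\<in>K. h c ?y (Y.H.R ?y (e a) (e i) (e i)) (e a) - \<kappa> * (second c ?y (e a) (e a) * second c ?y (e i) (e i)))"
  proof (intro sum.cong refl)
    fix i assume i: "i \<in> K"
    then have "second c ?y (e a) (e i) = 0" using K(1) a by (intro diag) auto
    then show "G c (0, ?y) (Y.G.R (0, ?y) (0, e a) (0, e i) (0, e i)) (0, e a) =
        h c ?y (Y.H.R ?y (e a) (e i) (e i)) (e a) - \<kappa> * (second c ?y (e a) (e a) * second c ?y (e i) (e i))"
      unfolding \<kappa>(2) by (simp add: mult.commute)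
  qed
  also have "\<dots> = (\<Sum>i\<in>K. h c ?y (Y.H.R ?y (e a) (e i) (e i)) (e a)) -
      \<kappa> * (second c ?y (e a) (e a) * (\<Sum>i\<in>K. second c ?y (e i) (e i)))"
    by (simp add: sum_subtractf sum_distrib_left mult.assoc)
  finally have "\<kappa> * (second c ?y (e a) (e a) * (\<Sum>i\<in>K. second c ?y (e i) (e i))) < 0"
    using le by linarith
  then show ?thesis using \<kappa>(1) by (simp add: mult_less_0_iff)
qed

lemma diagonal_basis_at:
  assumes c: "c \<in> A" and p: "p \<in> fst c" "p \<in> bd"
  obtains e where "inner_form.orthonormal_basis (h c (snd (snd c p))) e"
    "\<And>i j. i < DIM('e) \<Longrightarrow> j < DIM('e) \<Longrightarrow> i \<noteq> j \<Longrightarrow> second c (snd (snd c p)) (e i) (e j) = 0"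
proof -
  let ?y = "snd (snd c p)"
  interpret Y: hypersurface "S c" "G c" "U c" "h c" by (rule hypersurface_chart[OF c])
  interpret y: inner_form "h c ?y" by (rule inner_boundary[OF c p])
  have yU: "?y \<in> U c" using p by (auto simp: chart_image_def)
  show thesis
    using y.diagonal_basis[OF Y.bilinear_second_form[OF yU] Y.second_form_sym[OF yU]] that by blast
qed

lemma boundary_ricci_coord:
  assumes c: "c \<in> A" and p: "p \<in> fst c" "p \<in> bd"
    and orth: "\<And>i j. i \<le> k \<Longrightarrow> j \<le> k \<Longrightarrow> h c (snd (snd c p)) (e i) (e j) = (if i = j then 1 else 0)"
  shows "orthonormal_at bdA \<gamma> p k (\<lambda>i. tvec_of bdA (bchart c) p (e i))"
    and "intermediate_ricci bdA \<gamma> k p (\<lambda>i. tvec_of bdA (bchart c) p (e i)) =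
      (\<Sum>i=1..k. h c (snd (snd c p)) (B.curv (bchart c) (snd (snd c p)) (e 0) (e i) (e i)) (e 0))"
proof -
  have pb: "p \<in> fst (bchart c)" using p by auto
  have o: "h c (snd (bchart c) p) (e i) (e j) = (if i = j then 1 else 0)" if "i \<le> k" "j \<le> k" for i j
    using orth[OF that] by simp
  show "orthonormal_at bdA \<gamma> p k (\<lambda>i. tvec_of bdA (bchart c) p (e i))"
    by (rule B.orthonormal_at_tvec_of[OF bchart_in[OF c] pb o])
  show "intermediate_ricci bdA \<gamma> k p (\<lambda>i. tvec_of bdA (bchart c) p (e i)) =
      (\<Sum>i=1..k. h c (snd (snd c p)) (B.curv (bchart c) (snd (snd c p)) (e 0) (e i) (e i)) (e 0))"
    using B.intermediate_ricci_tvec_of[OF bchart_in[OF c] pb o] by simp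
qed

theorem no_extension_at_point:
  assumes k: "1 \<le> k" "k + 2 \<le> DIM('e)" and p: "p \<in> bd"
    and le: "intermediate_ricci_le_at bdA \<gamma> k p \<sigma>"
    and gt: "intermediate_ricci_gt nbA g k \<sigma>"
  shows False
proof -
  obtain c where c: "c \<in> A" "p \<in> fst c" using p by (auto simp: manifold_boundary_def)
  let ?y = "snd (snd c p)"
  obtain e where e: "inner_form.orthonormal_basis (h c ?y) e"
    and diag: "\<And>i j. i < DIM('e) \<Longrightarrow> j < DIM('e) \<Longrightarrow> i \<noteq> j \<Longrightarrow> second c ?y (e i) (e j) = 0"
    using diagonal_basis_at[OF c p] by metis
  interpret y: inner_form "h c ?y" by (rule inner_boundary[OF c p])
  show False
  proof (rule no_eigenvalues_with_negative_partial_sums[OF k, of "\<lambda>i. second c ?y (e i) (e i)"])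
    fix a K assume a: "a < DIM('e)" and K: "K \<subseteq> {..<DIM('e)} - {a}" "card K = k"
    have "finite K" "a \<notin> K" using K(1) finite_subset by blast+
    then obtain f where f: "f 0 = a" "bij_betw f {1..k} K" "inj_on f {..k}" "f ` {..k} = insert a K"
      using enumeration_with_first[of K a k] K(2) by blast
    have fD: "f i < DIM('e)" if "i \<le> k" for i
      using that f(4) K(1) a by (metis (no_types, lifting) DiffD1 atMost_iff imageI insertE lessThan_iff subsetD)
    have finj: "f i = f j \<longleftrightarrow> i = j" if "i \<le> k" "j \<le> k" for i j
      using f(3) that by (auto dest: inj_onD)
    have orth: "h c ?y (e (f i)) (e (f j)) = (if i = j then 1 else 0)" if "i \<le> k" "j \<le> k" for i j
      using y.orthonormal_basisD(1)[OF e fD[OF that(1)] fD[OF that(2)]] finj[OF that] by simp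
    have "(\<Sum>i\<in>K. h c ?y (B.curv (bchart c) ?y (e a) (e i) (e i)) (e a)) =
        (\<Sum>i=1..k. (\<lambda>i. h c ?y (B.curv (bchart c) ?y (e a) (e i) (e i)) (e a)) (f i))"
      by (rule sum.reindex_bij_betw[OF f(2), symmetric])
    also have "\<dots> = (\<Sum>i=1..k. h c ?y (B.curv (bchart c) ?y (e (f 0)) (e (f i)) (e (f i))) (e (f 0)))"
      by (simp only: f(1))
    also have "\<dots> \<le> \<sigma>"
    proof -
      note b = boundary_ricci_coord[OF c p, of k "\<lambda>i. e (f i)", OF orth]
      have "intermediate_ricci bdA \<gamma> k p (\<lambda>i. tvec_of bdA (bchart c) p (e (f i))) \<le> \<sigma>"
        using le b(1) unfolding intermediate_ricci_le_at_def by blast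
      then show ?thesis using b(2) by simp
    qed
    finally have le': "(\<Sum>i\<in>K. h c ?y (B.curv (bchart c) ?y (e a) (e i) (e i)) (e a)) \<le> \<sigma>" .
    show "second c ?y (e a) (e a) * (\<Sum>i\<in>K. second c ?y (e i) (e i)) < 0"
      by (rule eigenvalue_products_negative[OF gt c p e _ a K le']) (rule diag)
  qed
qed

text \<open>For \<open>k = DIM('e) - 1\<close> the set \<open>K\<close> consists of all other indices, and the curvature sum of \<open>\<gamma>\<close> is the Ricci curvature
  of \<open>e a\<close>, because the term with equal indices is zero.\<close>

lemma eigenvalue_signs:
  assumes dim: "DIM('e) \<ge> 2" and c: "c \<in> A" and p: "p \<in> fst c" "p \<in> bd"
    and le: "ricci_le bdA \<gamma> \<sigma>"
    and gt: "intermediate_ricci_gt nbA g (DIM('e) - 1) \<sigma>"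
    and e: "inner_form.orthonormal_basis (h c (snd (snd c p))) e"
    and diag: "\<And>i j. i < DIM('e) \<Longrightarrow> j < DIM('e) \<Longrightarrow> i \<noteq> j \<Longrightarrow> second c (snd (snd c p)) (e i) (e j) = 0"
  shows "\<And>a. a < DIM('e) \<Longrightarrow> second c (snd (snd c p)) (e a) (e a) \<noteq> 0"
    "\<exists>a<DIM('e). second c (snd (snd c p)) (e a) (e a) > 0" "\<exists>a<DIM('e). second c (snd (snd c p)) (e a) (e a) < 0"
proof -
  let ?y = "snd (snd c p)" and ?m = "DIM('e)"
  interpret Y: hypersurface "S c" "G c" "U c" "h c" by (rule hypersurface_chart[OF c])
  interpret y: inner_form "h c ?y" by (rule inner_boundary[OF c p])
  have yU: "?y \<in> U c" using p by (auto simp: chart_image_def)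
  have pb: "p \<in> fst (bchart c)" using p by auto
  note bc = bchart_in[OF c] pb
  have neg: "second c ?y (e a) (e a) * (\<Sum>i\<in>{..<?m} - {a}. second c ?y (e i) (e i)) < 0" if a: "a < ?m" for a
  proof (rule eigenvalue_products_negative[OF gt c p e diag a])
    let ?t = "\<lambda>i. tvec_of bdA (bchart c) p (e i)"
    note T = BA.tvec_of_in[OF bc]
    have "\<gamma> p (?t a) (?t a) = 1"
      using B.metric_coord_chart[OF bc, of "e a" "e a"] y.orthonormal_basisD(1)[OF e a a] by simp
    then have "ricci bdA \<gamma> p (?t a) (?t a) \<le> \<sigma>"
      using le B.in_domain[OF bc] T unfolding ricci_le_def by blast
    then have le': "ricci bdA \<gamma> p (?t a) (?t a) \<le> \<sigma>" .
    have e': "inner_form.orthonormal_basis (h c (snd (bchart c) p)) e" using e by simp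
    have "ricci bdA \<gamma> p (?t a) (?t a) =
        (\<Sum>i<?m. \<gamma> p (riemann bdA \<gamma> p (?t i) (?t a) (?t a)) (?t i))"
      by (rule B.ricci_trace[OF bc T T e'])
    also have "\<dots> = (\<Sum>i<?m. h c ?y (Y.H.R ?y (e a) (e i) (e i)) (e a))"
    proof (intro sum.cong refl)
      fix i
      have "\<gamma> p (riemann bdA \<gamma> p (?t i) (?t a) (?t a)) (?t i) =
          h c (snd (bchart c) p) (riemann bdA \<gamma> p (?t i) (?t a) (?t a) (bchart c)) (?t i (bchart c))"
        by (rule B.metric_via_coord[OF bc B.riemann_in[OF T T T] T])
      also have "\<dots> = h c ?y (Y.H.R ?y (e i) (e a) (e a)) (e i)"
        using c p by (simp add: riemann_def BA.tvec_of_chart[OF bc])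
      also have "\<dots> = h c ?y (Y.H.R ?y (e a) (e i) (e i)) (e a)"
        by (rule Y.H.curvature_pair_swap[OF yU])
      finally show "\<gamma> p (riemann bdA \<gamma> p (?t i) (?t a) (?t a)) (?t i) =
          h c ?y (Y.H.R ?y (e a) (e i) (e i)) (e a)" .
    qed
    also have "\<dots> = h c ?y (Y.H.R ?y (e a) (e a) (e a)) (e a) + (\<Sum>i\<in>{..<?m} - {a}. h c ?y (Y.H.R ?y (e a) (e i) (e i)) (e a))"
      using a by (intro sum.remove) auto
    also have "h c ?y (Y.H.R ?y (e a) (e a) (e a)) (e a) = 0"
      by (simp add: curvature_coord_def)
    finally show "(\<Sum>i\<in>{..<?m} - {a}. h c ?y (Y.H.R ?y (e a) (e i) (e i)) (e a)) \<le> \<sigma>"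
      using le' by simp
  qed (use a in auto)
  show "\<And>a. a < ?m \<Longrightarrow> second c ?y (e a) (e a) \<noteq> 0"
    "\<exists>a<?m. second c ?y (e a) (e a) > 0" "\<exists>a<?m. second c ?y (e a) (e a) < 0"
    using eigenvalues_of_both_signs[OF dim, of "\<lambda>a. second c ?y (e a) (e a)"] neg by blast+
qed

text \<open>The factor \<open>\<mu>\<close> is the transversal component of the derivative of the transition map.\<close>

lemma second_form_transition:
  assumes c: "c \<in> A" "d \<in> A" and p: "p \<in> fst c" "p \<in> fst d" "p \<in> bd"
  obtains \<mu> where "\<mu> > 0" "\<And>u v. second d (snd (snd d p)) (transition_deriv (bchart c) (bchart d) p u)
      (transition_deriv (bchart c) (bchart d) p v) = \<mu> * second c (snd (snd c p)) u v"
proof (rule that[OF transition_deriv_inward[OF c p]])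
  fix u v
  let ?t = "transition_deriv (bchart c) (bchart d) p" and ?T = "transition_deriv (rc c) (rc d) p"
  interpret C: hypersurface "S c" "G c" "U c" "h c" by (rule hypersurface_chart[OF c(1)])
  interpret D: hypersurface "S d" "G d" "U d" "h d" by (rule hypersurface_chart[OF c(2)])
  have x: "snd (rc c) p = (0, snd (snd c p))" "snd (rc d) p = (0, snd (snd d p))"
    using boundary_chart_pair[OF c(1) p(1,3)] boundary_chart_pair[OF c(2) p(2,3)] by simp_all
  have "?T (R.chris (rc c) (snd (rc c) p) (0, u) (0, v)) =
      fderiv (over c d) (\<lambda>x. fderiv (over c d) (transition (rc c) (rc d)) x (0, v)) (snd (rc c) p) (0, u)
      + R.chris (rc d) (snd (rc d) p) (?T (0, u)) (?T (0, v))"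
    by (rule R.christoffel_transition) (use c p in auto)
  from arg_cong[OF this, of fst]
  have "fst (?T (R.chris (rc c) (snd (rc c) p) (0, u) (0, v))) =
      fst (fderiv (over c d) (\<lambda>x. fderiv (over c d) (transition (rc c) (rc d)) x (0, v)) (snd (rc c) p) (0, u))
      + fst (R.chris (rc d) (snd (rc d) p) (0, ?t u) (0, ?t v))"
    unfolding transition_deriv_boundary[OF c p] fst_add .
  also have "fst (fderiv (over c d) (\<lambda>x. fderiv (over c d) (transition (rc c) (rc d)) x (0, v)) (snd (rc c) p) (0, u)) = 0"
    using second_transition_deriv_boundary[OF c p, of v u] by simp
  also have "fst (?T (R.chris (rc c) (snd (rc c) p) (0, u) (0, v))) =
      fst (R.chris (rc c) (snd (rc c) p) (0, u) (0, v)) * fst (?T (1, 0))"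
    by (rule fst_transition_deriv[OF c p])
  finally show "second d (snd (snd d p)) (?t u) (?t v) = fst (?T (1, 0)) * second c (snd (snd c p)) u v"
    unfolding C.second_form_def D.second_form_def x by (simp only: mult.commute add_0)
qed

lemma eigen_span_transition:
  assumes c: "c \<in> A" "d \<in> A" and p: "p \<in> fst c" "p \<in> fst d" "p \<in> bd"
  shows "eigen_span (shp d (snd (snd d p))) \<sigma> = transition_deriv (bchart c) (bchart d) p ` eigen_span (shp c (snd (snd c p))) \<sigma>"
proof -
  let ?t = "transition_deriv (bchart c) (bchart d) p" and ?x = "snd (snd c p)" and ?z = "snd (snd d p)"
  interpret C: hypersurface "S c" "G c" "U c" "h c" by (rule hypersurface_chart[OF c(1)])
  interpret D: hypersurface "S d" "G d" "U d" "h d" by (rule hypersurface_chart[OF c(2)])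
  have x: "?x \<in> U c" and z: "?z \<in> U d" using p by (auto simp: chart_image_def)
  have pc: "p \<in> fst (bchart c)" and pd: "p \<in> fst (bchart d)" using p by auto
  note tr = bchart_in[OF c(1)] bchart_in[OF c(2)] pc pd
  have lin: "linear ?t" by (rule BA.linear_transition_deriv[OF tr])
  have bij: "bij ?t" by (rule BA.bij_transition_deriv[OF tr])
  obtain \<mu> where \<mu>: "\<mu> > 0" "\<And>u v. second d ?z (?t u) (?t v) = \<mu> * second c ?x u v"
    using second_form_transition[OF c p] by metis
  have iso: "h d ?z (?t a) (?t b) = h c ?x a b" for a b
    using B.metric_coord_chart[OF tr(1,3), of a b] B.metric_coord_chart[OF tr(2,4), of "?t a" "?t b"]
    by (simp add: BA.tvec_of_change[OF tr])
  have shape: "shp d ?z (?t v) = \<mu> *\<^sub>R ?t (shp c ?x v)" for v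
  proof (rule D.H.heqI[OF z])
    fix w'
    obtain w where w: "w' = ?t w" using bij_is_surj[OF bij] by (metis surjD)
    show "h d ?z (shp d ?z (?t v)) w' = h d ?z (\<mu> *\<^sub>R ?t (shp c ?x v)) w'"
      by (simp add: w D.shape_eq[OF z] \<mu>(2) linear_scale[OF D.H.linear_left[OF z]] iso C.shape_eq[OF x])
  qed
  have "{v. \<exists>l>0. shp d ?z v = (\<sigma> * l) *\<^sub>R v} = ?t ` {v. \<exists>l>0. shp c ?x v = (\<sigma> * l) *\<^sub>R v}"
  proof (intro equalityI subsetI)
    fix v' assume "v' \<in> {v. \<exists>l>0. shp d ?z v = (\<sigma> * l) *\<^sub>R v}"
    then obtain l where l: "l > 0" "shp d ?z v' = (\<sigma> * l) *\<^sub>R v'" by blast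
    obtain v where v: "v' = ?t v" using bij_is_surj[OF bij] by (metis surjD)
    have "?t (shp c ?x v) = (1 / \<mu>) *\<^sub>R (\<mu> *\<^sub>R ?t (shp c ?x v))" using \<mu>(1) by simp
    also have "\<dots> = (1 / \<mu>) *\<^sub>R ((\<sigma> * l) *\<^sub>R ?t v)" using l(2) by (simp only: shape[symmetric] v)
    also have "\<dots> = ?t ((\<sigma> * (l / \<mu>)) *\<^sub>R v)" by (simp add: linear_scale[OF lin])
    finally have "shp c ?x v = (\<sigma> * (l / \<mu>)) *\<^sub>R v" using bij_is_inj[OF bij] by (simp add: injD)
    moreover have "l / \<mu> > 0" using l(1) \<mu>(1) by simp
    ultimately show "v' \<in> ?t ` {v. \<exists>l>0. shp c ?x v = (\<sigma> * l) *\<^sub>R v}" unfolding v by blast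
  next
    fix v' assume "v' \<in> ?t ` {v. \<exists>l>0. shp c ?x v = (\<sigma> * l) *\<^sub>R v}"
    then obtain v l where v: "v' = ?t v" "l > 0" "shp c ?x v = (\<sigma> * l) *\<^sub>R v" by blast
    have "shp d ?z v' = (\<sigma> * (\<mu> * l)) *\<^sub>R v'"
      by (simp add: v(1) shape v(3) linear_scale[OF lin] mult_ac)
    then show "v' \<in> {v. \<exists>l>0. shp d ?z v = (\<sigma> * l) *\<^sub>R v}" using v(2) \<mu>(1) by (auto intro!: exI[of _ "\<mu> * l"])
  qed
  then show ?thesis unfolding eigen_span_def by (simp add: linear_span_image[OF lin])
qed

text \<open>Defined through an arbitrary chart at each point; \<open>eigen_bundle_chart\<close> shows that every other chart gives the same space.\<close>

definition eigen_bundle :: "real \<Rightarrow> 'p \<Rightarrow> ('p, 'e) tvec set" where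
  "eigen_bundle \<sigma> p = (let c = SOME c. c \<in> A \<and> p \<in> fst c
     in tvec_of bdA (bchart c) p ` eigen_span (shp c (snd (snd c p))) \<sigma>)"

lemma eigen_bundle_chart:
  assumes c: "c \<in> A" and p: "p \<in> fst c" "p \<in> bd"
  shows "eigen_bundle \<sigma> p = tvec_of bdA (bchart c) p ` eigen_span (shp c (snd (snd c p))) \<sigma>"
proof -
  define d where "d = (SOME d. d \<in> A \<and> p \<in> fst d)"
  have "d \<in> A \<and> p \<in> fst d" unfolding d_def by (rule someI[of _ c]) (use c p in simp)
  then have d: "d \<in> A" "p \<in> fst d" by auto
  have tr: "bchart c \<in> bdA" "bchart d \<in> bdA" "p \<in> fst (bchart c)" "p \<in> fst (bchart d)"
    using c d p by auto
  show ?thesis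
    unfolding eigen_bundle_def Let_def d_def[symmetric] eigen_span_transition[OF c d(1) p(1) d(2) p(2)] image_image
      BA.tvec_of_change[OF tr] ..
qed

text \<open>The one missing property is injectivity of the shape operator, that is, nonzero eigenvalues.\<close>

lemma selfadjoint_shape:
  assumes dim: "DIM('e) \<ge> 2" and le: "ricci_le bdA \<gamma> \<sigma>"
    and gt: "intermediate_ricci_gt nbA g (DIM('e) - 1) \<sigma>" and c: "c \<in> A"
  shows "selfadjoint_family (U c) (h c) (shp c)"
proof -
  interpret Y: hypersurface "S c" "G c" "U c" "h c" by (rule hypersurface_chart[OF c])
  show ?thesis
  proof (rule selfadjoint_family.intro)
    have "U c = snd (bchart c) ` (fst c \<inter> bd \<inter> topspace M)"
      using chart_facts(4)[OF c] by (auto simp: chart_image_def)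
    then show "open (U c)" using boundary_image_open[OF c openin_topspace] by simp
    show "smooth_on (U c) (\<lambda>y. h c y u v)" for u v by (rule Y.H.smooth)
    show "smooth_on (U c) (\<lambda>y. shp c y v)" for v by (rule Y.smooth_shape)
    fix y assume y: "y \<in> U c"
    show inner: "inner_form (h c y)" by (rule Y.H.inner_form[OF y])
    show lin: "linear (shp c y)" by (rule Y.linear_shape[OF y])
    show adj: "h c y (shp c y u) v = h c y u (shp c y v)" for u v by (rule Y.shape_adjoint[OF y])
    interpret y: inner_form "h c y" by (rule inner)
    obtain p where p: "p \<in> fst c" "p \<in> bd" "y = snd (snd c p)" using boundary_coordinate_cases[OF c y] by metis
    obtain e where e: "y.orthonormal_basis e"
      and diag: "\<And>i j. i < DIM('e) \<Longrightarrow> j < DIM('e) \<Longrightarrow> i \<noteq> j \<Longrightarrow> second c y (e i) (e j) = 0"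
      using diagonal_basis_at[OF c p(1,2)] unfolding p(3) by metis
    have nz: "second c y (e a) (e a) \<noteq> 0" if "a < DIM('e)" for a
      using eigenvalue_signs(1)[OF dim c p(1,2) le gt, of e a] e diag that unfolding p(3) by blast
    show "inj (shp c y)"
      unfolding linear_injective_0[OF lin]
    proof (intro allI impI)
      fix v assume v: "shp c y v = 0"
      have "h c y v (e j) = 0" if j: "j < DIM('e)" for j
      proof -
        have lin2: "linear (\<lambda>v. second c y v (e j))" by (rule Y.linear_second_form_left[OF y])
        have "second c y v (e j) = second c y (\<Sum>i<DIM('e). h c y v (e i) *\<^sub>R e i) (e j)"
          using y.orthonormal_basisD(2)[OF e, of v] by (rule arg_cong)
        also have "\<dots> = (\<Sum>i<DIM('e). h c y v (e i) *\<^sub>R second c y (e i) (e j))"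
          by (simp only: linear_sum[OF lin2] linear_scale[OF lin2])
        also have "\<dots> = (\<Sum>i<DIM('e). if i = j then h c y v (e j) * second c y (e j) (e j) else 0)"
          using diag[of _ j] j by (intro sum.cong refl) auto
        also have "\<dots> = h c y v (e j) * second c y (e j) (e j)" using j by simp
        finally have "second c y v (e j) = h c y v (e j) * second c y (e j) (e j)" .
        moreover have "second c y v (e j) = 0" using Y.shape_eq[OF y, of v "e j"] v by simp
        ultimately show ?thesis using nz[OF j] by simp
      qed
      then have "(\<Sum>i<DIM('e). h c y v (e i) *\<^sub>R e i) = 0" by simp
      then show "v = 0" using y.orthonormal_basisD(2)[OF e, of v] by metis
    qed
  qed
qed

lemma eigen_span_nontrivial:
  assumes dim: "DIM('e) \<ge> 2" and le: "ricci_le bdA \<gamma> \<sigma>"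
    and gt: "intermediate_ricci_gt nbA g (DIM('e) - 1) \<sigma>"
    and c: "c \<in> A" and p: "p \<in> fst c" "p \<in> bd" and \<tau>: "\<tau> = 1 \<or> \<tau> = -1"
  obtains v where "v \<in> eigen_span (shp c (snd (snd c p))) \<tau>" "v \<noteq> 0"
proof -
  let ?y = "snd (snd c p)"
  interpret Y: hypersurface "S c" "G c" "U c" "h c" by (rule hypersurface_chart[OF c])
  interpret y: inner_form "h c ?y" by (rule inner_boundary[OF c p])
  have y: "?y \<in> U c" using p by (auto simp: chart_image_def)
  obtain e where e: "y.orthonormal_basis e"
    and diag: "\<And>i j. i < DIM('e) \<Longrightarrow> j < DIM('e) \<Longrightarrow> i \<noteq> j \<Longrightarrow> second c ?y (e i) (e j) = 0"
    using diagonal_basis_at[OF c p] by metis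
  have ev: "shp c ?y (e a) = second c ?y (e a) (e a) *\<^sub>R e a" if a: "a < DIM('e)" for a
  proof -
    have "shp c ?y (e a) = (\<Sum>i<DIM('e). h c ?y (shp c ?y (e a)) (e i) *\<^sub>R e i)"
      by (rule y.orthonormal_basisD(2)[OF e])
    also have "\<dots> = (\<Sum>i<DIM('e). if i = a then second c ?y (e a) (e a) *\<^sub>R e a else 0)"
      using diag[OF a] by (intro sum.cong refl) (auto simp: Y.shape_eq[OF y])
    finally show ?thesis using a by simp
  qed
  obtain a where a: "a < DIM('e)" "\<tau> * second c ?y (e a) (e a) > 0"
    using eigenvalue_signs(2,3)[OF dim c p le gt e diag] \<tau> by auto
  have "shp c ?y (e a) = (\<tau> * (\<tau> * second c ?y (e a) (e a))) *\<^sub>R e a" using ev[OF a(1)] \<tau> by auto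
  then have "e a \<in> eigen_span (shp c ?y) \<tau>"
    unfolding eigen_span_def using a(2) by (intro span_base) blast
  then show thesis using that y.orthonormal_basis_nonzero[OF e a(1)] by blast
qed

text \<open>In another chart the components arise by the derivative of the transition map, a smooth family of linear maps.\<close>

lemma smooth_vector_field_tvec_of:
  assumes c: "c \<in> A" and W: "W \<subseteq> U c" and Y: "smooth_on W Y"
  shows "smooth_vector_field_on bdA {q \<in> fst c \<inter> bd. snd (snd c q) \<in> W}
    (\<lambda>q. tvec_of bdA (bchart c) q (Y (snd (snd c q))))"
  unfolding smooth_vector_field_on_def
proof (intro conjI ballI)
  let ?V = "{q \<in> fst c \<inter> bd. snd (snd c q) \<in> W}" and ?b = "bchart c"
  have b: "?b \<in> bdA" using c by simp
  show "tvec_of bdA ?b q (Y (snd (snd c q))) \<in> tangent_space bdA q" if "q \<in> ?V" for q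
    by (rule BA.tvec_of_in[OF b]) (use that in auto)
  fix d assume d: "d \<in> bdA"
  let ?O = "snd ?b ` (fst ?b \<inter> fst d)" and ?P = "snd d ` (fst d \<inter> ?V)"
  let ?T = "\<lambda>x. fderiv ?O (transition ?b d) x"
  have sT: "smooth_on ?O (\<lambda>x. ?T x u)" for u
    by (rule smooth_on_fderiv[OF BA.thick_overlap[OF b d] BA.smooth_transition[OF b d]])
  have lT: "linear (?T x)" if "x \<in> ?O" for x
    by (rule linear_fderiv[OF BA.smooth_transition[OF b d] that])
  have tr: "transition d ?b (snd d q) = snd (snd c q)" if "q \<in> fst d" "q \<in> ?V" for q
    using BA.transition_chart[OF d that(1), of ?b] by simp
  have sub: "transition d ?b ` ?P \<subseteq> ?O \<inter> W"
  proof
    fix z assume "z \<in> transition d ?b ` ?P"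
    then obtain q where q: "q \<in> fst d" "q \<in> ?V" "z = transition d ?b (snd d q)" by blast
    then have "z = snd ?b q" using tr[OF q(1,2)] by simp
    then show "z \<in> ?O \<inter> W" using q(1,2) by auto
  qed
  have "smooth_on (?O \<inter> W) (\<lambda>x. ?T x (Y x))"
  proof (rule smooth_on_linear_family[where T = ?T and V = Y])
    show "linear (?T x)" if "x \<in> ?O \<inter> W" for x by (rule lT) (use that in blast)
    show "smooth_on (?O \<inter> W) (\<lambda>x. ?T x u)" for u by (rule smooth_on_subset[OF sT Int_lower1])
    show "smooth_on (?O \<inter> W) Y" by (rule smooth_on_subset[OF Y Int_lower2])
  qed
  moreover have "smooth_on ?P (transition d ?b)"
    by (rule smooth_on_subset[OF BA.smooth_transition[OF d b]]) auto
  ultimately have "smooth_on ?P (\<lambda>x. ?T (transition d ?b x) (Y (transition d ?b x)))"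
    using sub by (rule smooth_on_compose)
  then show "smooth_on ?P (\<lambda>x. tvec_of bdA ?b (chart_inv d x) (Y (snd (snd c (chart_inv d x)))) d)"
  proof (rule smooth_on_cong)
    fix x assume "x \<in> ?P"
    then obtain q where q: "q \<in> fst d" "q \<in> ?V" "x = snd d q" by blast
    have "tvec_of bdA ?b q (Y (snd (snd c q))) d = transition_deriv ?b d q (Y (snd (snd c q)))"
      using d q(1) by (simp add: tvec_of_def)
    also have "\<dots> = ?T (snd ?b q) (Y (snd (snd c q)))" by (simp add: transition_deriv_def)
    finally show "?T (transition d ?b x) (Y (transition d ?b x)) =
        tvec_of bdA ?b (chart_inv d x) (Y (snd (snd c (chart_inv d x)))) d"
      using tr[OF q(1,2)] BA.chart_inv_chart[OF d q(1)] q(3) by simp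
  qed
qed

lemma openin_boundary_preimage:
  assumes c: "c \<in> A" and W: "open W"
  shows "openin (subtopology M bd) {q \<in> fst c \<inter> bd. snd (snd c q) \<in> W}"
proof -
  have "continuous_map (subtopology M (fst c)) (top_of_set (chart_image c)) (snd c)"
    using homeomorphic_imp_continuous_map[OF chart_facts(3)[OF c]] .
  then have cm: "continuous_map (subtopology M (fst c)) euclidean (snd c)"
    by (simp add: continuous_map_in_subtopology)
  have "open (snd -` W :: (real \<times> 'e) set)" using W by (intro open_vimage continuous_intros)
  then have "openin (subtopology M (fst c)) {q \<in> topspace (subtopology M (fst c)). snd c q \<in> snd -` W}"
    using cm by (intro openin_continuous_map_preimage) auto
  also have "{q \<in> topspace (subtopology M (fst c)). snd c q \<in> snd -` W} = {q \<in> fst c. snd (snd c q) \<in> W}"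
    using chart_facts(4)[OF c] by auto
  finally have "openin M {q \<in> fst c. snd (snd c q) \<in> W}"
    by (rule openin_trans_full[OF _ chart_facts(1)[OF c]])
  then have "openin (subtopology M bd) (bd \<inter> {q \<in> fst c. snd (snd c q) \<in> W})" by (rule openin_subtopology_Int2)
  also have "bd \<inter> {q \<in> fst c. snd (snd c q) \<in> W} = {q \<in> fst c \<inter> bd. snd (snd c q) \<in> W}" by auto
  finally show ?thesis .
qed

theorem boundary_tangent_bundle_splits:
  assumes dim: "DIM('e) \<ge> 2" and le: "ricci_le bdA \<gamma> \<sigma>"
    and gt: "intermediate_ricci_gt nbA g (DIM('e) - 1) \<sigma>"
  shows "tangent_bundle_splits (subtopology M bd) bdA"
proof -
  note fam = selfadjoint_shape[OF dim le gt]
  have chart: "\<exists>c\<in>A. p \<in> fst c" if "p \<in> bd" for p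
    using that by (auto simp: manifold_boundary_def)
  have sub: "smooth_subbundle (subtopology M bd) bdA (eigen_bundle \<tau>)" if \<tau>: "\<tau> = 1 \<or> \<tau> = -1" for \<tau>
    unfolding smooth_subbundle_def
  proof
    fix p assume "p \<in> topspace (subtopology M bd)"
    then have p: "p \<in> bd" by simp
    obtain c where c: "c \<in> A" "p \<in> fst c" using chart[OF p] by blast
    interpret F: selfadjoint_family "U c" "h c" "shp c" by (rule fam[OF c(1)])
    have y: "snd (snd c p) \<in> U c" using c p by (auto simp: chart_image_def)
    obtain W and r :: nat and Y where W: "open W" "snd (snd c p) \<in> W" "W \<subseteq> U c" "\<And>i. smooth_on W (Y i)"
      and Yi: "\<And>y. y \<in> W \<Longrightarrow> inj_on (\<lambda>i. Y i y) {..<r}" "\<And>y. y \<in> W \<Longrightarrow> independent ((\<lambda>i. Y i y) ` {..<r})"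
        "\<And>y. y \<in> W \<Longrightarrow> eigen_span (shp c y) \<tau> = span ((\<lambda>i. Y i y) ` {..<r})"
      using F.eigen_span_frame[OF y \<tau>] by metis
    let ?V = "{q \<in> fst c \<inter> bd. snd (snd c q) \<in> W}"
    let ?t = "\<lambda>q. tvec_of bdA (bchart c) q"
    let ?Y = "\<lambda>i q. ?t q (Y i (snd (snd c q)))"
    show "\<exists>V (r::nat) Y. openin (subtopology M bd) V \<and> p \<in> V \<and>
        (\<forall>i<r. smooth_vector_field_on bdA V (Y i)) \<and>
        (\<forall>q\<in>V. inj_on (\<lambda>i. Y i q) {..<r} \<and> independent ((\<lambda>i. Y i q) ` {..<r}) \<and>
           eigen_bundle \<tau> q = span ((\<lambda>i. Y i q) ` {..<r}))"
    proof (intro exI[of _ ?V] exI[of _ r] exI[of _ ?Y] conjI allI impI ballI)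
      show "openin (subtopology M bd) ?V" by (rule openin_boundary_preimage[OF c(1) W(1)])
      show "p \<in> ?V" using c p W(2) by simp
      show "smooth_vector_field_on bdA ?V (?Y i)" for i
        by (rule smooth_vector_field_tvec_of[OF c(1) W(3,4)])
      fix q assume q: "q \<in> ?V"
      then have qc: "q \<in> fst c" "q \<in> bd" "snd (snd c q) \<in> W" by auto
      have qb: "bchart c \<in> bdA" "q \<in> fst (bchart c)" using c qc by auto
      have lin: "linear (?t q)" and inj: "inj (?t q)"
        by (rule BA.linear_tvec_of[OF qb], rule BA.inj_tvec_of[OF qb])
      have img: "(\<lambda>i. ?Y i q) ` {..<r} = ?t q ` ((\<lambda>i. Y i (snd (snd c q))) ` {..<r})" by (simp add: image_image)
      show "inj_on (\<lambda>i. ?Y i q) {..<r}"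
        using Yi(1)[OF qc(3)] inj by (auto simp: inj_on_def)
      show "independent ((\<lambda>i. ?Y i q) ` {..<r})"
        unfolding img by (rule linear_independent_injective_image[OF lin Yi(2)[OF qc(3)]]) (rule inj_on_subset[OF inj], simp)
      show "eigen_bundle \<tau> q = span ((\<lambda>i. ?Y i q) ` {..<r})"
        unfolding img eigen_bundle_chart[OF c(1) qc(1,2)] Yi(3)[OF qc(3)] by (rule linear_span_image[OF lin, symmetric])
    qed
  qed
  show ?thesis
    unfolding tangent_bundle_splits_def
  proof (rule exI[of _ "eigen_bundle 1"], rule exI[of _ "eigen_bundle (-1)"], intro conjI ballI)
    show "smooth_subbundle (subtopology M bd) bdA (eigen_bundle 1)" by (rule sub) simp
    show "smooth_subbundle (subtopology M bd) bdA (eigen_bundle (-1))" by (rule sub) simp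
    fix p assume "p \<in> topspace (subtopology M bd)"
    then have p: "p \<in> bd" by simp
    obtain c where c: "c \<in> A" "p \<in> fst c" using chart[OF p] by blast
    interpret F: selfadjoint_family "U c" "h c" "shp c" by (rule fam[OF c(1)])
    let ?y = "snd (snd c p)" and ?t = "tvec_of bdA (bchart c) p"
    have y: "?y \<in> U c" using c p by (auto simp: chart_image_def)
    have pb: "bchart c \<in> bdA" "p \<in> fst (bchart c)" using c p by auto
    have lin: "linear ?t" and inj: "inj ?t"
      by (rule BA.linear_tvec_of[OF pb], rule BA.inj_tvec_of[OF pb])
    note eb = eigen_bundle_chart[OF c p]
    have "eigen_bundle 1 p \<inter> eigen_bundle (-1) p = ?t ` {0}"
      unfolding eb image_Int[OF inj, symmetric] F.eigen_span_Int[OF y] ..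
    then show "eigen_bundle 1 p \<inter> eigen_bundle (-1) p = {0}" using linear_0[OF lin] by simp
    show "tangent_space bdA p = {u + v |u v. u \<in> eigen_bundle 1 p \<and> v \<in> eigen_bundle (-1) p}"
    proof (intro equalityI subsetI)
      fix w assume "w \<in> tangent_space bdA p"
      then obtain z where z: "w = ?t z" unfolding BA.tangent_space_eq_range[OF pb] by blast
      obtain u v where "u \<in> eigen_span (shp c ?y) 1" "v \<in> eigen_span (shp c ?y) (-1)" "z = u + v"
        using F.eigen_span_sum[OF y] by metis
      then show "w \<in> {u + v |u v. u \<in> eigen_bundle 1 p \<and> v \<in> eigen_bundle (-1) p}"
        unfolding eb z using linear_add[OF lin] by blast
    next
      fix w assume "w \<in> {u + v |u v. u \<in> eigen_bundle 1 p \<and> v \<in> eigen_bundle (-1) p}"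
      then obtain u v where "w = ?t u + ?t v" unfolding eb by blast
      then show "w \<in> tangent_space bdA p"
        unfolding BA.tangent_space_eq_range[OF pb] using linear_add[OF lin, of u v] by (metis rangeI)
    qed
    have ne: "eigen_bundle \<tau> p \<noteq> {0}" if \<tau>: "\<tau> = 1 \<or> \<tau> = -1" for \<tau>
    proof -
      obtain v where v: "v \<in> eigen_span (shp c ?y) \<tau>" "v \<noteq> 0"
        using eigen_span_nontrivial[OF dim le gt c p \<tau>] by metis
      have "?t v \<noteq> 0" using v(2) inj linear_0[OF lin] by (metis injD)
      then show ?thesis unfolding eb using v(1) by blast
    qed
    show "eigen_bundle 1 p \<noteq> {0}" "eigen_bundle (-1) p \<noteq> {0}" by (rule ne; simp)+
  qed
qed

end

theorem theorem1p5:
  fixes M :: "'p topology"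
    and A :: "('p, real \<times> 'e::euclidean_space) chart set"
    and n :: nat and \<sigma> :: real
  assumes manifold: "smooth_manifold_with_boundary M A"
    and compact: "compact_space M"
    and dim: "n = DIM(real \<times> 'e)"
  shows
    "(n \<ge> 4 \<longrightarrow> (\<forall>k \<gamma>. 1 \<le> k \<and> k \<le> n - 3 \<and>
        riemannian_metric (boundary_atlas A) \<gamma> \<and>
        (\<exists>p\<in>manifold_boundary A. intermediate_ricci_le_at (boundary_atlas A) \<gamma> k p \<sigma>) \<longrightarrow>
        \<not> (\<exists>N g. collar_neighborhood M A N \<and>
              riemannian_metric (restrict_atlas N A) g \<and>
              intermediate_ricci_gt (restrict_atlas N A) g k \<sigma> \<and>
              induces_on_boundary A N g \<gamma>)))
     \<and>
     (n \<ge> 3 \<longrightarrow> (\<forall>\<gamma>. riemannian_metric (boundary_atlas A) \<gamma> \<and>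
        ricci_le (boundary_atlas A) \<gamma> \<sigma> \<and>
        (\<exists>N g. collar_neighborhood M A N \<and>
              riemannian_metric (restrict_atlas N A) g \<and>
              intermediate_ricci_gt (restrict_atlas N A) g (n - 2) \<sigma> \<and>
              induces_on_boundary A N g \<gamma>) \<longrightarrow>
        tangent_bundle_splits (subtopology M (manifold_boundary A)) (boundary_atlas A)))"
proof -
  have n: "n = Suc DIM('e)" using dim by simp
  have bm: "boundary_metric M A N g \<gamma>"
    if N: "collar_neighborhood M A N" and g: "riemannian_metric (restrict_atlas N A) g"
      and \<gamma>: "riemannian_metric (boundary_atlas A) \<gamma>" and ind: "induces_on_boundary A N g \<gamma>" for N g \<gamma>
  proof -
    obtain \<Phi> where \<Phi>: "\<forall>p\<in>manifold_boundary A. \<Phi> (p, 0) = p"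
      "diffeomorphism (prod_topology (subtopology M (manifold_boundary A)) (top_of_set {0..<1})) (cylinder_atlas A)
          (subtopology M N) (restrict_atlas N A) \<Phi>"
      using N unfolding collar_neighborhood_def by blast
    obtain \<Psi> where "homeomorphic_maps (prod_topology (subtopology M (manifold_boundary A)) (top_of_set {0..<1}))
        (subtopology M N) \<Phi> \<Psi>"
      using \<Phi>(2) unfolding diffeomorphism_def by blast
    then have cm: "continuous_map (prod_topology (subtopology M (manifold_boundary A)) (top_of_set {0..<1})) (subtopology M N) \<Phi>"
      by (simp add: homeomorphic_maps_def)
    have top: "p \<in> topspace M" if "p \<in> manifold_boundary A" for p
      using that manifold unfolding manifold_boundary_def smooth_manifold_with_boundary_def smooth_atlas_def by blast
    \<comment> \<open>the identity \<open>\<Phi> (p, 0) = p\<close> puts the boundary inside \<open>N\<close>\<close>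
    have "manifold_boundary A \<subseteq> N"
    proof
      fix p assume p: "p \<in> manifold_boundary A"
      then have "(p, 0) \<in> topspace (prod_topology (subtopology M (manifold_boundary A)) (top_of_set {0..<1::real}))"
        using top[OF p] by simp
      then have "\<Phi> (p, 0) \<in> topspace (subtopology M N)" using cm by (meson continuous_map_image_subset_topspace image_subset_iff)
      then show "p \<in> N" using \<Phi>(1) p by simp
    qed
    moreover have "openin M N" using N by (simp add: collar_neighborhood_def)
    ultimately show ?thesis
      by (intro boundary_metric.intro boundary_neighborhood.intro bounded_manifold.intro boundary_neighborhood_axioms.intro
          boundary_metric_axioms.intro manifold g \<gamma> ind)
  qed
  show ?thesis
  proof (intro conjI impI allI notI; elim conjE exE bexE)
    fix k \<gamma> p N g
    assume k: "1 \<le> k" "k \<le> n - 3" and "4 \<le> n" and p: "p \<in> manifold_boundary A"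
      and le: "intermediate_ricci_le_at (boundary_atlas A) \<gamma> k p \<sigma>"
      and gt: "intermediate_ricci_gt (restrict_atlas N A) g k \<sigma>"
      and m: "collar_neighborhood M A N" "riemannian_metric (restrict_atlas N A) g"
        "riemannian_metric (boundary_atlas A) \<gamma>" "induces_on_boundary A N g \<gamma>"
    have "k + 2 \<le> DIM('e)" using k(2) \<open>4 \<le> n\<close> n by simp
    then show False by (rule boundary_metric.no_extension_at_point[OF bm[OF m] k(1) _ p le gt])
  next
    fix \<gamma> N g
    assume "3 \<le> n" and le: "ricci_le (boundary_atlas A) \<gamma> \<sigma>"
      and gt: "intermediate_ricci_gt (restrict_atlas N A) g (n - 2) \<sigma>"
      and m: "collar_neighborhood M A N" "riemannian_metric (restrict_atlas N A) g"
        "riemannian_metric (boundary_atlas A) \<gamma>" "induces_on_boundary A N g \<gamma>"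
    have "2 \<le> DIM('e)" "n - 2 = DIM('e) - 1" using \<open>3 \<le> n\<close> n by simp_all
    then show "tangent_bundle_splits (subtopology M (manifold_boundary A)) (boundary_atlas A)"
      using boundary_metric.boundary_tangent_bundle_splits[OF bm[OF m] _ le] gt by simp
  qed
qed

end
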